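(* Let $\gamma_\star\approx1.37184$ be the threshold defined in the context. There exist absolute constants $C>0$ and $\gamma_0\ge\gamma_\star$ such that for every $\gamma>\gamma_0$ the following holds for every wave on any curve of unidirectional solitary waves with constant adverse vorticity $\omega=-\gamma$ bifurcating from a shear (laminar) flow: (i) everywhere along the surface, $u(x,\eta(x))\ge\gamma\check\eta-C\gamma^{-5/2}$, where $|\gamma\check\eta-\sqrt{2\gamma}|\le C\gamma^{-1}$; that is, $u\ge\gamma\check\eta-O(\gamma^{-5/2})=\sqrt{2\gamma}-O(\gamma^{-1})$; (ii) at every crest, $u\ge\sqrt{2\gamma}-C\gamma^{-5/2}$ and $\hat\eta\le\sqrt{2/\gamma}+C\gamma^{-7/2}$; (iii) the amplitude satisfies $\hat\eta-\check\eta\le C\gamma^{-2}$. The same is true for unidirectional Stokes waves (on curves of unidirectional Stokes waves bifurcating from a shear flow) provided that the Bernoulli constant $r$ satisfies $$r\le\gamma+\sqrt{\frac2\gamma}.$$ The constants $C$ and $\gamma_0$ are independent of the solution and of the vorticity.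
   Context: Setting (non-dimensional steady water waves with relative mass flux and gravity both equal to $1$, constant vorticity $\omega=v_x-u_y=-\gamma<0$). A solution consists of a smooth surface profile $\eta:\mathbb{R}\to(0,\infty)$, a stream function $\psi$ smooth up to the boundary of $D=\{(x,y):x\in\mathbb{R},\ 0<y<\eta(x)\}$, and a Bernoulli constant $r\in\mathbb{R}$, with $\Delta\psi=\gamma$ in $D$; $\frac12|\nabla\psi|^2+y=r$ on $y=\eta(x)$; $\psi=1$ on $y=\eta(x)$; $\psi=0$ on $y=0$. The relative velocity is $(u,v)=(\psi_y,-\psi_x)$. The solution is unidirectional if $u=\psi_y>0$ everywhere in the fluid (including its boundary). A Stokes wave is a solution periodic in $x$ whose profile $\eta$ has exactly one crest and one trough in each minimal period. A solitary wave is a non-laminar solution converging uniformly to a flat background (laminar) state as $|x|\to\infty$; unidirectional solitary waves are known to be waves of elevation with exactly one crest. Waves are translated so that a crest is at $x=0$. Write $\hat\eta=\sup_x\eta(x)$, $\check\eta=\inf_x\eta(x)$ (for a solitary wave of elevation the latter is the depth at infinity), and $\hat u=\psi_y(0,\hat\eta)$. A shear (laminar) flow is a solution with horizontal velocity and flat surface; the unidirectional ones are $\psi=\frac12\gamma y^2+sy$, $\eta=d(s)$, $r=R(s)$ with $s>0$, where $d(s)=\dfrac{-s+\sqrt{s^2+2\gamma}}{\gamma}$ and $R(s)=\frac12s^2+\gamma+d(s)$. The function $R$ has a unique critical point $s_c=s_c(\gamma)>0$ (its minimum). The threshold $\gamma_\star\approx1.37184$ is the unique $\gamma>0$ with $R(s_c(\gamma))=\frac{\gamma}{2}+\frac{2}{\sqrt\gamma}$.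 A curve of waves bifurcating from a shear flow is a continuous one-parameter family of solutions, $\gamma$ being fixed, parametrized by $t\in[0,T)$, whose member at $t=0$ is a unidirectional laminar flow ($s>0$) and whose members for $t>0$ are waves of the stated type; in particular $r$, $\hat\eta$ and $\hat u$ depend continuously on $t$ (the period of Stokes waves may vary). *)

theory Defs
  imports "HOL-Analysis.Analysis"
begin

definition fluid :: "(real \<Rightarrow> real) \<Rightarrow> (real \<times> real) set" where
  "fluid \<eta> = {(x, y). 0 < y \<and> y < \<eta> x}"

definition closed_fluid :: "(real \<Rightarrow> real) \<Rightarrow> (real \<times> real) set" where
  "closed_fluid \<eta> = {(x, y). 0 \<le> y \<and> y \<le> \<eta> x}"

(* Partial derivatives are read off the Frechet derivative within S. At interior points of S
   these are the ordinary partial derivatives. If S is a closed fluid domain with smooth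
   surface, the derivative within S is unique also at boundary points, so these are the
   boundary values of the partial derivatives. *)

definition dx :: "(real \<times> real) set \<Rightarrow> (real \<times> real \<Rightarrow> real) \<Rightarrow> real \<times> real \<Rightarrow> real" where
  "dx S f z = frechet_derivative f (at z within S) (1, 0)"

definition dy :: "(real \<times> real) set \<Rightarrow> (real \<times> real \<Rightarrow> real) \<Rightarrow> real \<times> real \<Rightarrow> real" where
  "dy S f z = frechet_derivative f (at z within S) (0, 1)"

primrec Ck_on :: "nat \<Rightarrow> (real \<times> real) set \<Rightarrow> (real \<times> real \<Rightarrow> real) \<Rightarrow> bool" where
  "Ck_on 0 S f \<longleftrightarrow> continuous_on S f"
| "Ck_on (Suc k) S f \<longleftrightarrow> f differentiable_on S \<and> Ck_on k S (dx S f) \<and> Ck_on k S (dy S f)"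

definition smooth_on_closed :: "(real \<times> real) set \<Rightarrow> (real \<times> real \<Rightarrow> real) \<Rightarrow> bool" where
  "smooth_on_closed S f \<longleftrightarrow> (\<forall>k. Ck_on k S f)"

definition smooth_profile :: "(real \<Rightarrow> real) \<Rightarrow> bool" where
  "smooth_profile \<eta> \<longleftrightarrow> (\<forall>k x. ((deriv ^^ k) \<eta>) differentiable (at x))"

definition vel_u :: "(real \<Rightarrow> real) \<Rightarrow> (real \<times> real \<Rightarrow> real) \<Rightarrow> real \<times> real \<Rightarrow> real" where
  "vel_u \<eta> \<psi> z = dy (closed_fluid \<eta>) \<psi> z"

definition vel_v :: "(real \<Rightarrow> real) \<Rightarrow> (real \<times> real \<Rightarrow> real) \<Rightarrow> real \<times> real \<Rightarrow> real" where
  "vel_v \<eta> \<psi> z = - dx (closed_fluid \<eta>) \<psi> z"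

(* Only the values of \<psi> on the closed fluid domain are relevant here and below. *)

definition solution ::
    "real \<Rightarrow> (real \<Rightarrow> real) \<Rightarrow> (real \<times> real \<Rightarrow> real) \<Rightarrow> real \<Rightarrow> bool" where
  "solution \<gamma> \<eta> \<psi> r \<longleftrightarrow>
     smooth_profile \<eta> \<and> (\<forall>x. 0 < \<eta> x) \<and>
     (let S = closed_fluid \<eta> in
        smooth_on_closed S \<psi> \<and>
        (\<forall>z\<in>fluid \<eta>. dx S (dx S \<psi>) z + dy S (dy S \<psi>) z = \<gamma>) \<and>
        (\<forall>x. ((dx S \<psi> (x, \<eta> x))\<^sup>2 + (dy S \<psi> (x, \<eta> x))\<^sup>2) / 2 + \<eta> x = r) \<and>
        (\<forall>x. \<psi> (x, \<eta> x) = 1) \<and>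
        (\<forall>x. \<psi> (x, 0) = 0))"

definition unidirectional :: "(real \<Rightarrow> real) \<Rightarrow> (real \<times> real \<Rightarrow> real) \<Rightarrow> bool" where
  "unidirectional \<eta> \<psi> \<longleftrightarrow> (\<forall>z\<in>closed_fluid \<eta>. 0 < vel_u \<eta> \<psi> z)"

definition laminar ::
    "real \<Rightarrow> (real \<Rightarrow> real) \<Rightarrow> (real \<times> real \<Rightarrow> real) \<Rightarrow> real \<Rightarrow> bool" where
  "laminar \<gamma> \<eta> \<psi> r \<longleftrightarrow>
     solution \<gamma> \<eta> \<psi> r \<and> (\<exists>d. \<forall>x. \<eta> x = d) \<and> (\<forall>z\<in>closed_fluid \<eta>. vel_v \<eta> \<psi> z = 0)"

definition eta_max :: "(real \<Rightarrow> real) \<Rightarrow> real" where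
  "eta_max \<eta> = (SUP x. \<eta> x)"

definition eta_min :: "(real \<Rightarrow> real) \<Rightarrow> real" where
  "eta_min \<eta> = (INF x. \<eta> x)"

definition crest :: "(real \<Rightarrow> real) \<Rightarrow> real \<Rightarrow> bool" where
  "crest \<eta> x \<longleftrightarrow> (\<forall>\<^sub>F x' in nhds x. \<eta> x' \<le> \<eta> x)"

definition trough :: "(real \<Rightarrow> real) \<Rightarrow> real \<Rightarrow> bool" where
  "trough \<eta> x \<longleftrightarrow> (\<forall>\<^sub>F x' in nhds x. \<eta> x \<le> \<eta> x')"

definition wave_period :: "real \<Rightarrow> (real \<Rightarrow> real) \<Rightarrow> (real \<times> real \<Rightarrow> real) \<Rightarrow> bool" where
  "wave_period p \<eta> \<psi> \<longleftrightarrow>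
     0 < p \<and> (\<forall>x. \<eta> (x + p) = \<eta> x) \<and> (\<forall>(x, y)\<in>closed_fluid \<eta>. \<psi> (x + p, y) = \<psi> (x, y))"

definition stokes_wave ::
    "real \<Rightarrow> (real \<Rightarrow> real) \<Rightarrow> (real \<times> real \<Rightarrow> real) \<Rightarrow> real \<Rightarrow> bool" where
  "stokes_wave \<gamma> \<eta> \<psi> r \<longleftrightarrow>
     solution \<gamma> \<eta> \<psi> r \<and>
     (\<exists>p. wave_period p \<eta> \<psi> \<and> (\<forall>q. wave_period q \<eta> \<psi> \<longrightarrow> p \<le> q) \<and>
          (\<exists>!x. x \<in> {0..<p} \<and> crest \<eta> x) \<and> (\<exists>!x. x \<in> {0..<p} \<and> trough \<eta> x))"

(* Every laminar flow has a stream function \<gamma> y^2 / 2 + s y with s real. Its velocity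
   (\<gamma> y + s, 0) makes sense for all y, so the two flows can be compared although their
   domains differ. *)

definition solitary_wave ::
    "real \<Rightarrow> (real \<Rightarrow> real) \<Rightarrow> (real \<times> real \<Rightarrow> real) \<Rightarrow> real \<Rightarrow> bool" where
  "solitary_wave \<gamma> \<eta> \<psi> r \<longleftrightarrow>
     solution \<gamma> \<eta> \<psi> r \<and> \<not> laminar \<gamma> \<eta> \<psi> r \<and>
     (\<exists>d s. laminar \<gamma> (\<lambda>_. d) (\<lambda>(x, y). \<gamma> * y\<^sup>2 / 2 + s * y) r \<and>
        (\<eta> \<longlongrightarrow> d) at_infinity \<and>
        (\<forall>\<epsilon>>0. \<forall>\<^sub>F x in at_infinity. \<forall>y\<in>{0..\<eta> x}.
           \<bar>vel_u \<eta> \<psi> (x, y) - (\<gamma> * y + s)\<bar> < \<epsilon> \<and> \<bar>vel_v \<eta> \<psi> (x, y)\<bar> < \<epsilon>))"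

definition shear_depth :: "real \<Rightarrow> real \<Rightarrow> real" where
  "shear_depth \<gamma> s = (- s + sqrt (s\<^sup>2 + 2 * \<gamma>)) / \<gamma>"

definition shear_bernoulli :: "real \<Rightarrow> real \<Rightarrow> real" where
  "shear_bernoulli \<gamma> s = s\<^sup>2 / 2 + \<gamma> + shear_depth \<gamma> s"

definition s_crit :: "real \<Rightarrow> real" where
  "s_crit \<gamma> = (THE s. 0 < s \<and> (shear_bernoulli \<gamma> has_real_derivative 0) (at s))"

definition gamma_star :: real where
  "gamma_star = (THE \<gamma>. 0 < \<gamma> \<and> shear_bernoulli \<gamma> (s_crit \<gamma>) = \<gamma> / 2 + 2 / sqrt \<gamma>)"

(* The waves at parameters 0 < t < T are normalised to have a (highest) crest at x = 0, so that
   (0, eta_max) is a point of the surface. Of the continuity of the family in t, only that of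
   the Bernoulli constant, the crest height and the crest velocity is demanded. This is implied
   by continuity in any of the usual function spaces, also with varying periods. *)

definition bifurcating_curve ::
    "(real \<Rightarrow> (real \<Rightarrow> real) \<Rightarrow> (real \<times> real \<Rightarrow> real) \<Rightarrow> real \<Rightarrow> bool) \<Rightarrow> real \<Rightarrow> ereal \<Rightarrow>
     (real \<Rightarrow> real \<Rightarrow> real) \<Rightarrow> (real \<Rightarrow> real \<times> real \<Rightarrow> real) \<Rightarrow> (real \<Rightarrow> real) \<Rightarrow> bool" where
  "bifurcating_curve W \<gamma> T \<eta> \<psi> r \<longleftrightarrow>
     0 < T \<and>
     laminar \<gamma> (\<eta> 0) (\<psi> 0) (r 0) \<and> unidirectional (\<eta> 0) (\<psi> 0) \<and>
     (\<forall>t. 0 < t \<and> ereal t < T \<longrightarrow>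
        W \<gamma> (\<eta> t) (\<psi> t) (r t) \<and> unidirectional (\<eta> t) (\<psi> t) \<and> (\<forall>x. \<eta> t x \<le> \<eta> t 0)) \<and>
     (let I = {t. 0 \<le> t \<and> ereal t < T} in
        continuous_on I r \<and>
        continuous_on I (\<lambda>t. eta_max (\<eta> t)) \<and>
        continuous_on I (\<lambda>t. vel_u (\<eta> t) (\<psi> t) (0, eta_max (\<eta> t))))"

end

theory Submission
  imports Defs "HOL-Complex_Analysis.Complex_Analysis"
begin

text \<open>Write \<open>a = sqrt (2 / \<gamma>)\<close>. Comparing \<open>\<psi>\<close> with the shear flow of the same depth, at a lowest trough
  and at a highest crest (or using the background at infinity), gives \<open>r \<ge> 2 / a\<^sup>2 + a - a\<^sup>4 / 8\<close>, the minimum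
  over all shear flows up to higher order, and bounds the crest velocity from above. The maximum
  principle for \<open>|\<nabla>\<psi>|\<^sup>2 / 2 - \<gamma> \<psi> / 2 + y\<close> bounds the downward curvature of the surface, so a half-disc
  centred on the bed fits under the crest and touches it. In this half-disc the difference \<open>\<phi> \<ge> 0\<close>
  between \<open>\<psi>\<close> and the shear flow of crest depth \<open>h\<close> is harmonic and vanishes on the bed and at the crest.
  If \<open>h > a\<close>, that shear flow runs backwards at the bed, so \<open>\<phi>\<close> has slope at least \<open>\<gamma> h / 2 - 1 / h\<close> there,
  and a Harnack type inequality costs at least a quarter of that slope in the crest velocity. For
  \<open>h = a + a\<^sup>7\<close> and large \<open>\<gamma>\<close> this contradicts the lower bound for \<open>r\<close>. As the crest height is
  continuous along the curve and starts below \<open>a\<close>, it stays below \<open>a + a\<^sup>7\<close>; the other estimates follow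
  from this bound, the energies of the shear flows and the curvature bound.\<close>

section \<open>Calculus on the fluid domain\<close>

text \<open>The exponent 7 comes from balancing two losses. Put \<open>c = a ^ 6\<close>, so that
  the barrier is \<open>h = a * (1 + c)\<close>. For crests up to this height the bound on
  \<open>r\<close> leaves the crest velocity at most \<open>a ^ 5 / 4 = c / (4 * a)\<close> below
  \<open>2 / a\<close>, and the shear velocity of depth \<open>h\<close> exceeds
  \<open>2 / a\<close> only by order \<open>c\<^sup>2 / a\<close>. The backward bed velocity of that
  shear flow is about \<open>2 * c / a\<close>; a quarter of it, \<open>c / (2 * a)\<close>, is more
  than the velocities allow. With these estimates a barrier of smaller order would not work. The
  barrier is a forbidden value, not an upper bound for a single wave: a much higher crest could be
  slow, the curvature bound degenerates as the crest speed tends to 0, and the half-disc might then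
  leave the fluid. This is why the curve of waves is needed. At the barrier the curvature is at most
  about \<open>1 / (2 * a)\<close>, against \<open>1 / h\<close> for the circle, so there is ample
  room.\<close>

lemma has_derivative_dx_dy:
  assumes "f differentiable_on S" "z \<in> S"
  shows "(f has_derivative (\<lambda>h. dx S f z * fst h + dy S f z * snd h)) (at z within S)"
proof -
  let ?D = "frechet_derivative f (at z within S)"
  have D: "(f has_derivative ?D) (at z within S)"
    using assms by (simp add: differentiable_on_def frechet_derivative_works)
  interpret linear ?D
    using D by (rule has_derivative_linear)
  have "?D h = dx S f z * fst h + dy S f z * snd h" for h
  proof -
    have "h = fst h *\<^sub>R (1, 0) + snd h *\<^sub>R (0, 1)"
      by (simp add: prod_eq_iff)
    then have "?D h = ?D (fst h *\<^sub>R (1, 0) + snd h *\<^sub>R (0, 1))"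
      by simp
    also have "\<dots> = dx S f z * fst h + dy S f z * snd h"
      unfolding add scale dx_def dy_def by simp
    finally show ?thesis .
  qed
  then have "?D = (\<lambda>h. dx S f z * fst h + dy S f z * snd h)"
    by blast
  with D show ?thesis
    by simp
qed

text \<open>The second difference over a square of side \<open>h\<close> is \<open>h * h\<close>
  times either mixed partial at some point of the square, by the mean value theorem applied in the
  two orders; continuity at the corner \<open>(x, y)\<close> then forces equality.\<close>

lemma mixed_partials_eq:
  fixes f fx fy fxy fyx :: "real \<times> real \<Rightarrow> real"
  assumes e: "0 < e"
    and fx: "\<And>s t. \<bar>s - x\<bar> < e \<Longrightarrow> \<bar>t - y\<bar> < e \<Longrightarrow> ((\<lambda>s. f (s, t)) has_real_derivative fx (s, t)) (at s)"
    and fy: "\<And>s t. \<bar>s - x\<bar> < e \<Longrightarrow> \<bar>t - y\<bar> < e \<Longrightarrow> ((\<lambda>t. f (s, t)) has_real_derivative fy (s, t)) (at t)"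
    and fxy: "\<And>s t. \<bar>s - x\<bar> < e \<Longrightarrow> \<bar>t - y\<bar> < e \<Longrightarrow> ((\<lambda>t. fx (s, t)) has_real_derivative fxy (s, t)) (at t)"
    and fyx: "\<And>s t. \<bar>s - x\<bar> < e \<Longrightarrow> \<bar>t - y\<bar> < e \<Longrightarrow> ((\<lambda>s. fy (s, t)) has_real_derivative fyx (s, t)) (at s)"
    and cont: "isCont fxy (x, y)" "isCont fyx (x, y)"
  shows "fxy (x, y) = fyx (x, y)"
proof (rule ccontr)
  assume neq: "fxy (x, y) \<noteq> fyx (x, y)"
  define c where "c = \<bar>fxy (x, y) - fyx (x, y)\<bar> / 2"
  have c: "0 < c"
    using neq by (simp add: c_def)
  obtain d1 where d1: "0 < d1" "\<And>z. dist z (x, y) < d1 \<Longrightarrow> dist (fxy z) (fxy (x, y)) < c"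
    using cont(1) c unfolding continuous_at_eps_delta by blast
  obtain d2 where d2: "0 < d2" "\<And>z. dist z (x, y) < d2 \<Longrightarrow> dist (fyx z) (fyx (x, y)) < c"
    using cont(2) c unfolding continuous_at_eps_delta by blast
  define h where "h = min e (min d1 d2) / 2"
  have h: "0 < h" "h < e" "2 * h \<le> d1" "2 * h \<le> d2"
    using e d1(1) d2(1) by (auto simp: h_def)
  have near: "dist (s, t) (x, y) < 2 * h" if "x < s" "s < x + h" "y < t" "t < y + h" for s t
  proof -
    have "dist (s, t) (x, y) \<le> \<bar>s - x\<bar> + \<bar>t - y\<bar>"
      by (simp add: dist_prod_def dist_real_def sqrt_sum_squares_le_sum_abs)
    with that show ?thesis
      by linarith
  qed
  define D where "D = f (x + h, y + h) - f (x, y + h) - f (x + h, y) + f (x, y)"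
  have "\<exists>s t. x < s \<and> s < x + h \<and> y < t \<and> t < y + h \<and> D = h * (h * fxy (s, t))"
  proof -
    have "\<exists>s>x. s < x + h \<and>
        (f (x + h, y + h) - f (x + h, y)) - (f (x, y + h) - f (x, y))
        = (x + h - x) * (fx (s, y + h) - fx (s, y))"
      using h by (intro MVT2) (auto intro!: derivative_eq_intros fx)
    then obtain s where s: "x < s" "s < x + h" "D = h * (fx (s, y + h) - fx (s, y))"
      by (auto simp: D_def)
    have "\<exists>t>y. t < y + h \<and> fx (s, y + h) - fx (s, y) = (y + h - y) * fxy (s, t)"
      using h s by (intro MVT2) (auto intro!: fxy)
    with s show ?thesis
      by auto
  qed
  then obtain s t where st: "x < s" "s < x + h" "y < t" "t < y + h" "D = h * (h * fxy (s, t))"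
    by blast
  have "\<exists>s t. x < s \<and> s < x + h \<and> y < t \<and> t < y + h \<and> D = h * (h * fyx (s, t))"
  proof -
    have "\<exists>t>y. t < y + h \<and>
        (f (x + h, y + h) - f (x, y + h)) - (f (x + h, y) - f (x, y))
        = (y + h - y) * (fy (x + h, t) - fy (x, t))"
      using h by (intro MVT2) (auto intro!: derivative_eq_intros fy)
    then obtain t where t: "y < t" "t < y + h" "D = h * (fy (x + h, t) - fy (x, t))"
      by (auto simp: D_def)
    have "\<exists>s>x. s < x + h \<and> fy (x + h, t) - fy (x, t) = (x + h - x) * fyx (s, t)"
      using h t by (intro MVT2) (auto intro!: fyx)
    with t show ?thesis
      by auto
  qed
  then obtain s' t' where st': "x < s'" "s' < x + h" "y < t'" "t' < y + h" "D = h * (h * fyx (s', t'))"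
    by blast
  have eq: "fxy (s, t) = fyx (s', t')"
    using st(5) st'(5) h(1) by simp
  have "\<bar>fxy (s, t) - fxy (x, y)\<bar> < c"
    using d1(2)[of "(s, t)"] near[OF st(1-4)] h by (simp add: dist_real_def)
  moreover have "\<bar>fyx (s', t') - fyx (x, y)\<bar> < c"
    using d2(2)[of "(s', t')"] near[OF st'(1-4)] h by (simp add: dist_real_def)
  moreover have "\<bar>fxy (x, y) - fyx (x, y)\<bar> = 2 * c"
    by (simp add: c_def)
  ultimately show False
    using eq by linarith
qed

lemma local_max_second_derivative:
  fixes f :: "real \<Rightarrow> real"
  assumes e: "0 < e"
    and f: "\<And>t. \<bar>t - x\<bar> < e \<Longrightarrow> (f has_real_derivative f' t) (at t)"
    and f': "(f' has_real_derivative c) (at x)"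
    and max: "\<And>t. \<bar>t - x\<bar> < e \<Longrightarrow> f t \<le> f x"
  shows "c \<le> 0"
proof (rule ccontr)
  assume "\<not> c \<le> 0"
  have "f' x = 0"
    using DERIV_local_max[of f "f' x" x e] f[of x] max e by (simp add: abs_minus_commute)
  then obtain d where d: "0 < d" "\<And>h. 0 < h \<Longrightarrow> h < d \<Longrightarrow> 0 < f' (x + h)"
    using DERIV_pos_inc_right[OF f'] \<open>\<not> c \<le> 0\<close> by auto
  define k where "k = min d e / 2"
  have k: "0 < k" "k < d" "k < e"
    using d(1) e by (auto simp: k_def)
  have "\<exists>z>x. z < x + k \<and> f (x + k) - f x = (x + k - x) * f' z"
    using k by (intro MVT2) (auto intro!: f)
  then obtain z where z: "x < z" "z < x + k" "f (x + k) - f x = k * f' z"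
    by auto
  have "0 < f' z"
    using d(2)[of "z - x"] z k by simp
  then have "f x < f (x + k)"
    using z(3) k by (smt (verit) mult_pos_pos)
  moreover have "f (x + k) \<le> f x"
    using k by (intro max) auto
  ultimately show False
    by simp
qed

text \<open>One-sided, because at the surface \<open>dy\<close> is only a derivative within the
  closed fluid. All velocity comparisons at crests and troughs end with this.\<close>

lemma endpoint_max_imp_deriv_nonneg:
  fixes f :: "real \<Rightarrow> real"
  assumes "a < b" and D: "(f has_real_derivative D) (at b within {a..b})"
    and max: "\<And>t. a < t \<Longrightarrow> t < b \<Longrightarrow> f t \<le> f b"
  shows "0 \<le> D"
proof (rule ccontr)
  assume "\<not> 0 \<le> D"
  then obtain d where d: "0 < d" "\<And>h. 0 < h \<Longrightarrow> b - h \<in> {a..b} \<Longrightarrow> h < d \<Longrightarrow> f b < f (b - h)"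
    using has_real_derivative_neg_dec_left[OF D] by auto
  define h where "h = min d (b - a) / 2"
  have "0 < h" "h < d" "h < b - a"
    using d(1) assms(1) by (auto simp: h_def min_def)
  then show False
    using d(2)[of h] max[of "b - h"] by auto
qed

section \<open>Topology of the fluid domain and derivatives within it\<close>

lemma closed_fluid_iff [simp]: "(x, y) \<in> closed_fluid \<eta> \<longleftrightarrow> 0 \<le> y \<and> y \<le> \<eta> x"
  by (simp add: closed_fluid_def)

lemma fluid_iff [simp]: "(x, y) \<in> fluid \<eta> \<longleftrightarrow> 0 < y \<and> y < \<eta> x"
  by (simp add: fluid_def)

lemma open_fluid:
  assumes "continuous_on UNIV \<eta>"
  shows "open (fluid \<eta>)"
proof -
  have "fluid \<eta> = {z. 0 < snd z} \<inter> {z. snd z < \<eta> (fst z)}"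
    by auto
  moreover have "open {z::real \<times> real. 0 < snd z}" "open {z. snd z < \<eta> (fst z)}"
    by (intro open_Collect_less continuous_intros continuous_on_compose2[OF assms] | simp)+
  ultimately show ?thesis
    by auto
qed

lemma closed_closed_fluid:
  assumes "continuous_on UNIV \<eta>"
  shows "closed (closed_fluid \<eta>)"
proof -
  have "closed_fluid \<eta> = {z. 0 \<le> snd z} \<inter> {z. snd z \<le> \<eta> (fst z)}"
    by auto
  moreover have "closed {z::real \<times> real. 0 \<le> snd z}" "closed {z. snd z \<le> \<eta> (fst z)}"
    by (intro closed_Collect_le continuous_intros continuous_on_compose2[OF assms] | simp)+
  ultimately show ?thesis
    by auto
qed

lemma closed_fluid_subset_closure:
  assumes pos: "\<And>x. 0 < \<eta> x"
  shows "closed_fluid \<eta> \<subseteq> closure (fluid \<eta>)"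
proof
  fix z assume "z \<in> closed_fluid \<eta>"
  then obtain x y where z: "z = (x, y)" "0 \<le> y" "y \<le> \<eta> x"
    by (cases z) auto
  \<comment> \<open>The points move along the vertical towards mid-depth, which keeps them off bed
    and surface.\<close>
  define w where "w n = (x, y + inverse (real (Suc n)) * (\<eta> x / 2 - y))" for n
  have "w \<longlonglongrightarrow> (x, y + 0 * (\<eta> x / 2 - y))"
    unfolding w_def by (intro tendsto_intros LIMSEQ_inverse_real_of_nat)
  moreover have "w n \<in> fluid \<eta>" for n
  proof -
    define l where "l = inverse (real (Suc n))"
    have l: "0 < l" "l \<le> 1"
      by (auto simp: l_def field_simps)
    have eq: "y + l * (\<eta> x / 2 - y) = (1 - l) * y + l * (\<eta> x / 2)"
      by (simp add: algebra_simps)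
    have "0 < l * (\<eta> x / 2)" "l * (\<eta> x / 2) < l * \<eta> x" "0 \<le> (1 - l) * y" "(1 - l) * y \<le> (1 - l) * \<eta> x"
      using l z pos[of x] by (auto intro: mult_left_mono)
    then show ?thesis
      unfolding w_def l_def[symmetric] fluid_iff eq by (auto simp: algebra_simps)
  qed
  ultimately show "z \<in> closure (fluid \<eta>)"
    unfolding closure_sequential z(1) by auto
qed

text \<open>Identities between derivatives are proved in the interior, where derivatives are
  two-sided, and carried to bed and surface by density.\<close>

lemma closed_fluid_eqI:
  fixes f g :: "real \<times> real \<Rightarrow> real"
  assumes "\<And>x. 0 < \<eta> x" "continuous_on UNIV \<eta>"
    and "continuous_on (closed_fluid \<eta>) f" "continuous_on (closed_fluid \<eta>) g"
    and "\<And>z. z \<in> fluid \<eta> \<Longrightarrow> f z = g z" "z \<in> closed_fluid \<eta>"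
  shows "f z = g z"
proof -
  have "fluid \<eta> \<subseteq> closed_fluid \<eta>"
    by (auto simp: fluid_def closed_fluid_def)
  then have "closure (fluid \<eta>) = closed_fluid \<eta>"
    using closed_fluid_subset_closure[of \<eta>] closed_closed_fluid[OF assms(2)] assms(1)
    by (metis closure_minimal subset_antisym)
  then have "f z - g z = 0"
    using continuous_constant_on_closure[of "fluid \<eta>" "\<lambda>z. f z - g z" 0 z] assms
    by (auto intro!: continuous_intros)
  then show ?thesis
    by simp
qed

text \<open>A derivative within \<open>S\<close> controls only increments inside \<open>S\<close>,
  so the curve has to stay in \<open>S\<close>; the surface, the bed and vertical segments
  do.\<close>

lemma deriv_along_curve:
  fixes f :: "real \<times> real \<Rightarrow> real"
  assumes f: "f differentiable_on S" and c: "(c has_real_derivative c') (at t within T)"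
    and d: "(d has_real_derivative d') (at t within T)"
    and sub: "\<And>t. t \<in> T \<Longrightarrow> (c t, d t) \<in> S" and t: "t \<in> T"
  shows "((\<lambda>t. f (c t, d t)) has_real_derivative
            dx S f (c t, d t) * c' + dy S f (c t, d t) * d') (at t within T)"
proof -
  have cd: "((\<lambda>t. (c t, d t)) has_derivative (\<lambda>h. (c' * h, d' * h))) (at t within T)"
    using c d unfolding has_field_derivative_def by (rule has_derivative_Pair)
  have "(f has_derivative (\<lambda>h. dx S f (c t, d t) * fst h + dy S f (c t, d t) * snd h))
          (at (c t, d t) within (\<lambda>t. (c t, d t)) ` T)"
    using has_derivative_dx_dy[OF f sub[OF t]] by (rule has_derivative_subset) (use sub in auto)
  from has_derivative_in_compose[OF cd this] show ?thesis
    unfolding has_field_derivative_def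
    by (rule has_derivative_eq_rhs) (auto simp: fun_eq_iff algebra_simps)
qed

lemma fluid_imp_closed_fluid: "z \<in> fluid \<eta> \<Longrightarrow> z \<in> closed_fluid \<eta>"
  by (auto simp: fluid_def closed_fluid_def)

lemma at_within_closed_fluid:
  assumes "continuous_on UNIV \<eta>" "z \<in> fluid \<eta>"
  shows "at z within closed_fluid \<eta> = at z"
  by (rule at_within_open_subset[OF assms(2) open_fluid[OF assms(1)]]) (auto simp: fluid_imp_closed_fluid)

lemma has_derivative_interior:
  assumes "f differentiable_on closed_fluid \<eta>" "continuous_on UNIV \<eta>" "z \<in> fluid \<eta>"
  shows "(f has_derivative (\<lambda>h. dx (closed_fluid \<eta>) f z * fst h + dy (closed_fluid \<eta>) f z * snd h)) (at z)"
  using has_derivative_dx_dy[OF assms(1) fluid_imp_closed_fluid[OF assms(3)]]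
  by (simp add: at_within_closed_fluid assms)

lemma dx_interior:
  assumes "f differentiable_on closed_fluid \<eta>" "continuous_on UNIV \<eta>" "(x, y) \<in> fluid \<eta>"
  shows "((\<lambda>s. f (s, y)) has_real_derivative dx (closed_fluid \<eta>) f (x, y)) (at x)"
proof -
  have "((\<lambda>s. (s, y)) has_derivative (\<lambda>h. (h, 0))) (at x)"
    by (auto intro!: derivative_eq_intros)
  from has_derivative_compose[OF this has_derivative_interior[OF assms]] show ?thesis
    unfolding has_field_derivative_def by simp
qed

lemma dy_interior:
  assumes "f differentiable_on closed_fluid \<eta>" "continuous_on UNIV \<eta>" "(x, y) \<in> fluid \<eta>"
  shows "((\<lambda>t. f (x, t)) has_real_derivative dy (closed_fluid \<eta>) f (x, y)) (at y)"
proof -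
  have "((\<lambda>t. (x, t)) has_derivative (\<lambda>h. (0, h))) (at y)"
    by (auto intro!: derivative_eq_intros)
  from has_derivative_compose[OF this has_derivative_interior[OF assms]] show ?thesis
    unfolding has_field_derivative_def by simp
qed

lemma dy_vertical:
  assumes "f differentiable_on closed_fluid \<eta>" "(x, y) \<in> closed_fluid \<eta>"
  shows "((\<lambda>t. f (x, t)) has_real_derivative dy (closed_fluid \<eta>) f (x, y)) (at y within {0..\<eta> x})"
  using deriv_along_curve[OF assms(1), of "\<lambda>_. x" 0 y "{0..\<eta> x}" "\<lambda>t. t" 1] assms(2)
  by (auto intro!: derivative_eq_intros)

lemma fluid_box:
  assumes "continuous_on UNIV \<eta>" "(x, y) \<in> fluid \<eta>"
  obtains e where "0 < e" "\<And>s t. \<bar>s - x\<bar> < e \<Longrightarrow> \<bar>t - y\<bar> < e \<Longrightarrow> (s, t) \<in> fluid \<eta>"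
proof -
  obtain d where d: "0 < d" "ball (x, y) d \<subseteq> fluid \<eta>"
    using open_fluid[OF assms(1)] assms(2) by (meson open_contains_ball)
  have "(s, t) \<in> fluid \<eta>" if "\<bar>s - x\<bar> < d / 2" "\<bar>t - y\<bar> < d / 2" for s t
  proof -
    have "dist (x, y) (s, t) \<le> \<bar>x - s\<bar> + \<bar>y - t\<bar>"
      by (simp add: dist_prod_def dist_real_def sqrt_sum_squares_le_sum_abs)
    then have "dist (x, y) (s, t) < d"
      using that by linarith
    with d show ?thesis
      by auto
  qed
  with d(1) show thesis
    by (intro that[of "d / 2"]) auto
qed

text \<open>A Phragmen--Lindelof argument: adding \<open>- k x\<^sup>2 + 2 k y\<^sup>2\<close> makes \<open>G\<close> strictly subharmonic and
  forces its maximum to be attained, without changing the sign of the normal derivative on the bed.\<close>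

lemma max_principle:
  fixes \<eta> :: "real \<Rightarrow> real"
  assumes \<eta>: "continuous_on UNIV \<eta>" "\<And>x. 0 < \<eta> x" "\<And>x. \<eta> x \<le> H"
    and G: "continuous_on (closed_fluid \<eta>) G" "\<And>z. z \<in> closed_fluid \<eta> \<Longrightarrow> G z \<le> B"
    and Gx: "\<And>x y. (x, y) \<in> fluid \<eta> \<Longrightarrow> ((\<lambda>s. G (s, y)) has_real_derivative Gx (x, y)) (at x)"
    and Gy: "\<And>x y. (x, y) \<in> fluid \<eta> \<Longrightarrow> ((\<lambda>t. G (x, t)) has_real_derivative Gy (x, y)) (at y)"
    and Gxx: "\<And>x y. (x, y) \<in> fluid \<eta> \<Longrightarrow> ((\<lambda>s. Gx (s, y)) has_real_derivative Gxx (x, y)) (at x)"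
    and Gyy: "\<And>x y. (x, y) \<in> fluid \<eta> \<Longrightarrow> ((\<lambda>t. Gy (x, t)) has_real_derivative Gyy (x, y)) (at y)"
    and sub: "\<And>z. z \<in> fluid \<eta> \<Longrightarrow> 0 \<le> Gxx z + Gyy z"
    and top: "\<And>x. G (x, \<eta> x) \<le> M"
    and bed: "\<And>x. G (x, 0) \<le> M \<or> (\<exists>D>0. ((\<lambda>t. G (x, t)) has_real_derivative D) (at 0 within {0..\<eta> x}))"
    and z: "z \<in> closed_fluid \<eta>"
  shows "G z \<le> M"
proof (rule ccontr)
  assume "\<not> G z \<le> M"
  obtain x0 y0 where z0: "z = (x0, y0)"
    by (cases z)
  define c where "c = G z - M"
  have c: "0 < c"
    using \<open>\<not> G z \<le> M\<close> by (simp add: c_def)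
  define k where "k = c / (x0\<^sup>2 + 2 * H\<^sup>2 + 1)"
  have den: "0 < x0\<^sup>2 + 2 * H\<^sup>2 + 1"
    by (simp add: add_nonneg_pos)
  have k: "0 < k"
    using c den by (simp add: k_def)
  have "k * (x0\<^sup>2 + 2 * H\<^sup>2 + 1) = c"
    using den by (simp add: k_def)
  then have kc: "k * x0\<^sup>2 + 2 * k * H\<^sup>2 < c"
    using k by (simp add: algebra_simps)
  define F where "F = (\<lambda>z. G z - k * (fst z)\<^sup>2 + 2 * k * (snd z)\<^sup>2)"
  have Fz: "M + 2 * k * H\<^sup>2 < F z"
    using kc k z0 by (simp add: F_def c_def algebra_simps) (smt (verit) mult_nonneg_nonneg zero_le_power2)
  have H: "y\<^sup>2 \<le> H\<^sup>2" if "(x, y) \<in> closed_fluid \<eta>" for x y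
    using that \<eta>(3)[of x] by (intro power_mono) auto
  \<comment> \<open>Beyond \<open>N\<close> the term \<open>k * x\<^sup>2\<close> outweighs
    \<open>B - M\<close>, so \<open>F\<close> cannot exceed its value at \<open>z\<close>
    there.\<close>
  define N where "N = sqrt (\<bar>B - M\<bar> / k) + \<bar>x0\<bar> + 1"
  have N: "B - k * x\<^sup>2 + 2 * k * H\<^sup>2 \<le> M + 2 * k * H\<^sup>2" if "N < \<bar>x\<bar>" for x
  proof -
    have "sqrt (\<bar>B - M\<bar> / k) \<le> \<bar>x\<bar>"
      using that by (simp add: N_def)
    then have "\<bar>B - M\<bar> / k \<le> x\<^sup>2"
      using sqrt_le_D[of "\<bar>B - M\<bar> / k" "\<bar>x\<bar>"] by simp
    then have "\<bar>B - M\<bar> \<le> k * x\<^sup>2"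
      using k by (simp add: divide_simps mult.commute)
    then show ?thesis
      by linarith
  qed
  define K where "K = ({-N..N} \<times> {0..H}) \<inter> closed_fluid \<eta>"
  have "compact K"
    unfolding K_def by (intro compact_Int_closed compact_Times closed_closed_fluid \<eta>) auto
  moreover have "z \<in> K"
  proof -
    have "0 \<le> sqrt (\<bar>B - M\<bar> / k)"
      using k by simp
    then have "\<bar>x0\<bar> \<le> N"
      by (simp add: N_def)
    then show ?thesis
      using z \<eta>(3)[of x0] unfolding K_def z0 by auto
  qed
  moreover have "continuous_on K F"
    unfolding F_def K_def by (intro continuous_intros continuous_on_subset[OF G(1)]) auto
  ultimately obtain w where w: "w \<in> K" "\<And>u. u \<in> K \<Longrightarrow> F u \<le> F w"
    using continuous_attains_sup[of K F] by blast
  have wmax: "F u \<le> F w" if u: "u \<in> closed_fluid \<eta>" for u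
  proof (cases "\<bar>fst u\<bar> \<le> N")
    case True
    then have "u \<in> K"
      using u \<eta>(3)[of "fst u"] by (cases u) (auto simp: K_def)
    then show ?thesis
      by (rule w(2))
  next
    case False
    have "(snd u)\<^sup>2 \<le> H\<^sup>2"
      using H[of "fst u" "snd u"] u by simp
    then have "k * (snd u)\<^sup>2 \<le> k * H\<^sup>2"
      using k by simp
    then have "F u \<le> B - k * (fst u)\<^sup>2 + 2 * k * H\<^sup>2"
      using G(2)[OF u] by (simp add: F_def)
    also have "\<dots> \<le> M + 2 * k * H\<^sup>2"
      using N False by auto
    also have "\<dots> \<le> F w"
      using Fz w(2)[OF \<open>z \<in> K\<close>] by linarith
    finally show ?thesis .
  qed
  obtain x y where xy: "w = (x, y)"
    by (cases w)
  have wS: "(x, y) \<in> closed_fluid \<eta>"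
    using w(1) xy by (simp add: K_def)
  have Fw: "M + 2 * k * H\<^sup>2 < F (x, y)"
    using Fz wmax[OF z] xy by simp
  have kH: "k * y\<^sup>2 \<le> k * H\<^sup>2"
    using H[OF wS] k by simp
  have Gw: "M < G (x, y)"
  proof -
    have "0 \<le> k * x\<^sup>2"
      using k by simp
    moreover have "M + 2 * (k * H\<^sup>2) < G (x, y) - k * x\<^sup>2 + 2 * (k * y\<^sup>2)"
      using Fw by (simp add: F_def mult.assoc)
    ultimately show ?thesis
      using kH by linarith
  qed
  have "y \<noteq> \<eta> x"
    using Gw top[of x] by auto
  have "y \<noteq> 0"
  proof
    assume "y = 0"
    then obtain D where D: "0 < D" "((\<lambda>t. G (x, t)) has_real_derivative D) (at 0 within {0..\<eta> x})"
      using bed[of x] Gw by auto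
    have "((\<lambda>t. F (x, t)) has_real_derivative D) (at 0 within {0..\<eta> x})"
      unfolding F_def using D(2) by (auto intro!: derivative_eq_intros)
    then obtain d where d: "0 < d" "\<And>h. 0 < h \<Longrightarrow> 0 + h \<in> {0..\<eta> x} \<Longrightarrow> h < d \<Longrightarrow> F (x, 0) < F (x, 0 + h)"
      using has_real_derivative_pos_inc_right[OF _ D(1)] by blast
    define h where "h = min d (\<eta> x) / 2"
    have "0 < h" "h < d" "h \<le> \<eta> x"
      using d(1) \<eta>(2)[of x] by (auto simp: h_def)
    then have "F (x, 0) < F (x, h)"
      using d(2)[of h] by auto
    moreover have "F (x, h) \<le> F w"
      using \<open>0 < h\<close> \<open>h \<le> \<eta> x\<close> by (intro wmax) auto
    ultimately show False
      using xy \<open>y = 0\<close> by simp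
  qed
  have fl: "(x, y) \<in> fluid \<eta>"
    using wS \<open>y \<noteq> 0\<close> \<open>y \<noteq> \<eta> x\<close> by auto
  then obtain e where e: "0 < e" "\<And>s t. \<bar>s - x\<bar> < e \<Longrightarrow> \<bar>t - y\<bar> < e \<Longrightarrow> (s, t) \<in> fluid \<eta>"
    using fluid_box[OF \<eta>(1)] by metis
  have "Gxx (x, y) - 2 * k \<le> 0"
  proof (rule local_max_second_derivative[OF e(1), where f = "\<lambda>s. F (s, y)" and f' = "\<lambda>s. Gx (s, y) - 2 * k * s"])
    show "((\<lambda>s. F (s, y)) has_real_derivative Gx (s, y) - 2 * k * s) (at s)" if "\<bar>s - x\<bar> < e" for s
      unfolding F_def using that e(1) e(2)[of s y] by (auto intro!: derivative_eq_intros Gx)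
    show "((\<lambda>s. Gx (s, y) - 2 * k * s) has_real_derivative Gxx (x, y) - 2 * k) (at x)"
      using fl by (auto intro!: derivative_eq_intros Gxx)
    show "F (s, y) \<le> F (x, y)" if "\<bar>s - x\<bar> < e" for s
      using wmax[OF fluid_imp_closed_fluid, of "(s, y)"] e(1) e(2)[of s y] that xy by auto
  qed
  moreover have "Gyy (x, y) + 4 * k \<le> 0"
  proof (rule local_max_second_derivative[OF e(1), where f = "\<lambda>t. F (x, t)" and f' = "\<lambda>t. Gy (x, t) + 4 * k * t"])
    show "((\<lambda>t. F (x, t)) has_real_derivative Gy (x, t) + 4 * k * t) (at t)" if "\<bar>t - y\<bar> < e" for t
      unfolding F_def using that e(1) e(2)[of x t] by (auto intro!: derivative_eq_intros Gy)
    show "((\<lambda>t. Gy (x, t) + 4 * k * t) has_real_derivative Gyy (x, y) + 4 * k) (at y)"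
      using fl by (auto intro!: derivative_eq_intros Gyy)
    show "F (x, t) \<le> F (x, y)" if "\<bar>t - y\<bar> < e" for t
      using wmax[OF fluid_imp_closed_fluid, of "(x, t)"] e(1) e(2)[of x t] that xy by auto
  qed
  ultimately show False
    using sub[OF fl] k by linarith
qed

text \<open>Both functions have the same set of derivatives within \<open>S\<close>, so
  \<open>frechet_derivative\<close> makes the same choice for both, unique or not.\<close>

lemma dx_dy_cong:
  assumes "\<And>w. w \<in> S \<Longrightarrow> f w = g w" "z \<in> S"
  shows "dx S f z = dx S g z" "dy S f z = dy S g z"
proof -
  have "(f has_derivative f') (at z within S) \<longleftrightarrow> (g has_derivative f') (at z within S)" for f'
    using assms by (metis (no_types, lifting) has_derivative_transform)
  then have "frechet_derivative f (at z within S) = frechet_derivative g (at z within S)"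
    by (simp add: frechet_derivative_def)
  then show "dx S f z = dx S g z" "dy S f z = dy S g z"
    by (simp_all add: dx_def dy_def)
qed

lemma dx_dy_commute:
  assumes \<eta>: "continuous_on UNIV \<eta>" "\<And>x. 0 < \<eta> x" and f: "Ck_on 2 (closed_fluid \<eta>) f"
    and z: "z \<in> closed_fluid \<eta>"
  shows "dx (closed_fluid \<eta>) (dy (closed_fluid \<eta>) f) z = dy (closed_fluid \<eta>) (dx (closed_fluid \<eta>) f) z"
proof (rule closed_fluid_eqI[OF \<eta>(2,1) _ _ _ z])
  let ?S = "closed_fluid \<eta>"
  have d: "f differentiable_on ?S" "dx ?S f differentiable_on ?S" "dy ?S f differentiable_on ?S"
    and c: "continuous_on ?S (dx ?S (dy ?S f))" "continuous_on ?S (dy ?S (dx ?S f))"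
    using f by (auto simp: eval_nat_numeral)
  then show "continuous_on ?S (dx ?S (dy ?S f))" "continuous_on ?S (dy ?S (dx ?S f))"
    by simp_all
  fix z assume "z \<in> fluid \<eta>"
  then obtain x y where z: "z = (x, y)" "(x, y) \<in> fluid \<eta>"
    by (cases z) auto
  obtain e where e: "0 < e" "\<And>s t. \<bar>s - x\<bar> < e \<Longrightarrow> \<bar>t - y\<bar> < e \<Longrightarrow> (s, t) \<in> fluid \<eta>"
    using fluid_box[OF \<eta>(1) z(2)] by metis
  have isc: "isCont g (x, y)" if "continuous_on ?S g" for g :: "real \<times> real \<Rightarrow> real"
    using that fluid_imp_closed_fluid[OF z(2)] at_within_closed_fluid[OF \<eta>(1) z(2)]
    by (metis continuous_on_eq_continuous_within)
  show "dx ?S (dy ?S f) z = dy ?S (dx ?S f) z"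
    unfolding z(1)
    by (rule mixed_partials_eq[OF e(1), symmetric, where f = f and fx = "dx ?S f" and fy = "dy ?S f"])
      (use e d isc[OF c(1)] isc[OF c(2)] in \<open>auto intro!: dx_interior dy_interior \<eta>(1)\<close>)
qed

text \<open>The polynomial is the stream function of the shear flow of depth \<open>h\<close>,
  continued to all \<open>y\<close>: 0 at the bed and 1 at \<open>h\<close>. The sign of its
  difference from 1 on the surface feeds the comparison of \<open>\<psi>\<close> with this
  flow.\<close>

lemma shear_le_1:
  fixes \<gamma> h y :: real
  assumes "0 \<le> \<gamma>" "0 < h" "0 \<le> y" "y \<le> h"
  shows "\<gamma> * y\<^sup>2 / 2 + (1 / h - \<gamma> * h / 2) * y \<le> 1"
proof -
  have "\<gamma> * y\<^sup>2 / 2 + (1 / h - \<gamma> * h / 2) * y = y / h + \<gamma> * y * (y - h) / 2"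
    by (simp add: field_simps power2_eq_square)
  moreover have "y / h \<le> 1" "\<gamma> * y * (y - h) \<le> 0"
    using assms by (auto simp: mult_nonneg_nonpos)
  ultimately show ?thesis
    by linarith
qed

lemma shear_ge_1:
  fixes \<gamma> h y :: real
  assumes "0 \<le> \<gamma>" "0 < h" "h \<le> y"
  shows "1 \<le> \<gamma> * y\<^sup>2 / 2 + (1 / h - \<gamma> * h / 2) * y"
proof -
  have "\<gamma> * y\<^sup>2 / 2 + (1 / h - \<gamma> * h / 2) * y = y / h + \<gamma> * y * (y - h) / 2"
    by (simp add: field_simps power2_eq_square)
  moreover have "1 \<le> y / h" "0 \<le> \<gamma> * y * (y - h)"
    using assms by auto
  ultimately show ?thesis
    by linarith
qed

section \<open>Unidirectional waves with bounded velocity\<close>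

locale unidirectional_flow =
  fixes \<gamma> :: real and \<eta> \<psi> r
  assumes solution: "solution \<gamma> \<eta> \<psi> r" and unidirectional: "unidirectional \<eta> \<psi>" and \<gamma>: "0 < \<gamma>"
begin

abbreviation "S \<equiv> closed_fluid \<eta>"
abbreviation "px \<equiv> dx S \<psi>"
abbreviation "py \<equiv> dy S \<psi>"
abbreviation "\<eta>' \<equiv> deriv \<eta>"

lemma eta_pos: "0 < \<eta> x"
  using solution by (simp add: solution_def)

lemma eta_deriv: "(\<eta> has_real_derivative \<eta>' x) (at x)"
proof -
  have "((deriv ^^ 0) \<eta>) differentiable (at x)"
    using solution by (simp only: solution_def smooth_profile_def)
  then show ?thesis
    by (simp add: DERIV_deriv_iff_real_differentiable)
qed

lemma eta_deriv2: "(\<eta>' has_real_derivative deriv \<eta>' x) (at x)"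
proof -
  have "((deriv ^^ 1) \<eta>) differentiable (at x)"
    using solution by (simp only: solution_def smooth_profile_def)
  then show ?thesis
    by (simp add: DERIV_deriv_iff_real_differentiable)
qed

lemma eta_cont: "continuous_on A \<eta>"
  using eta_deriv by (meson DERIV_isCont continuous_at_imp_continuous_on)

lemma smooth: "Ck_on k S \<psi>"
  using solution by (simp add: solution_def smooth_on_closed_def Let_def)

lemma Ck2: "Ck_on 2 S \<psi>" "Ck_on 2 S px" "Ck_on 2 S py"
  using smooth[of 2] smooth[of 3] by (auto simp: eval_nat_numeral)

lemma diff: "\<psi> differentiable_on S" "px differentiable_on S" "py differentiable_on S"
  "dx S px differentiable_on S" "dy S px differentiable_on S"
  "dx S py differentiable_on S" "dy S py differentiable_on S"
  using Ck2 by (auto simp: eval_nat_numeral)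

lemma psi_top: "\<psi> (x, \<eta> x) = 1" and psi_bed: "\<psi> (x, 0) = 0"
  using solution by (auto simp: solution_def Let_def)

lemma bernoulli: "((px (x, \<eta> x))\<^sup>2 + (py (x, \<eta> x))\<^sup>2) / 2 + \<eta> x = r"
  using solution by (simp add: solution_def Let_def)

lemma top_in: "(x, \<eta> x) \<in> S" and bed_in: "(x, 0) \<in> S"
  using eta_pos[of x] by auto

lemma py_pos: "z \<in> S \<Longrightarrow> 0 < py z"
  using unidirectional by (simp add: unidirectional_def vel_u_def)

lemma mixed: "z \<in> S \<Longrightarrow> dx S py z = dy S px z"
  using dx_dy_commute[OF eta_cont eta_pos Ck2(1)] by simp

lemma laplace:
  assumes "z \<in> S"
  shows "dx S px z + dy S py z = \<gamma>"
proof (rule closed_fluid_eqI[OF eta_pos eta_cont _ _ _ assms])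
  show "continuous_on S (\<lambda>z. dx S px z + dy S py z)"
    using diff by (intro continuous_intros differentiable_imp_continuous_on) auto
  show "dx S px z + dy S py z = \<gamma>" if "z \<in> fluid \<eta>" for z
    using solution that by (simp add: solution_def Let_def)
qed auto

lemmas dx_int = dx_interior[OF _ eta_cont]
lemmas dy_int = dy_interior[OF _ eta_cont]

lemma laplace_dx_dy:
  assumes z: "z \<in> fluid \<eta>"
  shows "dx S (dx S px) z + dx S (dy S py) z = 0" "dy S (dx S px) z + dy S (dy S py) z = 0"
proof -
  obtain x y where xy: "z = (x, y)" "(x, y) \<in> fluid \<eta>"
    using z by (cases z) auto
  obtain e where e: "0 < e" "\<And>s t. \<bar>s - x\<bar> < e \<Longrightarrow> \<bar>t - y\<bar> < e \<Longrightarrow> (s, t) \<in> fluid \<eta>"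
    using fluid_box[OF eta_cont xy(2)] by metis
  have near: "\<forall>\<^sub>F s in nhds x. \<bar>s - x\<bar> < e" "\<forall>\<^sub>F t in nhds y. \<bar>t - y\<bar> < e"
    by (auto simp: eventually_nhds_metric dist_real_def intro!: exI[of _ e] e(1))
  have "((\<lambda>s. dx S px (s, y) + dy S py (s, y)) has_real_derivative
      dx S (dx S px) (x, y) + dx S (dy S py) (x, y)) (at x)"
    using diff xy by (intro DERIV_add dx_int) auto
  moreover have "((\<lambda>s. dx S px (s, y) + dy S py (s, y)) has_real_derivative 0) (at x)"
  proof (subst DERIV_cong_ev[OF refl _ refl])
    show "\<forall>\<^sub>F s in nhds x. dx S px (s, y) + dy S py (s, y) = \<gamma>"
      using near(1) by eventually_elim (rule laplace[OF fluid_imp_closed_fluid[OF e(2)]], use e(1) in auto)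
  qed auto
  ultimately show "dx S (dx S px) z + dx S (dy S py) z = 0"
    unfolding xy(1) by (rule DERIV_unique)
  have "((\<lambda>t. dx S px (x, t) + dy S py (x, t)) has_real_derivative
      dy S (dx S px) (x, y) + dy S (dy S py) (x, y)) (at y)"
    using diff xy by (intro DERIV_add dy_int) auto
  moreover have "((\<lambda>t. dx S px (x, t) + dy S py (x, t)) has_real_derivative 0) (at y)"
  proof (subst DERIV_cong_ev[OF refl _ refl])
    show "\<forall>\<^sub>F t in nhds y. dx S px (x, t) + dy S py (x, t) = \<gamma>"
      using near(2) by eventually_elim (rule laplace[OF fluid_imp_closed_fluid[OF e(2)]], use e(1) in auto)
  qed auto
  ultimately show "dy S (dx S px) z + dy S (dy S py) z = 0"
    unfolding xy(1) by (rule DERIV_unique)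
qed

text \<open>Differentiate the Poisson equation in \<open>x\<close> and permute the third-order
  derivatives.\<close>

lemma px_harmonic:
  assumes z: "z \<in> fluid \<eta>"
  shows "dx S (dx S px) z + dy S (dy S px) z = 0"
proof -
  have zS: "z \<in> S"
    using z by (rule fluid_imp_closed_fluid)
  have "dx S (dy S py) z = dy S (dx S py) z"
    by (rule dx_dy_commute[OF eta_cont eta_pos Ck2(3) zS])
  also have "\<dots> = dy S (dy S px) z"
    by (rule dx_dy_cong[OF mixed zS])
  finally show ?thesis
    using laplace_dx_dy[OF z] by simp
qed

lemma py_harmonic:
  assumes z: "z \<in> fluid \<eta>"
  shows "dx S (dx S py) z + dy S (dy S py) z = 0"
proof -
  have zS: "z \<in> S"
    using z by (rule fluid_imp_closed_fluid)
  have "dx S (dx S py) z = dx S (dy S px) z"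
    by (rule dx_dy_cong[OF mixed zS])
  also have "\<dots> = dy S (dx S px) z"
    by (rule dx_dy_commute[OF eta_cont eta_pos Ck2(2) zS])
  finally show ?thesis
    using laplace_dx_dy[OF z] by simp
qed

lemma on_top:
  assumes "f differentiable_on S"
  shows "((\<lambda>s. f (s, \<eta> s)) has_real_derivative dx S f (x, \<eta> x) + \<eta>' x * dy S f (x, \<eta> x)) (at x)"
  using deriv_along_curve[OF assms, of "\<lambda>s. s" 1 x UNIV \<eta> "\<eta>' x"] eta_deriv top_in
  by (auto simp: algebra_simps)

lemma on_bed:
  assumes "f differentiable_on S"
  shows "((\<lambda>s. f (s, 0)) has_real_derivative dx S f (x, 0)) (at x)"
  using deriv_along_curve[OF assms, of "\<lambda>s. s" 1 x UNIV "\<lambda>_. 0" 0] eta_pos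
  by (auto simp: less_imp_le)

text \<open>The kinematic condition, from differentiating \<open>\<psi> = 1\<close> along the
  surface.\<close>

lemma px_top: "px (x, \<eta> x) = - \<eta>' x * py (x, \<eta> x)"
proof -
  have "((\<lambda>s. \<psi> (s, \<eta> s)) has_real_derivative 0) (at x)"
    by (simp add: psi_top)
  from DERIV_unique[OF on_top[OF diff(1)] this] show ?thesis
    by simp
qed

lemma px_bed: "px (x, 0) = 0"
proof -
  have "((\<lambda>s. \<psi> (s, 0)) has_real_derivative 0) (at x)"
    by (simp add: psi_bed)
  from DERIV_unique[OF on_bed[OF diff(1)] this] show ?thesis .
qed

lemma pyy_bed: "dy S py (x, 0) = \<gamma>"
proof -
  have "((\<lambda>s. px (s, 0)) has_real_derivative 0) (at x)"
    by (simp add: px_bed)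
  from DERIV_unique[OF on_bed[OF diff(2)] this] show ?thesis
    using laplace[OF bed_in, of x] by simp
qed

lemma psi_mono:
  assumes "0 \<le> y" "y < y'" "y' \<le> \<eta> x"
  shows "\<psi> (x, y) < \<psi> (x, y')"
proof (rule DERIV_pos_imp_increasing_open[OF assms(2)])
  show "\<exists>D. ((\<lambda>t. \<psi> (x, t)) has_real_derivative D) (at t) \<and> 0 < D" if "y < t" "t < y'" for t
    using dy_int[OF diff(1), of x t] py_pos[of "(x, t)"] that assms by auto
  have "continuous_on S \<psi>"
    using diff(1) by (rule differentiable_imp_continuous_on)
  then show "continuous_on {y..y'} (\<lambda>t. \<psi> (x, t))"
    by (rule continuous_on_compose2) (use assms in \<open>auto intro!: continuous_intros\<close>)
qed

lemma psi_bounds: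
  assumes "z \<in> S"
  shows "0 \<le> \<psi> z" "\<psi> z \<le> 1"
proof -
  obtain x y where z: "z = (x, y)" "0 \<le> y" "y \<le> \<eta> x"
    using assms by (cases z) auto
  show "0 \<le> \<psi> z" "\<psi> z \<le> 1"
    using psi_mono[of 0 y x] psi_mono[of y "\<eta> x" x] z psi_top[of x] psi_bed[of x]
    by (cases "y = 0"; cases "y = \<eta> x"; force)+
qed

end

text \<open>The bounds are the growth conditions for the maximum principle on the unbounded fluid.
  For Stokes and solitary waves they follow from periodicity and from the background flow, once the
  profile is bounded.\<close>

locale wave = unidirectional_flow +
  assumes bounded_gradient: "\<exists>B. \<forall>z\<in>closed_fluid \<eta>. \<bar>dx (closed_fluid \<eta>) \<psi> z\<bar> \<le> B \<and> \<bar>dy (closed_fluid \<eta>) \<psi> z\<bar> \<le> B"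
    and bounded_profile: "\<exists>H. \<forall>x. \<eta> x \<le> H"
begin

text \<open>The shear stream function also has Laplacian \<open>\<gamma>\<close>, so the difference
  is harmonic, and it vanishes on the bed; only its sign on the surface matters. The bed velocity
  \<open>s\<close> may be negative.\<close>

lemma shear_below:
  assumes top: "\<And>x. \<gamma> * (\<eta> x)\<^sup>2 / 2 + s * \<eta> x \<le> 1" and z: "(x, y) \<in> S"
  shows "\<gamma> * y\<^sup>2 / 2 + s * y \<le> \<psi> (x, y)"
proof -
  obtain H where H: "\<And>x. \<eta> x \<le> H"
    using bounded_profile by auto
  let ?G = "\<lambda>z. \<gamma> * (snd z)\<^sup>2 / 2 + s * snd z - \<psi> z"
  have "?G (x, y) \<le> 0"
  proof (rule max_principle[OF eta_cont eta_pos H _ _ _ _ _ _ _ _ _ z, where B = "\<gamma> * H\<^sup>2 / 2 + \<bar>s\<bar> * H"])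
    show "continuous_on S ?G"
      by (intro continuous_intros differentiable_imp_continuous_on diff) auto
    fix z assume "z \<in> S"
    then have "0 \<le> snd z" "snd z \<le> H" "0 \<le> \<psi> z"
      using H[of "fst z"] psi_bounds by (cases z; force)+
    then have "\<gamma> * (snd z)\<^sup>2 \<le> \<gamma> * H\<^sup>2" "s * snd z \<le> \<bar>s\<bar> * H"
      using \<gamma> by (auto intro!: mult_left_mono power_mono mult_mono)
    then show "?G z \<le> \<gamma> * H\<^sup>2 / 2 + \<bar>s\<bar> * H"
      using \<open>0 \<le> \<psi> z\<close> by linarith
  next
    fix x y assume xy: "(x, y) \<in> fluid \<eta>"
    show "((\<lambda>s. ?G (s, y)) has_real_derivative - px (x, y)) (at x)"
      using xy by (auto intro!: derivative_eq_intros dx_int diff)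
    show "((\<lambda>t. ?G (x, t)) has_real_derivative \<gamma> * snd (x, y) + s - py (x, y)) (at y)"
      using xy by (auto intro!: derivative_eq_intros dy_int diff)
    show "((\<lambda>s. - px (s, y)) has_real_derivative - dx S px (x, y)) (at x)"
      using xy by (auto intro!: derivative_eq_intros dx_int diff)
    show "((\<lambda>t. \<gamma> * snd (x, t) + s - py (x, t)) has_real_derivative \<gamma> - dy S py (x, y)) (at y)"
      using xy by (auto intro!: derivative_eq_intros dy_int diff)
  next
    fix z assume "z \<in> fluid \<eta>"
    then show "0 \<le> - dx S px z + (\<gamma> - dy S py z)"
      using laplace[OF fluid_imp_closed_fluid, of z] by linarith
  qed (use top psi_top psi_bed in auto)
  then show ?thesis
    by simp
qed

lemma shear_above:
  assumes top: "\<And>x. 1 \<le> \<gamma> * (\<eta> x)\<^sup>2 / 2 + s * \<eta> x" and z: "(x, y) \<in> S"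
  shows "\<psi> (x, y) \<le> \<gamma> * y\<^sup>2 / 2 + s * y"
proof -
  obtain H where H: "\<And>x. \<eta> x \<le> H"
    using bounded_profile by auto
  let ?G = "\<lambda>z. \<psi> z - \<gamma> * (snd z)\<^sup>2 / 2 - s * snd z"
  have "?G (x, y) \<le> 0"
  proof (rule max_principle[OF eta_cont eta_pos H _ _ _ _ _ _ _ _ _ z, where B = "1 + \<bar>s\<bar> * H"])
    show "continuous_on S ?G"
      by (intro continuous_intros differentiable_imp_continuous_on diff) auto
    fix z assume "z \<in> S"
    then have "0 \<le> snd z" "snd z \<le> H" "\<psi> z \<le> 1"
      using H[of "fst z"] psi_bounds by (cases z; force)+
    then have "0 \<le> \<gamma> * (snd z)\<^sup>2" "\<bar>s * snd z\<bar> \<le> \<bar>s\<bar> * H"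
      using \<gamma> by (auto simp: abs_mult intro!: mult_left_mono)
    then show "?G z \<le> 1 + \<bar>s\<bar> * H"
      using \<open>\<psi> z \<le> 1\<close> by linarith
  next
    fix x y assume xy: "(x, y) \<in> fluid \<eta>"
    show "((\<lambda>s. ?G (s, y)) has_real_derivative px (x, y)) (at x)"
      using xy by (auto intro!: derivative_eq_intros dx_int diff)
    show "((\<lambda>t. ?G (x, t)) has_real_derivative py (x, y) - \<gamma> * snd (x, y) - s) (at y)"
      using xy by (auto intro!: derivative_eq_intros dy_int diff)
    show "((\<lambda>s. px (s, y)) has_real_derivative dx S px (x, y)) (at x)"
      using xy by (auto intro!: derivative_eq_intros dx_int diff)
    show "((\<lambda>t. py (x, t) - \<gamma> * snd (x, t) - s) has_real_derivative dy S py (x, y) - \<gamma>) (at y)"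
      using xy by (auto intro!: derivative_eq_intros dy_int diff)
  next
    fix z assume "z \<in> fluid \<eta>"
    then show "0 \<le> dx S px z + (dy S py z - \<gamma>)"
      using laplace[OF fluid_imp_closed_fluid, of z] by linarith
  next
    show "?G (x, \<eta> x) \<le> 0" for x
      using top[of x] psi_top[of x] by simp
  qed (use psi_bed in auto)
  then show ?thesis
    by simp
qed

end

section \<open>Curvature of the surface\<close>

text \<open>For a slope \<open>m\<close> the quotient is the sine of the slope angle, and its
  derivative is the signed curvature of the graph.\<close>

lemma sin_slope_deriv:
  assumes "(m has_real_derivative m') (at x)"
  shows "((\<lambda>x. m x / sqrt (1 + (m x)\<^sup>2)) has_real_derivative m' / sqrt (1 + (m x)\<^sup>2) ^ 3) (at x)"
proof -
  define w where "w = sqrt (1 + (m x)\<^sup>2)"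
  have pos: "0 < 1 + (m x)\<^sup>2"
    by (simp add: add_pos_nonneg)
  have w: "0 < w" "w\<^sup>2 = 1 + (m x)\<^sup>2"
    using pos by (auto simp: w_def)
  have "((\<lambda>x. m x / sqrt (1 + (m x)\<^sup>2)) has_real_derivative
      (m' * w - m x * (2 * m x * m' * (inverse w / 2))) / (w * w)) (at x)"
    unfolding w_def using pos assms by (auto intro!: derivative_eq_intros simp: less_imp_le)
  also have "(m' * w - m x * (2 * m x * m' * (inverse w / 2))) / (w * w) = m' * (w\<^sup>2 - (m x)\<^sup>2) / w ^ 3"
    using w by (simp add: field_simps power2_eq_square power3_eq_cube)
  also have "w\<^sup>2 - (m x)\<^sup>2 = 1"
    using w by simp
  finally show ?thesis
    by (simp add: w_def)
qed

lemma cos_slope_deriv: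
  assumes "(m has_real_derivative m') (at x)"
  shows "((\<lambda>x. 1 / sqrt (1 + (m x)\<^sup>2)) has_real_derivative - m x * (m' / sqrt (1 + (m x)\<^sup>2) ^ 3)) (at x)"
proof -
  define w where "w = sqrt (1 + (m x)\<^sup>2)"
  have pos: "0 < 1 + (m x)\<^sup>2"
    by (simp add: add_pos_nonneg)
  have w: "0 < w"
    using pos by (auto simp: w_def)
  have "((\<lambda>x. 1 / sqrt (1 + (m x)\<^sup>2)) has_real_derivative
      - (2 * m x * m' * (inverse w / 2)) / (w * w)) (at x)"
    unfolding w_def using pos assms by (auto intro!: derivative_eq_intros simp: less_imp_le)
  also have "- (2 * m x * m' * (inverse w / 2)) / (w * w) = - m x * (m' / w ^ 3)"
    using w by (simp add: field_simps power3_eq_cube)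
  finally show ?thesis
    by (simp add: w_def)
qed

text \<open>An arc whose downward curvature is at most \<open>K\<close> has to rise by \<open>(1 - cos \<theta>) / K\<close> before its
  slope angle can drop from \<open>\<theta>\<close> to \<open>0\<close>.\<close>

lemma cos_slope_ge_right:
  fixes f f' f'' :: "real \<Rightarrow> real"
  assumes f: "\<And>x. (f has_real_derivative f' x) (at x)" and f': "\<And>x. (f' has_real_derivative f'' x) (at x)"
    and curv: "\<And>x. - K \<le> f'' x / sqrt (1 + (f' x)\<^sup>2) ^ 3" and K: "0 \<le> K"
    and le: "\<And>x. f x \<le> h" and x: "0 \<le> f' x"
  shows "1 - 1 / sqrt (1 + (f' x)\<^sup>2) \<le> K * (h - f x)"
proof -
  \<comment> \<open>The arc is stopped where the slope first falls to \<open>e > 0\<close>: it may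
    decay to 0 without ever vanishing. At the end \<open>e\<close> tends to 0.\<close>
  have main: "1 / sqrt (1 + e\<^sup>2) - 1 / sqrt (1 + (f' x)\<^sup>2) \<le> K * (h - f x)" if e: "0 < e" for e
  proof (cases "f' x \<le> e")
    case True
    then have "1 / sqrt (1 + e\<^sup>2) \<le> 1 / sqrt (1 + (f' x)\<^sup>2)"
      using x by (intro divide_left_mono) (auto intro!: power_mono mult_pos_pos simp: add_pos_nonneg)
    moreover have "0 \<le> K * (h - f x)"
      using K le[of x] by simp
    ultimately show ?thesis
      by linarith
  next
    case False
    have cont: "continuous_on A f'" for A
      using f' by (meson DERIV_isCont continuous_at_imp_continuous_on)
    obtain X where X: "x < X" "f' X < e"
    proof -
      \<comment> \<open>If the slope stayed at least \<open>e\<close> up to \<open>X\<close>, the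
        graph would rise to \<open>h + 1\<close> or more.\<close>
      define X where "X = x + (h - f x + 1) / e"
      have "x < X"
        using e le[of x] by (simp add: X_def add_pos_nonneg)
      then obtain t where t: "x < t" "t < X" "f X - f x = (X - x) * f' t"
        using MVT2[of x X f f'] f by blast
      have "f' t < e"
      proof (rule ccontr)
        assume "\<not> f' t < e"
        then have "(X - x) * e \<le> (X - x) * f' t"
          using \<open>x < X\<close> by (intro mult_left_mono) auto
        moreover have "(X - x) * e = h - f x + 1"
          using e by (simp add: X_def)
        ultimately show False
          using t le[of X] by linarith
      qed
      with t that show thesis
        by blast
    qed
    define A where "A = {x..X} \<inter> f' -` {e}"
    have "\<exists>t\<ge>x. t \<le> X \<and> f' t = e"
      using X False by (intro IVT2') (auto intro: cont)
    then have "A \<noteq> {}"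
      by (auto simp: A_def)
    moreover have "compact A"
      unfolding A_def by (intro compact_Int_closed compact_Icc continuous_closed_vimage) (auto intro: DERIV_isCont[OF f'])
    ultimately obtain x1 where x1: "x1 \<in> A" "\<And>t. t \<in> A \<Longrightarrow> x1 \<le> t"
      using compact_attains_inf by metis
    have ge: "e \<le> f' t" if t: "x \<le> t" "t \<le> x1" for t
    proof (rule ccontr)
      assume less: "\<not> e \<le> f' t"
      have "\<exists>s\<ge>x. s \<le> t \<and> f' s = e"
        using t False less by (intro IVT2') (auto intro: cont)
      then obtain s where s: "x \<le> s" "s \<le> t" "f' s = e"
        by blast
      then have "x1 \<le> s"
        using t x1(1) by (intro x1(2)) (auto simp: A_def)
      then have "s = t"
        using s t by linarith
      then show False
        using s less by simp
    qed
    \<comment> \<open>As the graph rises, the cosine of the slope angle grows at most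
      \<open>K\<close> times as fast as the height; hence \<open>g\<close> is nonincreasing where
      the slope is positive.\<close>
    define g where "g t = 1 / sqrt (1 + (f' t)\<^sup>2) - K * f t" for t
    have "g x1 \<le> g x"
    proof (rule DERIV_nonpos_imp_nonincreasing[where f = g and a = x and b = x1])
      show "x \<le> x1"
        using x1(1) by (simp add: A_def)
      fix t assume t: "x \<le> t" "t \<le> x1"
      have "(g has_real_derivative - f' t * (f'' t / sqrt (1 + (f' t)\<^sup>2) ^ 3) - K * f' t) (at t)"
        unfolding g_def by (intro DERIV_diff cos_slope_deriv f' DERIV_cmult f)
      moreover have "- f' t * (f'' t / sqrt (1 + (f' t)\<^sup>2) ^ 3) - K * f' t
          = - (f' t * (f'' t / sqrt (1 + (f' t)\<^sup>2) ^ 3 + K))"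
        by (simp add: algebra_simps)
      moreover have "0 \<le> f' t * (f'' t / sqrt (1 + (f' t)\<^sup>2) ^ 3 + K)"
        using ge[OF t] e curv[of t] by (intro mult_nonneg_nonneg) auto
      ultimately show "\<exists>y. (g has_real_derivative y) (at t) \<and> y \<le> 0"
        by (metis neg_le_0_iff_le)
    qed
    moreover have "f' x1 = e"
      using x1(1) by (simp add: A_def)
    moreover have "K * f x1 \<le> K * h"
      using K le by (rule mult_left_mono[rotated])
    ultimately show ?thesis
      by (simp add: g_def algebra_simps)
  qed
  have "((\<lambda>e. 1 / sqrt (1 + e\<^sup>2) - 1 / sqrt (1 + (f' x)\<^sup>2)) \<longlongrightarrow> 1 / sqrt (1 + 0\<^sup>2) - 1 / sqrt (1 + (f' x)\<^sup>2)) (at_right 0)"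
    by (intro tendsto_intros) auto
  then have "1 / sqrt (1 + 0\<^sup>2) - 1 / sqrt (1 + (f' x)\<^sup>2) \<le> K * (h - f x)"
    by (rule tendsto_upperbound) (auto intro!: main eventually_at_right_less eventually_mono[OF eventually_at_right_less])
  then show ?thesis
    by simp
qed

lemma cos_slope_ge:
  fixes f f' f'' :: "real \<Rightarrow> real"
  assumes f: "\<And>x. (f has_real_derivative f' x) (at x)" and f': "\<And>x. (f' has_real_derivative f'' x) (at x)"
    and curv: "\<And>x. - K \<le> f'' x / sqrt (1 + (f' x)\<^sup>2) ^ 3" and K: "0 \<le> K"
    and le: "\<And>x. f x \<le> h"
  shows "1 - 1 / sqrt (1 + (f' x)\<^sup>2) \<le> K * (h - f x)"
proof (cases "0 \<le> f' x")
  case True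
  then show ?thesis
    by (intro cos_slope_ge_right[OF f f' curv K le])
next
  case False
  have "1 - 1 / sqrt (1 + (- f' (- (- x)))\<^sup>2) \<le> K * (h - f (- (- x)))"
  proof (rule cos_slope_ge_right[where f = "\<lambda>x. f (- x)" and f' = "\<lambda>x. - f' (- x)" and f'' = "\<lambda>x. f'' (- x)"])
    show "((\<lambda>x. f (- x)) has_real_derivative - f' (- x)) (at x)" for x
      using f[of "- x"] by (simp add: DERIV_mirror)
    show "((\<lambda>x. - f' (- x)) has_real_derivative f'' (- x)) (at x)" for x
      using DERIV_minus[of "\<lambda>x. f' (- x)" "- f'' (- x)"] f'[of "- x"] by (simp add: DERIV_mirror)
  qed (use False curv le K in auto)
  then show ?thesis
    by simp
qed

text \<open>On the upper circle of radius \<open>h\<close> the sine of the slope angle is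
  \<open>- (x / h)\<close> and the slope is \<open>- x / sqrt (h\<^sup>2 - x\<^sup>2)\<close>; an
  inequality between sines becomes one between slopes.\<close>

lemma slope_ge_circle:
  fixes m x h :: real
  assumes "0 \<le> x" "x < h" "- (x / h) \<le> m / sqrt (1 + m\<^sup>2)"
  shows "- x \<le> m * sqrt (h\<^sup>2 - x\<^sup>2)"
proof (cases "0 \<le> m")
  case True
  have "0 \<le> h\<^sup>2 - x\<^sup>2"
    using assms by (simp add: power_mono)
  then show ?thesis
    using True assms by (smt (verit) mult_nonneg_nonneg real_sqrt_ge_zero)
next
  case False
  have pos: "0 < 1 + m\<^sup>2"
    by (simp add: add_pos_nonneg)
  have hx: "0 \<le> h\<^sup>2 - x\<^sup>2"
    using assms by (simp add: power_mono)
  have "- m / sqrt (1 + m\<^sup>2) \<le> x / h"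
    using assms by simp
  then have "(- m / sqrt (1 + m\<^sup>2))\<^sup>2 \<le> (x / h)\<^sup>2"
    using False pos by (intro power_mono) (auto intro!: divide_nonpos_pos)
  then have "m\<^sup>2 / (1 + m\<^sup>2) \<le> x\<^sup>2 / h\<^sup>2"
    using pos by (simp add: power_divide)
  then have "m\<^sup>2 * h\<^sup>2 \<le> x\<^sup>2 * (1 + m\<^sup>2)"
    using pos assms by (simp add: divide_simps mult_ac)
  then have "(- m * sqrt (h\<^sup>2 - x\<^sup>2))\<^sup>2 \<le> x\<^sup>2"
    using hx by (simp add: power_mult_distrib algebra_simps)
  then have "- m * sqrt (h\<^sup>2 - x\<^sup>2) \<le> x"
    using assms(1) by (rule power2_le_imp_le)
  then show ?thesis
    by simp
qed

context wave
begin

section \<open>Lower bounds for curvature, profile and surface velocity\<close>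

lemma bernoulli_slope: "(py (x, \<eta> x))\<^sup>2 * (1 + (\<eta>' x)\<^sup>2) = 2 * (r - \<eta> x)"
proof -
  have "(px (x, \<eta> x))\<^sup>2 + (py (x, \<eta> x))\<^sup>2 = 2 * (r - \<eta> x)"
    using bernoulli[of x] by (simp add: field_simps)
  then show ?thesis
    by (simp add: px_top power_mult_distrib algebra_simps)
qed

text \<open>\<open>Q = |\<nabla>\<psi>|\<^sup>2 / 2 - \<gamma> \<psi> / 2 + y\<close> is subharmonic, since \<open>|D\<^sup>2\<psi>|\<^sup>2 \<ge> (\<Delta>\<psi>)\<^sup>2 / 2\<close>, it is constant on the
  surface, and \<open>Q\<^sub>y > 0\<close> on the bed.\<close>

definition Q where "Q z = ((px z)\<^sup>2 + (py z)\<^sup>2) / 2 - \<gamma> / 2 * \<psi> z + snd z"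

lemma Q_dy_vertical:
  assumes "(x, y) \<in> S"
  shows "((\<lambda>t. Q (x, t)) has_real_derivative
    px (x, y) * dy S px (x, y) + py (x, y) * dy S py (x, y) - \<gamma> / 2 * py (x, y) + 1) (at y within {0..\<eta> x})"
  unfolding Q_def using assms by (auto intro!: derivative_eq_intros dy_vertical diff)

lemma Q_top: "Q (x, \<eta> x) = r - \<gamma> / 2"
  using bernoulli[of x] by (simp add: Q_def psi_top)

lemma Q_le:
  assumes z: "z \<in> S"
  shows "Q z \<le> r - \<gamma> / 2"
proof -
  obtain H where H: "\<And>x. \<eta> x \<le> H"
    using bounded_profile by auto
  obtain B where B: "\<And>z. z \<in> S \<Longrightarrow> \<bar>px z\<bar> \<le> B" "\<And>z. z \<in> S \<Longrightarrow> \<bar>py z\<bar> \<le> B"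
    using bounded_gradient by auto
  show ?thesis
  proof (rule max_principle[OF eta_cont eta_pos H _ _ _ _ _ _ _ _ _ z, where B = "B\<^sup>2 + H"
      and Gx = "\<lambda>z. px z * dx S px z + py z * dx S py z - \<gamma> / 2 * px z"
      and Gxx = "\<lambda>z. (dx S px z)\<^sup>2 + px z * dx S (dx S px) z + (dx S py z)\<^sup>2 + py z * dx S (dx S py) z - \<gamma> / 2 * dx S px z"
      and Gy = "\<lambda>z. px z * dy S px z + py z * dy S py z - \<gamma> / 2 * py z + 1"
      and Gyy = "\<lambda>z. (dy S px z)\<^sup>2 + px z * dy S (dy S px) z + (dy S py z)\<^sup>2 + py z * dy S (dy S py) z - \<gamma> / 2 * dy S py z"])
    show "continuous_on S Q"
      unfolding Q_def by (intro continuous_intros differentiable_imp_continuous_on diff) auto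
    fix z assume zS: "z \<in> S"
    have "(px z)\<^sup>2 \<le> B\<^sup>2" "(py z)\<^sup>2 \<le> B\<^sup>2"
      using B[OF zS] abs_le_square_iff by fastforce+
    moreover have "snd z \<le> H"
      using zS H[of "fst z"] by (cases z) auto
    moreover have "0 \<le> \<gamma> / 2 * \<psi> z"
      using psi_bounds[OF zS] \<gamma> by simp
    ultimately show "Q z \<le> B\<^sup>2 + H"
      unfolding Q_def by (simp add: field_simps)
  next
    fix x y assume xy: "(x, y) \<in> fluid \<eta>"
    show "((\<lambda>s. Q (s, y)) has_real_derivative
        px (x, y) * dx S px (x, y) + py (x, y) * dx S py (x, y) - \<gamma> / 2 * px (x, y)) (at x)"
      unfolding Q_def using xy by (auto intro!: derivative_eq_intros dx_int diff)
    show "((\<lambda>t. Q (x, t)) has_real_derivative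
        px (x, y) * dy S px (x, y) + py (x, y) * dy S py (x, y) - \<gamma> / 2 * py (x, y) + 1) (at y)"
      unfolding Q_def using xy by (auto intro!: derivative_eq_intros dy_int diff)
    show "((\<lambda>s. px (s, y) * dx S px (s, y) + py (s, y) * dx S py (s, y) - \<gamma> / 2 * px (s, y)) has_real_derivative
        (dx S px (x, y))\<^sup>2 + px (x, y) * dx S (dx S px) (x, y) + (dx S py (x, y))\<^sup>2
          + py (x, y) * dx S (dx S py) (x, y) - \<gamma> / 2 * dx S px (x, y)) (at x)"
      using xy by (auto intro!: derivative_eq_intros dx_int diff simp: power2_eq_square)
    show "((\<lambda>t. px (x, t) * dy S px (x, t) + py (x, t) * dy S py (x, t) - \<gamma> / 2 * py (x, t) + 1) has_real_derivative
        (dy S px (x, y))\<^sup>2 + px (x, y) * dy S (dy S px) (x, y) + (dy S py (x, y))\<^sup>2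
          + py (x, y) * dy S (dy S py) (x, y) - \<gamma> / 2 * dy S py (x, y)) (at y)"
      using xy by (auto intro!: derivative_eq_intros dy_int diff simp: power2_eq_square)
  next
    fix z assume z: "z \<in> fluid \<eta>"
    then have zS: "z \<in> S"
      by (rule fluid_imp_closed_fluid)
    define a b where "a = dx S px z" and "b = dy S py z"
    have "px z * dx S (dx S px) z + px z * dy S (dy S px) z = 0" "py z * dx S (dx S py) z + py z * dy S (dy S py) z = 0"
      using px_harmonic[OF z] py_harmonic[OF z] by (simp_all flip: distrib_left)
    moreover have "\<gamma> = a + b"
      using laplace[OF zS] by (simp add: a_def b_def)
    \<comment> \<open>The coefficient \<open>\<gamma> / 2\<close> of \<open>\<psi>\<close> in
      \<open>Q\<close> removes exactly the trace part of the Hessian, leaving a square.\<close>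
    then have "a\<^sup>2 + b\<^sup>2 - \<gamma> / 2 * a - \<gamma> / 2 * b = (a - b)\<^sup>2 / 2"
      by (simp add: power2_eq_square field_simps)
    moreover have "0 \<le> (a - b)\<^sup>2" "0 \<le> (dx S py z)\<^sup>2" "0 \<le> (dy S px z)\<^sup>2"
      by simp_all
    ultimately show "0 \<le> (dx S px z)\<^sup>2 + px z * dx S (dx S px) z + (dx S py z)\<^sup>2 + py z * dx S (dx S py) z - \<gamma> / 2 * dx S px z
        + ((dy S px z)\<^sup>2 + px z * dy S (dy S px) z + (dy S py z)\<^sup>2 + py z * dy S (dy S py) z - \<gamma> / 2 * dy S py z)"
      unfolding a_def b_def by linarith
  next
    show "Q (x, \<eta> x) \<le> r - \<gamma> / 2" for x
      by (simp add: Q_top)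
    \<comment> \<open>At the bed \<open>px = 0\<close> and \<open>pyy = \<gamma>\<close>, so the
      normal derivative is \<open>\<gamma> / 2 * py + 1\<close>, positive by
      unidirectionality.\<close>
    show "Q (x, 0) \<le> r - \<gamma> / 2 \<or> (\<exists>D>0. ((\<lambda>t. Q (x, t)) has_real_derivative D) (at 0 within {0..\<eta> x}))" for x
      using Q_dy_vertical[OF bed_in, of x] py_pos[OF bed_in, of x] \<gamma>
      by (intro disjI2 exI conjI) (auto simp: px_bed pyy_bed add_pos_pos field_simps)
  qed
qed

text \<open>Three facts at a surface point are combined: the second derivative of
  \<open>\<psi> = 1\<close> along the surface (\<open>E1\<close>), the tangential derivative of the
  Bernoulli condition (\<open>E2\<close>), and \<open>Q\<^sub>y \<ge> 0\<close>, since
  \<open>Q\<close> is largest on the surface (\<open>E3\<close>).\<close>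

lemma profile_second_deriv_ge:
  defines "u \<equiv> \<lambda>x. py (x, \<eta> x)"
  shows "- (\<gamma> / 2) * (1 + (\<eta>' x)\<^sup>2) - 1 / u x \<le> u x * deriv \<eta>' x"
proof -
  let ?z = "(x, \<eta> x)"
  define m n a b where "m = \<eta>' x" and "n = deriv \<eta>' x" and "a = dy S px ?z" and "b = dy S py ?z"
  have u: "0 < u x"
    using py_pos[OF top_in] by (simp add: u_def)
  have pxx: "dx S px ?z = \<gamma> - b"
    using laplace[OF top_in, of x] by (simp add: b_def)
  have pyx: "dx S py ?z = a"
    using mixed[OF top_in] by (simp add: a_def)
  have px: "px ?z = - m * u x"
    by (simp add: px_top m_def u_def)
  have "((\<lambda>s. px (s, \<eta> s) + \<eta>' s * py (s, \<eta> s)) has_real_derivative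
      (dx S px ?z + \<eta>' x * dy S px ?z) + (n * py ?z + (dx S py ?z + \<eta>' x * dy S py ?z) * \<eta>' x)) (at x)"
    unfolding n_def by (intro DERIV_add DERIV_mult on_top diff eta_deriv2)
  moreover have "((\<lambda>s. px (s, \<eta> s) + \<eta>' s * py (s, \<eta> s)) has_real_derivative 0) (at x)"
    by (simp add: px_top)
  ultimately have "(dx S px ?z + \<eta>' x * dy S px ?z) + (n * py ?z + (dx S py ?z + \<eta>' x * dy S py ?z) * \<eta>' x) = 0"
    by (rule DERIV_unique)
  then have E1: "u x * n = - (\<gamma> - b) - 2 * m * a - m\<^sup>2 * b"
    unfolding pxx pyx by (simp add: m_def u_def power2_eq_square algebra_simps flip: a_def b_def)
  have "((\<lambda>s. ((px (s, \<eta> s))\<^sup>2 + (py (s, \<eta> s))\<^sup>2) / 2 + \<eta> s) has_real_derivative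
      px ?z * (dx S px ?z + \<eta>' x * dy S px ?z) + py ?z * (dx S py ?z + \<eta>' x * dy S py ?z) + \<eta>' x) (at x)"
    by (auto intro!: derivative_eq_intros on_top diff eta_deriv)
  moreover have "((\<lambda>s. ((px (s, \<eta> s))\<^sup>2 + (py (s, \<eta> s))\<^sup>2) / 2 + \<eta> s) has_real_derivative 0) (at x)"
    by (simp add: bernoulli)
  ultimately have "px ?z * (dx S px ?z + \<eta>' x * dy S px ?z) + py ?z * (dx S py ?z + \<eta>' x * dy S py ?z) + \<eta>' x = 0"
    by (rule DERIV_unique)
  then have "u x * (a * (1 - m\<^sup>2) + 2 * m * (b - \<gamma> / 2)) + m = 0"
    unfolding pxx pyx px by (simp add: m_def u_def power2_eq_square algebra_simps flip: a_def b_def)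
  then have E2: "a * (1 - m\<^sup>2) + 2 * m * (b - \<gamma> / 2) = - m / u x"
    using u by (simp add: field_simps)
  have "0 \<le> px ?z * dy S px ?z + py ?z * dy S py ?z - \<gamma> / 2 * py ?z + 1"
  proof (rule endpoint_max_imp_deriv_nonneg[OF eta_pos Q_dy_vertical[OF top_in]])
    show "Q (x, t) \<le> Q (x, \<eta> x)" if "0 < t" "t < \<eta> x" for t
      unfolding Q_top using that by (intro Q_le) auto
  qed
  then have "0 \<le> u x * ((b - \<gamma> / 2) - m * a) + 1"
    unfolding px by (simp add: u_def algebra_simps flip: a_def b_def)
  then have E3: "- 1 / u x \<le> (b - \<gamma> / 2) - m * a"
    using u by (simp add: divide_simps mult_ac)
  \<comment> \<open>The right-hand side of \<open>E1\<close> regrouped into multiples of the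
    expressions in \<open>E3\<close> and \<open>E2\<close>, which eliminates \<open>a\<close> and
    \<open>b\<close>.\<close>
  have "u x * n = (1 + m\<^sup>2) * ((b - \<gamma> / 2) - m * a) - (\<gamma> / 2) * (1 + m\<^sup>2)
      - m * (a * (1 - m\<^sup>2) + 2 * m * (b - \<gamma> / 2))"
    unfolding E1 by (simp add: power2_eq_square field_simps)
  also have "\<dots> = (1 + m\<^sup>2) * ((b - \<gamma> / 2) - m * a) - (\<gamma> / 2) * (1 + m\<^sup>2) + m\<^sup>2 / u x"
    unfolding E2 by (simp add: power2_eq_square)
  also have "\<dots> \<ge> (1 + m\<^sup>2) * (- 1 / u x) - (\<gamma> / 2) * (1 + m\<^sup>2) + m\<^sup>2 / u x"
    using E3 by (intro add_right_mono diff_right_mono mult_left_mono) (auto simp: add_nonneg_nonneg)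
  also have "(1 + m\<^sup>2) * (- 1 / u x) - (\<gamma> / 2) * (1 + m\<^sup>2) + m\<^sup>2 / u x = - (\<gamma> / 2) * (1 + m\<^sup>2) - 1 / u x"
    using u by (simp add: field_simps)
  finally show ?thesis
    by (simp add: m_def n_def)
qed

text \<open>With \<open>w = sqrt (1 + (\<eta>' x)\<^sup>2)\<close> the product \<open>u * w\<close>
  is the full surface speed, which Bernoulli bounds below by \<open>q\<close>. Taking the speed at
  the highest crest for \<open>q\<close> makes the bound uniform in \<open>x\<close>.\<close>

lemma curvature_ge:
  assumes q: "0 < q" "q\<^sup>2 \<le> 2 * (r - \<eta> x)"
  shows "- ((\<gamma> / 2 + 1 / q) / q) \<le> deriv \<eta>' x / sqrt (1 + (\<eta>' x)\<^sup>2) ^ 3"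
proof -
  define u w where "u = py (x, \<eta> x)" and "w = sqrt (1 + (\<eta>' x)\<^sup>2)"
  have u: "0 < u"
    using py_pos[OF top_in] by (simp add: u_def)
  have w: "1 \<le> w" "w\<^sup>2 = 1 + (\<eta>' x)\<^sup>2"
    by (auto simp: w_def)
  have "q\<^sup>2 \<le> (u * w)\<^sup>2"
    using bernoulli_slope[of x] q by (simp add: power_mult_distrib w(2) u_def)
  then have uw: "q \<le> u * w"
    by (rule power2_le_imp_le) (use u w in auto)
  have "- (\<gamma> / 2) * w\<^sup>2 - 1 / u \<le> u * deriv \<eta>' x"
    using profile_second_deriv_ge[of x] by (simp add: u_def w(2))
  then have "(- (\<gamma> / 2) * w\<^sup>2 - 1 / u) / (u * w ^ 3) \<le> (u * deriv \<eta>' x) / (u * w ^ 3)"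
    using u w by (intro divide_right_mono) auto
  also have "\<dots> = deriv \<eta>' x / w ^ 3"
    using u by simp
  also have "(- (\<gamma> / 2) * w\<^sup>2 - 1 / u) / (u * w ^ 3) = - (\<gamma> / 2 / (u * w) + 1 / ((u * w)\<^sup>2 * w))"
  proof -
    have "u \<noteq> 0" "w \<noteq> 0"
      using u w by auto
    then show ?thesis
      by (simp add: field_simps power2_eq_square power3_eq_cube)
  qed
  finally have "- (\<gamma> / 2 / (u * w) + 1 / ((u * w)\<^sup>2 * w)) \<le> deriv \<eta>' x / w ^ 3" .
  moreover have "\<gamma> / 2 / (u * w) \<le> \<gamma> / 2 / q"
    using uw q \<gamma> by (intro divide_left_mono) auto
  moreover have "1 / ((u * w)\<^sup>2 * w) \<le> 1 / (q\<^sup>2 * 1)"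
  proof -
    have "q\<^sup>2 * 1 \<le> (u * w)\<^sup>2 * w"
      using uw q w by (intro mult_mono power_mono) auto
    then show ?thesis
      using q u w by (intro divide_left_mono) auto
  qed
  moreover have "(\<gamma> / 2 + 1 / q) / q = \<gamma> / 2 / q + 1 / (q\<^sup>2 * 1)"
    by (simp add: add_divide_distrib power2_eq_square)
  ultimately show ?thesis
    unfolding w_def by linarith
qed

text \<open>The curvature bound makes the sine of the slope angle plus \<open>x / h\<close>
  nondecreasing, and it is 0 at the crest. Hence the profile descends on both sides no faster than
  the circle of radius \<open>h\<close> centred on the bed.\<close>

lemma profile_above_circle:
  assumes q: "0 < q" "\<And>x. q\<^sup>2 \<le> 2 * (r - \<eta> x)" and K: "(\<gamma> / 2 + 1 / q) / q \<le> 1 / \<eta> 0"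
    and crest: "\<eta>' 0 = 0" and x: "\<bar>x\<bar> < \<eta> 0"
  shows "sqrt ((\<eta> 0)\<^sup>2 - x\<^sup>2) \<le> \<eta> x"
proof -
  define h where "h = \<eta> 0"
  have h: "0 < h"
    using eta_pos[of 0] by (simp add: h_def)
  define f where "f x = \<eta>' x / sqrt (1 + (\<eta>' x)\<^sup>2) + x / h" for x
  have f_mono: "f s \<le> f t" if "s \<le> t" for s t
  proof (rule DERIV_nonneg_imp_nondecreasing[OF that])
    fix y
    have "(f has_real_derivative deriv \<eta>' y / sqrt (1 + (\<eta>' y)\<^sup>2) ^ 3 + 1 / h) (at y)"
      unfolding f_def by (intro DERIV_add sin_slope_deriv eta_deriv2) (use h in \<open>auto intro!: derivative_eq_intros\<close>)
    moreover have "0 \<le> deriv \<eta>' y / sqrt (1 + (\<eta>' y)\<^sup>2) ^ 3 + 1 / h"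
      using curvature_ge[OF q(1), of y] q K by (simp add: h_def)
    ultimately show "\<exists>D. (f has_real_derivative D) (at y) \<and> 0 \<le> D"
      by blast
  qed
  have f0: "f 0 = 0"
    by (simp add: f_def crest)
  define g where "g x = \<eta> x - sqrt (h\<^sup>2 - x\<^sup>2)" for x
  have g: "(g has_real_derivative (\<eta>' y * sqrt (h\<^sup>2 - y\<^sup>2) + y) / sqrt (h\<^sup>2 - y\<^sup>2)) (at y)"
    and sq: "0 < sqrt (h\<^sup>2 - y\<^sup>2)" if "\<bar>y\<bar> < h" for y
  proof -
    have pos: "0 < h\<^sup>2 - y\<^sup>2"
      using that abs_square_less_1[of "y / h"] h by (simp add: power_divide)
    then show "0 < sqrt (h\<^sup>2 - y\<^sup>2)"
      by simp
    have "(g has_real_derivative \<eta>' y - (- 2 * y) * (inverse (sqrt (h\<^sup>2 - y\<^sup>2)) / 2)) (at y)"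
      unfolding g_def using pos by (auto intro!: derivative_eq_intros eta_deriv)
    moreover have "\<eta>' y - (- 2 * y) * (inverse (sqrt (h\<^sup>2 - y\<^sup>2)) / 2) = (\<eta>' y * sqrt (h\<^sup>2 - y\<^sup>2) + y) / sqrt (h\<^sup>2 - y\<^sup>2)"
      using pos by (simp add: field_simps)
    ultimately show "(g has_real_derivative (\<eta>' y * sqrt (h\<^sup>2 - y\<^sup>2) + y) / sqrt (h\<^sup>2 - y\<^sup>2)) (at y)"
      by simp
  qed
  have g0: "g 0 = 0"
    using h by (simp add: g_def h_def)
  have "0 \<le> g x"
  proof (cases "0 \<le> x")
    case True
    have "g 0 \<le> g x"
    proof (rule DERIV_nonneg_imp_nondecreasing[where f = g and a = 0 and b = x, OF True])
      fix y assume y: "0 \<le> y" "y \<le> x"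
      then have "\<bar>y\<bar> < h"
        using x by (simp add: h_def)
      moreover have "- y \<le> \<eta>' y * sqrt (h\<^sup>2 - y\<^sup>2)"
        using f_mono[OF y(1)] f0 y x by (intro slope_ge_circle) (auto simp: f_def h_def)
      ultimately show "\<exists>D. (g has_real_derivative D) (at y) \<and> 0 \<le> D"
        using g sq[of y] by (intro exI conjI) auto
    qed
    then show ?thesis
      by (simp add: g0)
  next
    case False
    then have "x \<le> 0"
      by simp
    then have "g 0 \<le> g x"
    proof (rule DERIV_nonpos_imp_nonincreasing[where f = g and a = x and b = 0])
      fix y assume y: "x \<le> y" "y \<le> 0"
      then have "\<bar>y\<bar> < h"
        using x by (simp add: h_def)
      moreover have "- (- y) \<le> - \<eta>' y * sqrt (h\<^sup>2 - (- y)\<^sup>2)"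
        using f_mono[OF y(2)] f0 y x by (intro slope_ge_circle) (auto simp: f_def h_def)
      ultimately show "\<exists>D. (g has_real_derivative D) (at y) \<and> D \<le> 0"
        using g sq[of y] by (intro exI conjI) (auto intro!: divide_nonpos_nonneg)
    qed
    then show ?thesis
      by (simp add: g0)
  qed
  then show ?thesis
    by (simp add: g_def h_def)
qed

text \<open>The horizontal velocity is the speed, at least \<open>q\<close>, times the cosine of the
  slope angle, which \<open>cos_slope_ge\<close> bounds through the drop below
  \<open>h\<close>.\<close>

lemma surface_velocity_ge:
  assumes q: "0 < q" "\<And>x. q\<^sup>2 \<le> 2 * (r - \<eta> x)" and h: "\<And>x. \<eta> x \<le> h"
  shows "q - (\<gamma> / 2 + 1 / q) * (h - \<eta> x) \<le> py (x, \<eta> x)"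
proof -
  define u w where "u = py (x, \<eta> x)" and "w = sqrt (1 + (\<eta>' x)\<^sup>2)"
  have w: "1 \<le> w" "w\<^sup>2 = 1 + (\<eta>' x)\<^sup>2"
    by (auto simp: w_def)
  have u: "0 < u"
    using py_pos[OF top_in] by (simp add: u_def)
  have "q\<^sup>2 \<le> (u * w)\<^sup>2"
    using bernoulli_slope[of x] q(2)[of x] by (simp add: power_mult_distrib w(2) u_def)
  then have "q \<le> u * w"
    by (rule power2_le_imp_le) (use u w in auto)
  then have "q / w \<le> u"
    using w by (simp add: divide_le_eq)
  have "1 - 1 / w \<le> (\<gamma> / 2 + 1 / q) / q * (h - \<eta> x)"
    unfolding w_def using q(1) \<gamma>
    by (intro cos_slope_ge[OF eta_deriv eta_deriv2 curvature_ge[OF q] _ h]) (auto intro!: divide_nonneg_nonneg add_nonneg_nonneg)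
  then have "q * (1 - 1 / w) \<le> q * ((\<gamma> / 2 + 1 / q) / q * (h - \<eta> x))"
    using q(1) by (intro mult_left_mono) auto
  also have "\<dots> = (\<gamma> / 2 + 1 / q) * (h - \<eta> x)"
    using q(1) by simp
  finally show ?thesis
    using \<open>q / w \<le> u\<close> by (simp add: u_def algebra_simps)
qed

end

section \<open>Positive harmonic functions on a half-disc\<close>

text \<open>Harnack's inequality via the Cayley transform: \<open>m\<close> sends the right
  half-plane to the unit disc and \<open>a\<close> to 0, so the Schwarz lemma confines
  \<open>p z\<close> to a circle whose leftmost point is the bound.\<close>

lemma positive_real_part_lower_bound:
  assumes holo: "p holomorphic_on ball 0 1" and a: "0 < a" and p0: "p 0 = complex_of_real a"
    and pos: "\<And>z. norm z < 1 \<Longrightarrow> 0 \<le> Re (p z)" and z: "norm z < 1"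
  shows "a * (1 - norm z) / (1 + norm z) \<le> Re (p z)"
proof -
  define m where "m w = (p w - a) / (p w + a)" for w
  have ne: "p w + a \<noteq> 0" if "norm w < 1" for w
    using pos[OF that] a by (auto simp: complex_eq_iff)
  have m_holo: "m holomorphic_on ball 0 1"
    unfolding m_def using ne by (auto intro!: holomorphic_intros holo)
  have m_le: "norm (m w) \<le> 1" if "norm w < 1" for w
  proof -
    have "(norm (p w - a))\<^sup>2 \<le> (norm (p w + a))\<^sup>2"
      using pos[OF that] a unfolding cmod_power2 by (simp add: power2_eq_square algebra_simps)
    then have "norm (p w - a) \<le> norm (p w + a)"
      by simp
    then show ?thesis
      using ne[OF that] by (simp add: m_def norm_divide divide_le_eq)
  qed
  have schwarz: "norm (m z) \<le> norm z"
  proof (rule field_le_mult_one_interval)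
    \<comment> \<open>Here \<open>m\<close> is only bounded by 1, whereas the Schwarz lemma asks for
      values strictly inside the disc; the factor \<open>c\<close> provides this.\<close>
    fix c :: real assume c: "0 < c" "c < 1"
    have "norm (c * m z) \<le> norm z"
    proof (rule Schwarz_Lemma(1)[where f = "\<lambda>w. c * m w", OF _ _ _ z])
      show "(\<lambda>w. c * m w) holomorphic_on ball 0 1"
        using m_holo by (intro holomorphic_intros)
      show "norm (c * m w) < 1" if "norm w < 1" for w
      proof -
        have "c * norm (m w) \<le> c * 1"
          using m_le[OF that] c by (intro mult_left_mono) auto
        then have "c * norm (m w) < 1"
          using c by linarith
        then show ?thesis
          using c by (simp add: norm_mult)
      qed
    qed (simp add: m_def p0)
    then show "c * norm (m z) \<le> norm z"
      using c by (simp add: norm_mult)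
  qed
  define \<mu> where "\<mu> = norm (m z)"
  have \<mu>: "0 \<le> \<mu>" "\<mu> \<le> norm z" "\<mu> < 1"
    using schwarz z by (auto simp: \<mu>_def)
  have "norm (p z - a) = \<mu> * norm (p z + a)"
    using ne[OF z] by (simp add: \<mu>_def m_def norm_divide)
  then have "(norm (p z - a))\<^sup>2 = \<mu>\<^sup>2 * (norm (p z + a))\<^sup>2"
    by (simp add: power_mult_distrib)
  then have "(Re (p z) - a)\<^sup>2 + (Im (p z))\<^sup>2 = \<mu>\<^sup>2 * ((Re (p z) + a)\<^sup>2 + (Im (p z))\<^sup>2)"
    unfolding cmod_power2 by simp
  moreover have "(1 - \<mu>\<^sup>2) * ((Re (p z))\<^sup>2 + (Im (p z))\<^sup>2 + a\<^sup>2) - 2 * (1 + \<mu>\<^sup>2) * a * Re (p z)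
      = ((Re (p z) - a)\<^sup>2 + (Im (p z))\<^sup>2) - \<mu>\<^sup>2 * ((Re (p z) + a)\<^sup>2 + (Im (p z))\<^sup>2)"
    by (simp add: power2_eq_square algebra_simps)
  ultimately have eq: "(1 - \<mu>\<^sup>2) * ((Re (p z))\<^sup>2 + (Im (p z))\<^sup>2 + a\<^sup>2) = 2 * (1 + \<mu>\<^sup>2) * a * Re (p z)"
    by simp
  have \<mu>2: "\<mu>\<^sup>2 < 1"
    using \<mu> by (simp add: power_less_one_iff)
  \<comment> \<open>With \<open>norm (p z - a) = \<mu> * norm (p z + a)\<close>, the value lies on
    an Apollonius circle that meets the real axis at \<open>a * (1 - \<mu>) / (1 + \<mu>)\<close>
    and its reciprocal multiple of \<open>a\<close>. To the left of both points the factorised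
    quadratic would be positive.\<close>
  have lower: "a * (1 - \<mu>) \<le> Re (p z) * (1 + \<mu>)"
  proof (rule ccontr)
    define X where "X = Re (p z)"
    assume "\<not> a * (1 - \<mu>) \<le> Re (p z) * (1 + \<mu>)"
    then have 1: "0 < a * (1 - \<mu>) - X * (1 + \<mu>)"
      by (simp add: X_def)
    have "X * (1 - \<mu>) \<le> X * (1 + \<mu>)"
      using pos[OF z] \<mu> by (simp add: X_def mult_left_mono)
    also have "\<dots> < a * (1 - \<mu>)"
      using 1 by simp
    also have "\<dots> \<le> a * (1 + \<mu>)"
      using a \<mu> by simp
    finally have 2: "0 < a * (1 + \<mu>) - X * (1 - \<mu>)"
      by simp
    have "(1 - \<mu>\<^sup>2) * (X\<^sup>2 + a\<^sup>2) \<le> 2 * (1 + \<mu>\<^sup>2) * a * X"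
    proof -
      have "0 \<le> (1 - \<mu>\<^sup>2) * (Im (p z))\<^sup>2"
        using \<mu>2 by simp
      then show ?thesis
        using eq by (simp add: X_def algebra_simps)
    qed
    moreover have "(a * (1 - \<mu>) - X * (1 + \<mu>)) * (a * (1 + \<mu>) - X * (1 - \<mu>))
        = (1 - \<mu>\<^sup>2) * (X\<^sup>2 + a\<^sup>2) - 2 * (1 + \<mu>\<^sup>2) * a * X"
      by (simp add: power2_eq_square algebra_simps)
    ultimately show False
      using mult_pos_pos[OF 1 2] by linarith
  qed
  have "a * (1 - norm z) / (1 + norm z) \<le> a * (1 - \<mu>) / (1 + \<mu>)"
    using \<mu> a by (intro frac_le mult_left_mono) auto
  also have "\<dots> \<le> Re (p z)"
    using lower \<mu> by (simp add: divide_le_eq)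
  finally show ?thesis .
qed

text \<open>Rogosinski's trick for typically real functions: \<open>p z = F z * (R\<^sup>2 - z\<^sup>2) / z\<close> satisfies
  \<open>Re p = 2 * Im z * Im (F z) \<ge> 0\<close> on the circle of radius \<open>R\<close>, hence inside it.\<close>

lemma typically_real_lower_bound:
  fixes F :: "complex \<Rightarrow> complex" and R0 R \<rho> A :: real
  assumes holo: "F holomorphic_on ball 0 R0" and F0: "F 0 = 0"
    and dF: "deriv F 0 = complex_of_real A" and A: "0 < A"
    and pos: "\<And>z. norm z < R0 \<Longrightarrow> 0 \<le> Im z * Im (F z)"
    and R: "R < R0" and \<rho>: "0 < \<rho>" "\<rho> < R"
  shows "A * R\<^sup>2 * \<rho> * (R - \<rho>) / ((R + \<rho>) * (R\<^sup>2 + \<rho>\<^sup>2)) \<le> Im (F (\<i> * \<rho>))"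
proof -
  define G where "G = (\<lambda>z. if z = 0 then deriv F 0 else (F z - F 0) / (z - 0))"
  have G: "G holomorphic_on ball 0 R0"
    unfolding G_def by (rule pole_lemma_open[OF holo]) simp
  have zG: "F z = z * G z" for z
    by (simp add: G_def F0)
  define p where "p z = G z * ((of_real R)\<^sup>2 - z\<^sup>2)" for z
  have p: "p holomorphic_on ball 0 R0"
    unfolding p_def by (intro holomorphic_intros G)
  have p_circle: "0 \<le> Re (p z)" if z: "norm z = R" for z
  proof -
    have z0: "z \<noteq> 0"
      using z \<rho> by auto
    have "complex_of_real R ^ 2 = z * cnj z"
      using complex_norm_square[of z] z by simp
    then have "p z = F z * (cnj z - z)"
      using z0 by (simp add: p_def zG power2_eq_square algebra_simps)
    then have "Re (p z) = 2 * (Im z * Im (F z))"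
      by simp
    then show ?thesis
      using pos[of z] z R by simp
  qed
  have p_pos: "0 \<le> Re (p z)" if z: "norm z \<le> R" for z
  proof -
    \<comment> \<open>The minimum principle for \<open>Re p\<close>, as the maximum modulus
      principle for \<open>exp (- p)\<close>.\<close>
    have "norm (exp (- p z)) \<le> 1"
    proof (rule maximum_modulus_frontier[where f = "\<lambda>z. exp (- p z)" and S = "cball 0 R"])
      have sub: "cball 0 R \<subseteq> ball (0::complex) R0"
        using R by auto
      show "(\<lambda>z. exp (- p z)) holomorphic_on interior (cball 0 R)"
        using p R by (intro holomorphic_intros) (auto elim!: holomorphic_on_subset)
      show "continuous_on (closure (cball 0 R)) (\<lambda>z. exp (- p z))"
        using holomorphic_on_imp_continuous_on[OF p] sub
        by (auto intro!: continuous_intros intro: continuous_on_subset)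
      show "norm (exp (- p w)) \<le> 1" if "w \<in> frontier (cball 0 R)" for w
        using p_circle[of w] that \<rho> by (auto simp: norm_exp_eq_Re)
    qed (use z in auto)
    then show ?thesis
      by simp
  qed
  define q where "q w = p (of_real R * w)" for w
  have R0: "0 < R" using \<rho> by simp
  have "A * R\<^sup>2 * (1 - norm (\<i> * of_real (\<rho> / R))) / (1 + norm (\<i> * of_real (\<rho> / R))) \<le> Re (q (\<i> * of_real (\<rho> / R)))"
  proof (rule positive_real_part_lower_bound)
    have "p holomorphic_on (\<lambda>w. complex_of_real R * w) ` ball 0 1"
    proof (rule holomorphic_on_subset[OF p])
      have "norm (of_real R * w) < R0" if "norm w < 1" for w :: complex
      proof -
        have "R * norm w \<le> R"
          by (rule mult_left_le) (use that R0 in auto)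
        then have "R * norm w < R0"
          using R by linarith
        then show ?thesis
          using R0 by (simp add: norm_mult)
      qed
      then show "(\<lambda>w. complex_of_real R * w) ` ball 0 1 \<subseteq> ball 0 R0"
        by auto
    qed
    then show "q holomorphic_on ball 0 1"
      unfolding q_def using holomorphic_on_compose[of "\<lambda>w. complex_of_real R * w" "ball 0 1" p]
      by (auto simp: o_def intro: holomorphic_intros)
    show "0 \<le> Re (q w)" if "norm w < 1" for w
      unfolding q_def using that R0 by (intro p_pos) (simp add: norm_mult)
    show "0 < A * R\<^sup>2" using A R0 by simp
    show "q 0 = complex_of_real (A * R\<^sup>2)"
      by (simp add: q_def p_def G_def dF)
  qed (use \<rho> in \<open>simp add: norm_mult norm_divide\<close>)
  also have "q (\<i> * of_real (\<rho> / R)) = p (\<i> * \<rho>)"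
    using R0 by (simp add: q_def mult.left_commute)
  also have "p (\<i> * \<rho>) = F (\<i> * \<rho>) * of_real (R\<^sup>2 + \<rho>\<^sup>2) / (\<i> * \<rho>)"
    using \<rho> by (simp add: p_def zG[of "\<i> * \<rho>"] power_mult_distrib)
  also have "Re \<dots> = Im (F (\<i> * \<rho>)) * (R\<^sup>2 + \<rho>\<^sup>2) / \<rho>"
    using \<rho> by (simp add: Re_divide power2_eq_square field_simps)
  finally have *: "A * R\<^sup>2 * (1 - \<rho> / R) / (1 + \<rho> / R) \<le> Im (F (\<i> * \<rho>)) * (R\<^sup>2 + \<rho>\<^sup>2) / \<rho>"
    using \<rho> by (simp add: norm_mult norm_divide)
  have "(1 - \<rho> / R) / (1 + \<rho> / R) = (R - \<rho>) / (R + \<rho>)"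
  proof -
    have "1 - \<rho> / R = (R - \<rho>) / R" "1 + \<rho> / R = (R + \<rho>) / R"
      using R0 by (simp_all add: diff_divide_distrib add_divide_distrib)
    then show ?thesis
      using R0 by simp
  qed
  then have "A * R\<^sup>2 * (1 - \<rho> / R) / (1 + \<rho> / R) = A * R\<^sup>2 * (R - \<rho>) / (R + \<rho>)"
    by (metis times_divide_eq_right)
  with * have "A * R\<^sup>2 * (R - \<rho>) / (R + \<rho>) \<le> Im (F (\<i> * \<rho>)) * (R\<^sup>2 + \<rho>\<^sup>2) / \<rho>"
    by simp
  then have "A * R\<^sup>2 * (R - \<rho>) / (R + \<rho>) * \<rho> \<le> Im (F (\<i> * \<rho>)) * (R\<^sup>2 + \<rho>\<^sup>2)"
    using \<rho> by (simp add: pos_le_divide_eq)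
  moreover have "0 < R\<^sup>2 + \<rho>\<^sup>2"
    using R0 by (simp add: add_pos_nonneg)
  ultimately have "A * R\<^sup>2 * (R - \<rho>) / (R + \<rho>) * \<rho> / (R\<^sup>2 + \<rho>\<^sup>2) \<le> Im (F (\<i> * \<rho>))"
    by (subst pos_divide_le_eq)
  then show ?thesis
    by (simp add: mult_ac)
qed

text \<open>A primitive of \<open>W\<close> has imaginary part \<open>\<phi>\<close>, is real on the
  diameter and extends by Schwarz reflection. Positivity of \<open>\<phi>\<close> makes the
  extension typically real, with derivative at 0 the bed slope \<open>A\<close>.\<close>

lemma half_disc_lower_bound:
  fixes \<phi> :: "complex \<Rightarrow> real" and W :: "complex \<Rightarrow> complex" and R0 R \<rho> A :: real
  defines "U \<equiv> ball 0 R0 \<inter> {z. 0 \<le> Im z}"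
  assumes W: "W holomorphic_on (ball 0 R0 \<inter> {z. 0 < Im z})" "continuous_on U W"
    and W0: "W 0 = complex_of_real A" and A: "0 < A"
    and \<phi>: "\<And>z. z \<in> U \<Longrightarrow> (\<phi> has_derivative (\<lambda>h. Im (W z * h))) (at z within U)"
    and \<phi>0: "\<And>z. z \<in> U \<Longrightarrow> Im z = 0 \<Longrightarrow> \<phi> z = 0" and pos: "\<And>z. z \<in> U \<Longrightarrow> 0 \<le> \<phi> z"
    and R: "R < R0" and \<rho>: "0 < \<rho>" "\<rho> < R"
  shows "A * R\<^sup>2 * \<rho> * (R - \<rho>) / ((R + \<rho>) * (R\<^sup>2 + \<rho>\<^sup>2)) \<le> \<phi> (\<i> * \<rho>)"
proof -
  have R0: "0 < R0"
    using R \<rho> by simp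
  have conv: "convex U"
    unfolding U_def by (intro convex_Int convex_ball convex_halfspace_Im_ge)
  have U0: "0 \<in> U"
    using R0 by (simp add: U_def)
  have int: "interior U = ball 0 R0 \<inter> {z. 0 < Im z}"
    proof -
    have "interior {z. 0 \<le> Im z} = {z. 0 < Im z}"
      using interior_halfspace_ge[of \<i> 0] by (simp add: inner_complex_def)
    then show ?thesis
      by (simp add: U_def)
  qed
  have op: "open (ball (0::complex) R0 \<inter> {z. 0 < Im z})"
    by (intro open_Int open_ball open_halfspace_Im_gt)
  obtain g where g: "\<And>z. z \<in> U \<Longrightarrow> (g has_field_derivative W z) (at z within U)"
  proof (rule holomorphic_convex_primitive[OF conv _ W(2), of "{}"])
    show "W field_differentiable at z" if "z \<in> interior U - {}" for z
      using W(1) op that unfolding int by (auto intro: holomorphic_on_imp_differentiable_at)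
  qed auto
  define f where "f z = g z - g 0" for z
  have f: "(f has_field_derivative W z) (at z within U)" if "z \<in> U" for z
    unfolding f_def using g[OF that] by (auto intro!: derivative_eq_intros)
  have Imf: "Im (f z) = \<phi> z" if z: "z \<in> U" for z
  proof -
    have "((\<lambda>z. Im (f z) - \<phi> z) has_derivative (\<lambda>h. 0)) (at w within U)" if w: "w \<in> U" for w
    proof -
      have "((\<lambda>z. Im (f z)) has_derivative (\<lambda>h. Im (W w * h))) (at w within U)"
        using f[OF w] unfolding has_field_derivative_def by (rule bounded_linear.has_derivative[OF bounded_linear_Im])
      from has_derivative_diff[OF this \<phi>[OF w]] show ?thesis
        by simp
    qed
    then have "\<exists>c. \<forall>w\<in>U. Im (f w) - \<phi> w = c"
      by (rule has_derivative_zero_constant[OF conv])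
    then obtain c where "\<And>w. w \<in> U \<Longrightarrow> Im (f w) - \<phi> w = c"
      by auto
    from this[OF z] this[OF U0] show ?thesis
      using \<phi>0[OF U0] by (simp add: f_def)
  qed
  define F where "F z = (if 0 \<le> Im z then f z else cnj (f (cnj z)))" for z
  have F: "F holomorphic_on ball 0 R0"
    unfolding F_def
  proof (rule Schwarz_reflection)
    show "f holomorphic_on ball 0 R0 \<inter> {z. 0 < Im z}"
    proof (rule holomorphic_onI)
      fix z assume z: "z \<in> ball 0 R0 \<inter> {z. 0 < Im z}"
      then have "z \<in> U"
        by (auto simp: U_def)
      then have "(f has_field_derivative W z) (at z within ball 0 R0 \<inter> {z. 0 < Im z})"
        by (rule has_field_derivative_subset[OF f]) (auto simp: U_def)
      then show "f field_differentiable at z within ball 0 R0 \<inter> {z. 0 < Im z}"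
        by (auto simp: field_differentiable_def)
    qed
    show "continuous_on (ball 0 R0 \<inter> {z. 0 \<le> Im z}) f"
      using f unfolding U_def[symmetric] by (meson DERIV_continuous continuous_on_eq_continuous_within)
    show "f z \<in> \<real>" if "z \<in> ball 0 R0" "z \<in> \<real>" for z
    proof -
      have "z \<in> U" "Im z = 0"
        using that by (auto simp: U_def complex_is_Real_iff)
      then show ?thesis
        using Imf \<phi>0 by (simp add: complex_is_Real_iff)
    qed
  qed auto
  have F_upper: "F z = f z" if "z \<in> U" for z
    using that by (simp add: F_def U_def)
  \<comment> \<open>\<open>W\<close> is given only on the closed half-disc, so the derivatives are
    compared within \<open>U\<close>; uniqueness holds because 0 is a limit point of
    \<open>U\<close>.\<close>
  have "deriv F 0 = W 0"
  proof -
    have "(F has_field_derivative deriv F 0) (at 0)"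
      using F R0 by (intro holomorphic_derivI[of F "ball 0 R0"]) auto
    then have "(F has_field_derivative deriv F 0) (at 0 within U)"
      by (rule has_field_derivative_at_within)
    moreover have "(F has_field_derivative W 0) (at 0 within U)"
      using f[OF U0] by (rule has_field_derivative_transform_within[OF _ zero_less_one]) (use U0 F_upper in auto)
    moreover have "at (0::complex) within U \<noteq> bot"
    proof -
      have "interior U \<noteq> {}"
      proof -
        have "\<i> * of_real (R0 / 2) \<in> interior U"
          unfolding int using R0 by (simp add: norm_mult)
        then show ?thesis by blast
      qed
      then have "U \<noteq> {0}"
        by (metis interior_singleton)
      then show ?thesis
        using conv U0 connected_imp_perfect[OF convex_connected[OF conv]] trivial_limit_within by blast
    qed
    ultimately show ?thesis
      by (metis DERIV_deriv_iff_field_differentiable has_field_derivative_unique)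
  qed
  then have "A * R\<^sup>2 * \<rho> * (R - \<rho>) / ((R + \<rho>) * (R\<^sup>2 + \<rho>\<^sup>2)) \<le> Im (F (\<i> * \<rho>))"
  proof (intro typically_real_lower_bound[OF F _ _ A _ R \<rho>])
    show "F 0 = 0"
      by (simp add: F_def f_def)
    show "0 \<le> Im z * Im (F z)" if "norm z < R0" for z
    proof (cases "0 \<le> Im z")
      case True
      then show ?thesis
        using that Imf[of z] pos[of z] by (simp add: F_def U_def)
    next
      case False
      then show ?thesis
        using that Imf[of "cnj z"] pos[of "cnj z"] mult_nonpos_nonneg[of "Im z" "\<phi> (cnj z)"]
        by (simp add: F_def U_def)
    qed
  qed (simp add: W0)
  moreover have "\<i> * of_real \<rho> \<in> U"
    using \<rho> R by (simp add: U_def norm_mult)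
  ultimately show ?thesis
    using F_upper Imf by simp
qed

section \<open>Comparison with shear flows\<close>

context wave
begin

text \<open>The half-disc of radius \<open>\<eta> 0\<close> centred on the bed below the crest lies in the fluid and touches the
  surface at the crest; so a positive slope on the bed of \<open>\<psi>\<close> minus the shear flow of depth \<open>\<eta> 0\<close>
  costs at least a quarter of it at the crest.\<close>

lemma crest_velocity_gap:
  defines "h \<equiv> \<eta> 0"
  assumes crest: "\<And>x. \<eta> x \<le> h"
    and K: "(\<gamma> / 2 + 1 / py (0, h)) / py (0, h) \<le> 1 / h" and pos: "1 / h < \<gamma> * h / 2"
  shows "(\<gamma> * h / 2 - 1 / h) / 4 \<le> \<gamma> * h / 2 + 1 / h - py (0, h)"
proof -
  define s where "s = 1 / h - \<gamma> * h / 2"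
  define A where "A = py (0, 0) - s"
  have h: "0 < h"
    using eta_pos[of 0] by (simp add: h_def)
  \<comment> \<open>Unidirectionality enters here: the wave moves forward at the bed, while the
    shear flow has bed velocity \<open>s < 0\<close> by \<open>pos\<close>.\<close>
  have A: "0 < A" "- s \<le> A"
    using pos py_pos[OF bed_in, of 0] by (auto simp: A_def s_def)
  have slope0: "\<eta>' 0 = 0"
    by (rule DERIV_local_max[OF eta_deriv zero_less_one]) (use crest in \<open>auto simp: h_def\<close>)
  have q: "0 < py (0, h)"
    using py_pos[OF top_in, of 0] by (simp add: h_def)
  have q2: "(py (0, h))\<^sup>2 \<le> 2 * (r - \<eta> x)" for x
    using bernoulli_slope[of 0] slope0 crest[of x] by (simp add: h_def)
  define U where "U = ball 0 h \<inter> {z. 0 \<le> Im z}"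
  have inside: "Im z < \<eta> (Re z)" if "z \<in> ball 0 h" for z
  proof -
    have "\<bar>Re z\<bar> < h"
      using abs_Re_le_cmod[of z] that by simp
    then have "sqrt (h\<^sup>2 - (Re z)\<^sup>2) \<le> \<eta> (Re z)"
      using profile_above_circle[OF q q2 _ slope0, of "Re z"] K by (simp add: h_def)
    moreover have "(norm z)\<^sup>2 < h\<^sup>2"
      using that by (intro power_strict_mono) auto
    then have "(Im z)\<^sup>2 < h\<^sup>2 - (Re z)\<^sup>2"
      by (simp add: cmod_power2)
    then have "\<bar>Im z\<bar> < sqrt (h\<^sup>2 - (Re z)\<^sup>2)"
      using real_less_rsqrt[of "\<bar>Im z\<bar>"] by simp
    ultimately show ?thesis
      by linarith
  qed
  have in_S: "(Re z, Im z) \<in> S" if "z \<in> U" for z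
    using inside[of z] that by (auto simp: U_def less_imp_le)
  have in_fluid: "(Re z, Im z) \<in> fluid \<eta>" if "z \<in> ball 0 h \<inter> {z. 0 < Im z}" for z
    using inside[of z] that by auto
  have Re_Im: "(Re has_derivative Re) F" "(Im has_derivative Im) F" for F
    by (intro bounded_linear_imp_has_derivative bounded_linear_Re bounded_linear_Im)+
  have pair: "((\<lambda>z. (Re z, Im z)) has_derivative (\<lambda>k. (Re k, Im k))) (at w within T)" for w T
    by (intro has_derivative_Pair Re_Im)
  have chain: "((\<lambda>z. f (Re z, Im z)) has_derivative (\<lambda>k. dx S f (Re z, Im z) * Re k + dy S f (Re z, Im z) * Im k)) (at z within U)"
    if f: "f differentiable_on S" and z: "z \<in> U" for f z
  proof -
    have "(f has_derivative (\<lambda>k. dx S f (Re z, Im z) * fst k + dy S f (Re z, Im z) * snd k))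
        (at (Re z, Im z) within (\<lambda>z. (Re z, Im z)) ` U)"
      using has_derivative_dx_dy[OF f in_S[OF z]] by (rule has_derivative_subset) (use in_S in auto)
    from has_derivative_in_compose[OF pair this] show ?thesis
      by simp
  qed
  \<comment> \<open>The \<open>y\<close>-derivative of \<open>\<phi>\<close> plus
    \<open>\<i>\<close> times its \<open>x\<close>-derivative; the Cauchy-Riemann equations amount
    to the Poisson equation for \<open>\<psi>\<close> and equality of mixed partials.\<close>
  define W where "W z = Complex (py (Re z, Im z) - \<gamma> * Im z - s) (px (Re z, Im z))" for z
  define \<phi> where "\<phi> z = \<psi> (Re z, Im z) - \<gamma> * (Im z)\<^sup>2 / 2 - s * Im z" for z
  have W_deriv: "(W has_derivative (\<lambda>k. Complex (dx S py (Re z, Im z) * Re k + dy S py (Re z, Im z) * Im k - \<gamma> * Im k)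
      (dx S px (Re z, Im z) * Re k + dy S px (Re z, Im z) * Im k))) (at z within U)" if z: "z \<in> U" for z
    unfolding W_def Complex_eq
    by (rule derivative_eq_intros chain diff z refl Re_Im | simp)+
  have gap: "A * R\<^sup>2 * \<rho> * (R - \<rho>) / ((R + \<rho>) * (R\<^sup>2 + \<rho>\<^sup>2)) \<le> \<phi> (\<i> * \<rho>)"
    if R: "R < h" and \<rho>: "0 < \<rho>" "\<rho> < R" for R \<rho>
  proof (rule half_disc_lower_bound[OF _ _ _ A(1) _ _ _ R \<rho>])
    show "W holomorphic_on ball 0 h \<inter> {z. 0 < Im z}"
    proof (rule holomorphic_onI)
      fix z assume z: "z \<in> ball 0 h \<inter> {z. 0 < Im z}"
      then have zU: "z \<in> U"
        by (auto simp: U_def)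
      have zS: "(Re z, Im z) \<in> S"
        by (rule in_S[OF zU])
      define c where "c = Complex (dy S px (Re z, Im z)) (dx S px (Re z, Im z))"
      have "dy S py (Re z, Im z) = \<gamma> - dx S px (Re z, Im z)"
        using laplace[OF zS] by simp
      then have "(\<lambda>k. Complex (dx S py (Re z, Im z) * Re k + dy S py (Re z, Im z) * Im k - \<gamma> * Im k)
          (dx S px (Re z, Im z) * Re k + dy S px (Re z, Im z) * Im k)) = (*) c"
        by (auto simp: fun_eq_iff complex_eq_iff c_def mixed[OF zS] algebra_simps)
      then have "(W has_field_derivative c) (at z within U)"
        using W_deriv[OF zU] by (simp add: has_field_derivative_def)
      then have "(W has_field_derivative c) (at z within ball 0 h \<inter> {z. 0 < Im z})"
        by (rule has_field_derivative_subset) (auto simp: U_def)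
      then show "W field_differentiable at z within ball 0 h \<inter> {z. 0 < Im z}"
        by (auto simp: field_differentiable_def)
    qed
    show "continuous_on (ball 0 h \<inter> {z. 0 \<le> Im z}) W"
      using W_deriv has_derivative_continuous unfolding U_def[symmetric] continuous_on_eq_continuous_within by blast
    show "W 0 = complex_of_real A"
      by (simp add: W_def A_def px_bed complex_eq_iff)
    fix z assume "z \<in> ball 0 h \<inter> {z. 0 \<le> Im z}"
    then have z: "z \<in> U"
      by (simp add: U_def)
    have "(\<phi> has_derivative (\<lambda>k. px (Re z, Im z) * Re k + py (Re z, Im z) * Im k - \<gamma> * (Im k * Im z) - s * Im k)) (at z within U)"
      unfolding \<phi>_def
      by (rule derivative_eq_intros chain diff z refl Re_Im | simp)+
    then show "(\<phi> has_derivative (\<lambda>k. Im (W z * k))) (at z within (ball 0 h \<inter> {z. 0 \<le> Im z}))"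
      unfolding U_def[symmetric] by (rule has_derivative_eq_rhs) (auto simp: fun_eq_iff W_def algebra_simps)
    show "\<phi> z = 0" if "Im z = 0"
      using that by (simp add: \<phi>_def psi_bed)
    show "0 \<le> \<phi> z"
    proof -
      have "\<gamma> * (\<eta> x)\<^sup>2 / 2 + s * \<eta> x \<le> 1" for x
        unfolding s_def using shear_le_1[of \<gamma> h "\<eta> x"] \<gamma> h crest[of x] eta_pos[of x] by simp
      from shear_below[OF this in_S[OF z]] show ?thesis
        by (simp add: \<phi>_def)
    qed
  qed
  \<comment> \<open>The circle may not touch the boundary of the half-disc in the previous bound,
    hence the limit of \<open>R\<close> to \<open>h\<close> from below.\<close>
  have gap_h: "A * h\<^sup>2 * \<rho> * (h - \<rho>) / ((h + \<rho>) * (h\<^sup>2 + \<rho>\<^sup>2)) \<le> \<phi> (\<i> * \<rho>)"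
    if \<rho>: "0 < \<rho>" "\<rho> < h" for \<rho>
  proof (rule tendsto_upperbound)
    have "(h + \<rho>) * (h\<^sup>2 + \<rho>\<^sup>2) \<noteq> 0"
      using \<rho> by (simp add: sum_power2_gt_zero_iff less_imp_neq[THEN not_sym] add_pos_pos)
    then show "((\<lambda>R. A * R\<^sup>2 * \<rho> * (R - \<rho>) / ((R + \<rho>) * (R\<^sup>2 + \<rho>\<^sup>2))) \<longlongrightarrow>
        A * h\<^sup>2 * \<rho> * (h - \<rho>) / ((h + \<rho>) * (h\<^sup>2 + \<rho>\<^sup>2))) (at_left h)"
      by (intro tendsto_intros)
    have "\<forall>\<^sub>F R in at_left h. R \<in> {\<rho><..<h}"
      by (rule eventually_at_left_real[OF \<rho>(2)])
    then show "\<forall>\<^sub>F R in at_left h. A * R\<^sup>2 * \<rho> * (R - \<rho>) / ((R + \<rho>) * (R\<^sup>2 + \<rho>\<^sup>2)) \<le> \<phi> (\<i> * \<rho>)"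
      by eventually_elim (use gap \<rho> in auto)
  qed simp
  \<comment> \<open>Both parts vanish at \<open>h\<close>, so the inequality below \<open>h\<close>
    passes to the derivatives at \<open>h\<close>. The lower bound has derivative
    \<open>- A / 4\<close> there, the origin of the quarter.\<close>
  define E where "E \<rho> = A * h\<^sup>2 * \<rho> * (h - \<rho>) / ((h + \<rho>) * (h\<^sup>2 + \<rho>\<^sup>2)) - (\<psi> (0, \<rho>) - \<gamma> * \<rho>\<^sup>2 / 2 - s * \<rho>)" for \<rho>
  have "0 \<le> - A / 4 - (py (0, h) - \<gamma> * h - s)"
  proof (rule endpoint_max_imp_deriv_nonneg[OF h])
    have "((\<lambda>\<rho>. A * h\<^sup>2 * \<rho> * (h - \<rho>) / ((h + \<rho>) * (h\<^sup>2 + \<rho>\<^sup>2))) has_real_derivative - A / 4) (at h within {0..h})"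
    proof -
      have ne: "(h + h) * (h\<^sup>2 + h\<^sup>2) \<noteq> 0"
        using h by simp
      have "((\<lambda>\<rho>. A * h\<^sup>2 * \<rho> * (h - \<rho>) / ((h + \<rho>) * (h\<^sup>2 + \<rho>\<^sup>2))) has_real_derivative
          ((A * h\<^sup>2 * h * (0 - 1) + A * h\<^sup>2 * (h - h)) * ((h + h) * (h\<^sup>2 + h\<^sup>2))
            - A * h\<^sup>2 * h * (h - h) * ((h + h) * (2 * h) + (h\<^sup>2 + h\<^sup>2))) / (((h + h) * (h\<^sup>2 + h\<^sup>2)) * ((h + h) * (h\<^sup>2 + h\<^sup>2)))) (at h within {0..h})"
        by (rule derivative_eq_intros refl ne | simp)+
      moreover have "((A * h\<^sup>2 * h * (0 - 1) + A * h\<^sup>2 * (h - h)) * ((h + h) * (h\<^sup>2 + h\<^sup>2))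
            - A * h\<^sup>2 * h * (h - h) * ((h + h) * (2 * h) + (h\<^sup>2 + h\<^sup>2))) / (((h + h) * (h\<^sup>2 + h\<^sup>2)) * ((h + h) * (h\<^sup>2 + h\<^sup>2))) = - A / 4"
        using h by (simp add: field_simps power2_eq_square)
      ultimately show ?thesis
        by (simp only:)
    qed
    moreover have "((\<lambda>\<rho>. \<psi> (0, \<rho>) - \<gamma> * \<rho>\<^sup>2 / 2 - s * \<rho>) has_real_derivative py (0, h) - \<gamma> * h - s) (at h within {0..h})"
      using dy_vertical[OF diff(1) top_in, of 0] unfolding h_def
      by (auto intro!: derivative_eq_intros)
    ultimately show "(E has_real_derivative - A / 4 - (py (0, h) - \<gamma> * h - s)) (at h within {0..h})"
      unfolding E_def by (rule DERIV_diff)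
    fix \<rho> assume \<rho>: "0 < \<rho>" "\<rho> < h"
    have "E \<rho> \<le> 0"
      using gap_h[OF \<rho>] by (simp add: E_def \<phi>_def)
    moreover have "E h = 0"
      using psi_top[of 0] h by (simp add: E_def s_def h_def[symmetric] field_simps power2_eq_square)
    ultimately show "E \<rho> \<le> E h"
      by simp
  qed
  then show ?thesis
    using A(2) by (simp add: s_def field_simps)
qed

text \<open>\<open>\<psi>\<close> lies below the shear flow of trough depth and equals it at the
  trough, so it is at least as steep there.\<close>

lemma trough_bernoulli_ge:
  assumes trough: "\<And>x'. \<eta> x \<le> \<eta> x'"
  defines "h \<equiv> \<eta> x"
  shows "(\<gamma> * h / 2 + 1 / h)\<^sup>2 / 2 + h \<le> r"
proof -
  define s where "s = 1 / h - \<gamma> * h / 2"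
  have h: "0 < h"
    using eta_pos by (simp add: h_def)
  have "1 \<le> \<gamma> * (\<eta> x')\<^sup>2 / 2 + s * \<eta> x'" for x'
    unfolding s_def using shear_ge_1[of \<gamma> h "\<eta> x'"] \<gamma> h trough[of x'] by (simp add: h_def)
  note above = shear_above[OF this]
  have "0 \<le> py (x, h) - \<gamma> * h - s"
  proof (rule endpoint_max_imp_deriv_nonneg[OF h])
    show "((\<lambda>t. \<psi> (x, t) - \<gamma> * t\<^sup>2 / 2 - s * t) has_real_derivative py (x, h) - \<gamma> * h - s) (at h within {0..h})"
      using dy_vertical[OF diff(1) top_in, of x] unfolding h_def
      by (auto intro!: derivative_eq_intros)
    show "\<psi> (x, t) - \<gamma> * t\<^sup>2 / 2 - s * t \<le> \<psi> (x, h) - \<gamma> * h\<^sup>2 / 2 - s * h" if "0 < t" "t < h" for t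
    proof -
      have "\<gamma> * h\<^sup>2 / 2 + s * h = 1"
        using h by (simp add: s_def field_simps power2_eq_square)
      then show ?thesis
        using above[of x t] that psi_top[of x] by (simp add: h_def)
    qed
  qed
  then have "\<gamma> * h / 2 + 1 / h \<le> py (x, h)"
    by (simp add: s_def)
  then have "(\<gamma> * h / 2 + 1 / h)\<^sup>2 \<le> (py (x, h))\<^sup>2"
    using \<gamma> h by (intro power_mono) auto
  also have "\<dots> \<le> (px (x, h))\<^sup>2 + (py (x, h))\<^sup>2"
    by simp
  also have "\<dots> = 2 * (r - h)"
    using bernoulli[of x] by (simp add: h_def field_simps)
  finally show ?thesis
    by simp
qed

text \<open>The mirror image: \<open>\<psi>\<close> lies above the shear flow of crest depth and
  touches it at the crest.\<close>

lemma crest_velocity_le: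
  assumes crest: "\<And>x'. \<eta> x' \<le> \<eta> x"
  defines "h \<equiv> \<eta> x"
  shows "py (x, h) \<le> \<gamma> * h / 2 + 1 / h"
proof -
  define s where "s = 1 / h - \<gamma> * h / 2"
  have h: "0 < h"
    using eta_pos by (simp add: h_def)
  have "\<gamma> * (\<eta> x')\<^sup>2 / 2 + s * \<eta> x' \<le> 1" for x'
    unfolding s_def using shear_le_1[of \<gamma> h "\<eta> x'"] \<gamma> h crest[of x'] eta_pos[of x'] by (simp add: h_def)
  note below = shear_below[OF this]
  have "0 \<le> \<gamma> * h + s - py (x, h)"
  proof (rule endpoint_max_imp_deriv_nonneg[OF h])
    show "((\<lambda>t. \<gamma> * t\<^sup>2 / 2 + s * t - \<psi> (x, t)) has_real_derivative \<gamma> * h + s - py (x, h)) (at h within {0..h})"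
      using dy_vertical[OF diff(1) top_in, of x] unfolding h_def
      by (auto intro!: derivative_eq_intros)
    show "\<gamma> * t\<^sup>2 / 2 + s * t - \<psi> (x, t) \<le> \<gamma> * h\<^sup>2 / 2 + s * h - \<psi> (x, h)" if "0 < t" "t < h" for t
    proof -
      have "\<gamma> * h\<^sup>2 / 2 + s * h = 1"
        using h by (simp add: s_def field_simps power2_eq_square)
      then show ?thesis
        using below[of x t] that psi_top[of x] by (simp add: h_def)
    qed
  qed
  then show ?thesis
    by (simp add: s_def)
qed

end

section \<open>The Bernoulli constants of the shear flows\<close>

text \<open>From now on \<open>a = sqrt (2 / \<gamma>)\<close> is the depth of the shear flow with \<open>s = 0\<close>. The shear flow of
  depth \<open>h\<close> has surface velocity \<open>shear_velocity a h\<close> and Bernoulli constant \<open>shear_energy a h\<close>.\<close>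

definition shear_velocity :: "real \<Rightarrow> real \<Rightarrow> real" where
  "shear_velocity a h = h / a\<^sup>2 + 1 / h"

definition shear_energy :: "real \<Rightarrow> real \<Rightarrow> real" where
  "shear_energy a h = (shear_velocity a h)\<^sup>2 / 2 + h"

text \<open>The arithmetic-geometric mean inequality with its exact remainder. Depth
  \<open>a\<close>, where the shear flow is at rest on the bed, minimises the surface
  velocity.\<close>

lemma shear_velocity_eq:
  assumes "0 < a" "0 < h"
  shows "shear_velocity a h = 2 / a + (h - a)\<^sup>2 / (a\<^sup>2 * h)"
  using assms by (simp add: shear_velocity_def field_simps power2_eq_square)

lemma shear_velocity_ge:
  assumes "0 < a" "0 < h"
  shows "2 / a \<le> shear_velocity a h"
  using assms by (simp add: shear_velocity_eq)

lemma shear_energy_ge: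
  assumes "0 < a" "0 < h"
  shows "2 / a\<^sup>2 + 2 * (h - a)\<^sup>2 / (a ^ 3 * h) + h \<le> shear_energy a h"
proof -
  define t where "t = (h - a)\<^sup>2 / (a\<^sup>2 * h)"
  have "(2 / a + t)\<^sup>2 = 4 / a\<^sup>2 + 4 * (t / a) + t\<^sup>2"
    using assms by (simp add: power2_eq_square field_simps)
  moreover have "0 \<le> t\<^sup>2"
    by simp
  moreover have "t / a = (h - a)\<^sup>2 / (a ^ 3 * h)"
    using assms by (simp add: t_def power2_eq_square power3_eq_cube)
  ultimately show ?thesis
    using assms by (simp add: shear_energy_def shear_velocity_eq flip: t_def)
qed

lemma shear_energy_ge_shallow:
  assumes "0 < a" "0 < h" "h \<le> a"
  shows "2 / a\<^sup>2 + 2 * (h - a)\<^sup>2 / a ^ 4 + h \<le> shear_energy a h"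
proof -
  have "a ^ 3 * h \<le> a ^ 4"
    using assms by (simp add: power4_eq_xxxx power3_eq_cube)
  then have "2 * (h - a)\<^sup>2 / a ^ 4 \<le> 2 * (h - a)\<^sup>2 / (a ^ 3 * h)"
    using assms by (intro divide_left_mono) auto
  then show ?thesis
    using shear_energy_ge[OF assms(1,2)] by linarith
qed

lemma shear_energy_lower_bound:
  assumes "0 < a" "0 < h"
  shows "2 / a\<^sup>2 + a - a ^ 4 / 8 \<le> shear_energy a h"
proof (cases "h \<le> a")
  case True
  \<comment> \<open>Completing the square: \<open>2 * (h - a)\<^sup>2 / a ^ 4 + h\<close> is least
    at \<open>h = a - a ^ 4 / 4\<close>, with value \<open>a - a ^ 4 / 8\<close>.\<close>
  have "0 \<le> 2 * ((h - a) / a\<^sup>2 + a\<^sup>2 / 4)\<^sup>2"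
    by simp
  also have "\<dots> = 2 * (h - a)\<^sup>2 / a ^ 4 + (h - a) + a ^ 4 / 8"
    using assms by (simp add: power2_eq_square power4_eq_xxxx field_simps)
  finally show ?thesis
    using shear_energy_ge_shallow[OF assms True] by linarith
next
  case False
  have "0 \<le> 2 * (h - a)\<^sup>2 / (a ^ 3 * h)" "0 \<le> a ^ 4 / 8"
    using assms by auto
  then show ?thesis
    using shear_energy_ge[OF assms] False by linarith
qed

text \<open>If the deficit \<open>t = a - h\<close> exceeded \<open>2 * a ^ 4\<close>, the quadratic
  term would be at least \<open>4 * t\<close>, whereas the hypothesis allows only
  \<open>t + 5 * a ^ 4\<close>; but \<open>3 * t > 6 * a ^ 4\<close>.\<close>

lemma depth_ge_of_shear_energy_le:
  assumes "0 < a" "0 < h" "shear_energy a h \<le> 2 / a\<^sup>2 + a + 5 * a ^ 4"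
  shows "a - 2 * a ^ 4 \<le> h"
proof (rule ccontr)
  assume less: "\<not> a - 2 * a ^ 4 \<le> h"
  have a4: "0 < a ^ 4"
    using assms by simp
  define t where "t = a - h"
  have t: "2 * a ^ 4 < t"
    using less by (simp add: t_def)
  have "h \<le> a"
    using t a4 unfolding t_def by linarith
  then have "2 * t\<^sup>2 / a ^ 4 \<le> t + 5 * a ^ 4"
    using shear_energy_ge_shallow[OF assms(1,2)] assms(3) by (simp add: t_def power2_commute)
  moreover have "4 * t \<le> 2 * t\<^sup>2 / a ^ 4"
  proof -
    have "0 \<le> t"
      using t a4 by linarith
    then have "t * (2 * a ^ 4) \<le> t * t"
      using t by (intro mult_left_mono) auto
    then show ?thesis
      using a4 by (simp add: pos_le_divide_eq power2_eq_square algebra_simps)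
  qed
  ultimately show False
    using t a4 by linarith
qed

text \<open>The velocity drop is \<open>(y - x) * (1 / (x * y) - 1 / a\<^sup>2)\<close>, and the two
  velocities add up to at least \<open>4 / a\<close>. The hypothesis says that the kinetic loss
  beats the gain \<open>y - x\<close> in height. It constrains only the product, so \<open>y\<close>
  may lie beyond \<open>a\<close> if \<open>x\<close> is low enough.\<close>

lemma shear_energy_strict_decreasing:
  assumes "0 < a" "0 < x" "x < y" and xy: "x * y * (1 + a ^ 3 / 2) < a\<^sup>2"
  shows "shear_energy a y < shear_energy a x"
proof -
  have y: "0 < y"
    using assms by simp
  have fp: "4 / a \<le> shear_velocity a x + shear_velocity a y"
    using shear_velocity_ge[OF assms(1,2)] shear_velocity_ge[OF assms(1) y] by simp
  have "1 / a\<^sup>2 + a / 2 = (1 + a ^ 3 / 2) / a\<^sup>2"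
    using assms by (simp add: field_simps power2_eq_square power3_eq_cube)
  also have "\<dots> < 1 / (x * y)"
    using xy assms y by (simp add: divide_simps mult_ac)
  finally have "a / 2 < 1 / (x * y) - 1 / a\<^sup>2"
    by simp
  then have "(y - x) * (a / 2) < (y - x) * (1 / (x * y) - 1 / a\<^sup>2)"
    using assms by (intro mult_strict_left_mono) auto
  also have "\<dots> = shear_velocity a x - shear_velocity a y"
    using assms y by (simp add: shear_velocity_def field_simps power2_eq_square)
  finally have fm: "(y - x) * (a / 2) < shear_velocity a x - shear_velocity a y" .
  have "(y - x) * (a / 2) * (4 / a) < (shear_velocity a x - shear_velocity a y) * (shear_velocity a x + shear_velocity a y)"
    using fm fp assms by (intro mult_less_le_imp_less) auto
  moreover have "(y - x) * (a / 2) * (4 / a) = 2 * (y - x)"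
    using assms by simp
  ultimately show ?thesis
    by (simp add: shear_energy_def power2_eq_square algebra_simps)
qed

text \<open>The remainder in \<open>shear_velocity_eq\<close> is quadratic, so a depth error of
  \<open>a ^ 4\<close> raises the velocity by at most \<open>2 * a ^ 5\<close> and the energy by
  about \<open>4 * a ^ 4\<close>.\<close>

lemma shear_energy_le_near:
  assumes a: "0 < a" "a \<le> 1 / 10" and d: "a - a ^ 4 \<le> d" "d \<le> a"
  shows "shear_energy a d \<le> 2 / a\<^sup>2 + a + 5 * a ^ 4"
proof -
  have a3: "0 < a ^ 3" "a ^ 3 \<le> 1 / 1000"
    using a power_mono[of a "1 / 10" 3] by (auto simp: power3_eq_cube)
  have a4: "a ^ 4 = a * a ^ 3"
    by (simp add: power4_eq_xxxx power3_eq_cube)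
  have "a * a ^ 3 \<le> a * (1 / 1000)"
    using a a3 by (intro mult_left_mono) auto
  then have half: "a / 2 \<le> d"
    using d(1) a unfolding a4 by linarith
  then have d0: "0 < d"
    using a by simp
  have "(d - a)\<^sup>2 \<le> (a ^ 4)\<^sup>2"
    using d by (intro iffD1[OF abs_le_square_iff]) (auto simp: a4)
  then have "(d - a)\<^sup>2 / (a\<^sup>2 * d) \<le> (a ^ 4)\<^sup>2 / (a\<^sup>2 * (a / 2))"
    using half a d0 by (intro frac_le mult_left_mono mult_pos_pos) auto
  also have "\<dots> = 2 * a ^ 5"
    using a by (simp add: power2_eq_square eval_nat_numeral)
  finally have "shear_velocity a d \<le> 2 / a + 2 * a ^ 5"
    using shear_velocity_eq[OF a(1) d0] by simp
  moreover have "0 \<le> shear_velocity a d"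
    using a d0 by (simp add: shear_velocity_def)
  ultimately have "(shear_velocity a d)\<^sup>2 \<le> (2 / a + 2 * a ^ 5)\<^sup>2"
    by (intro power_mono)
  also have "\<dots> = 4 / a\<^sup>2 + 8 * a ^ 4 + 4 * (a ^ 4 * (a ^ 3 * a ^ 3))"
    using a by (simp add: power2_eq_square eval_nat_numeral field_simps)
  also have "\<dots> \<le> 4 / a\<^sup>2 + 10 * a ^ 4"
  proof -
    have "a ^ 3 * a ^ 3 \<le> 1 / 1000 * (1 / 1000)"
      using a3 by (intro mult_mono) auto
    then have "a ^ 4 * (a ^ 3 * a ^ 3) \<le> a ^ 4 * (1 / 2)"
      using a by (intro mult_left_mono) auto
    then show ?thesis
      by simp
  qed
  finally show ?thesis
    using d(2) by (simp add: shear_energy_def)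
qed

text \<open>To leading order the loss is \<open>a ^ 5 / 16\<close>; the slack up to
  \<open>a ^ 5 / 4\<close> absorbs the term \<open>2 * a ^ 7\<close> from the crest height.\<close>

lemma crest_velocity_lower_bound:
  fixes a h u r :: real
  assumes a: "0 < a" "a \<le> 1 / 10" and h: "h \<le> a + a ^ 7"
    and r: "2 / a\<^sup>2 + a - a ^ 4 / 8 \<le> r" and u: "0 < u" "u\<^sup>2 = 2 * (r - h)"
  shows "2 / a - a ^ 5 / 4 \<le> u"
proof (rule power2_le_imp_le)
  have a3: "0 < a ^ 3" "a ^ 3 \<le> 1 / 1000"
    using a power_mono[of a "1 / 10" 3] by (auto simp: power3_eq_cube)
  have "(2 / a - a ^ 5 / 4)\<^sup>2 = 4 / a\<^sup>2 - a ^ 4 + a ^ 4 * (a ^ 3 * a ^ 3) / 16"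
    using a by (simp add: power2_eq_square eval_nat_numeral field_simps)
  also have "\<dots> \<le> 4 / a\<^sup>2 - a ^ 4 / 4 - 2 * (a ^ 4 * a ^ 3)"
  proof -
    have "a ^ 3 * a ^ 3 \<le> 1 / 1000 * (1 / 1000)"
      using a3 by (intro mult_mono) auto
    then have "a ^ 4 * (a ^ 3 * a ^ 3) \<le> a ^ 4 * (1 / 1000)"
      using a by (intro mult_left_mono) auto
    moreover have "a ^ 4 * a ^ 3 \<le> a ^ 4 * (1 / 1000)"
      using a a3 by (intro mult_left_mono) auto
    ultimately show ?thesis
      using zero_le_power[of a 4] a by linarith
  qed
  also have "\<dots> \<le> u\<^sup>2"
  proof -
    have "a ^ 7 = a ^ 4 * a ^ 3"
      by (simp flip: power_add)
    moreover have "2 / a\<^sup>2 = 2 * (1 / a\<^sup>2)" "4 / a\<^sup>2 = 4 * (1 / a\<^sup>2)"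
      by simp_all
    moreover have "4 * k - p / 4 - 2 * q \<le> 2 * r - 2 * h"
      if "2 * k + a - p / 8 \<le> r" "h \<le> a + q" for k p q
      using that by linarith
    ultimately show ?thesis
      using u(2) r h by (metis right_diff_distrib)
  qed
  finally show "(2 / a - a ^ 5 / 4)\<^sup>2 \<le> u\<^sup>2" .
qed (use u in simp)

text \<open>With \<open>c = a ^ 6\<close> everything is measured in units of \<open>1 / a\<close>:
  the velocity defect is at most \<open>c / 4 + c\<^sup>2\<close>, and a quarter of the backward bed
  velocity is at least \<open>3 * c / 8\<close>. The first claim needs only
  \<open>1 / u \<le> 2 / 3 * a\<close>.\<close>

lemma barrier_inequalities:
  fixes a h u r :: real
  assumes a: "0 < a" "a \<le> 1 / 10" and h: "h = a + a ^ 7"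
    and u: "2 / a - a ^ 5 / 4 \<le> u"
  shows "(1 / a\<^sup>2 + 1 / u) / u \<le> 1 / h" "1 / h < h / a\<^sup>2"
    "shear_velocity a h - u < (h / a\<^sup>2 - 1 / h) / 4"
proof -
  define c where "c = a ^ 6"
  have a3: "0 < a ^ 3" "a ^ 3 \<le> 1 / 1000"
    using a power_mono[of a "1 / 10" 3] by (auto simp: power3_eq_cube)
  have c3: "c = a ^ 3 * a ^ 3"
    by (simp add: c_def flip: power_add)
  have "a ^ 3 * a ^ 3 \<le> a ^ 3 * (1 / 1000)"
    using a3 by (intro mult_left_mono) auto
  then have c: "0 < c" "c \<le> 1 / 1000"
    using a3 unfolding c3 by (auto intro: order_trans)
  have hc: "h = a * (1 + c)"
    unfolding h c_def by (simp add: algebra_simps eval_nat_numeral)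
  have "2 / a - a ^ 5 / 4 = (2 - c / 4) / a"
    using a unfolding c_def by (simp add: field_simps eval_nat_numeral)
  with u have uc: "(2 - c / 4) / a \<le> u"
    by simp
  have "3 / 2 / a \<le> (2 - c / 4) / a"
    using a c by (intro divide_right_mono) auto
  with uc have u32: "3 / 2 / a \<le> u"
    by simp
  have u0: "0 < u"
    using u32 a by (smt (verit) divide_pos_pos)
  have inv: "1 / u \<le> a * (2 / 3)"
  proof -
    have "1 / u \<le> 1 / (3 / 2 / a)"
      using u32 a u0 by (intro divide_left_mono) auto
    then show ?thesis
      using a by simp
  qed
  show "(1 / a\<^sup>2 + 1 / u) / u \<le> 1 / h"
  proof -
    have "(1 / a\<^sup>2 + 1 / u) / u = (1 / a\<^sup>2 + 1 / u) * (1 / u)"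
      by simp
    also have "\<dots> \<le> (1 / a\<^sup>2 + a * (2 / 3)) * (a * (2 / 3))"
      using inv u0 a by (intro mult_mono add_left_mono) auto
    also have "\<dots> = (1 + a ^ 3 * (2 / 3)) * (2 / 3) / a"
      using a by (simp add: field_simps power2_eq_square power3_eq_cube)
    also have "\<dots> \<le> (1 / (1 + c)) / a"
    proof (rule divide_right_mono)
      have "(1 + a ^ 3 * (2 / 3)) * (2 / 3) \<le> 9 / 10"
        using a3 by (simp add: algebra_simps)
      also have "\<dots> \<le> 1 / (1 + c)"
        using c by (simp add: field_simps)
      finally show "(1 + a ^ 3 * (2 / 3)) * (2 / 3) \<le> 1 / (1 + c)" .
    qed (use a in simp)
    also have "\<dots> = 1 / h"
      using a c by (simp add: hc)
    finally show ?thesis .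
  qed
  have h1: "h / a\<^sup>2 = (1 + c) / a" "1 / h = (1 / (1 + c)) / a"
    using a by (auto simp: hc power2_eq_square)
  have q: "1 / (1 + c) \<le> 1 - c + c\<^sup>2" "1 / (1 + c) \<le> 1 - c / 2"
    using c by (simp_all add: divide_simps power2_eq_square algebra_simps)
  show "1 / h < h / a\<^sup>2"
    unfolding h1 using a c q by (intro divide_strict_right_mono) auto
  have cc: "c\<^sup>2 \<le> c * (1 / 1000)"
    unfolding power2_eq_square using c by (intro mult_left_mono) auto
  have "shear_velocity a h - u \<le> (1 + c) / a + (1 / (1 + c)) / a - (2 - c / 4) / a"
    using uc by (simp add: shear_velocity_def h1)
  also have "\<dots> = ((1 + c) + 1 / (1 + c) - (2 - c / 4)) / a"
    by (simp add: add_divide_distrib diff_divide_distrib)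
  also have "\<dots> < ((1 + c) - 1 / (1 + c)) / 4 / a"
    using a c q cc by (intro divide_strict_right_mono) auto
  also have "\<dots> = (h / a\<^sup>2 - 1 / h) / 4"
    unfolding h1 diff_divide_distrib by (simp add: mult.commute)
  finally show "shear_velocity a h - u < (h / a\<^sup>2 - 1 / h) / 4" .
qed

section \<open>Laminar flows, Stokes waves and solitary waves\<close>

context wave
begin

text \<open>\<open>px\<close> is bounded and harmonic and vanishes on bed and flat surface. This
  rules out flat profiles for solitary waves, which are non-laminar by definition.\<close>

lemma flat_imp_laminar:
  assumes flat: "\<And>x. \<eta> x = c"
  shows "laminar \<gamma> \<eta> \<psi> r"
proof -
  obtain B where B: "\<And>z. z \<in> S \<Longrightarrow> \<bar>px z\<bar> \<le> B"
    using bounded_gradient by auto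
  have H: "\<eta> x \<le> c" for x
    by (simp add: flat)
  have slope: "\<eta>' x = 0" for x
  proof -
    have "\<eta> = (\<lambda>_. c)"
      using flat by auto
    then show ?thesis
      by simp
  qed
  have bd: "px z \<le> B" "- px z \<le> B" if "z \<in> S" for z
    using B[OF that] by linarith+
  have "px z = 0" if z: "z \<in> S" for z
  proof (rule antisym)
    show "px z \<le> 0"
      by (rule max_principle[OF eta_cont eta_pos H _ bd(1) _ _ _ _ _ _ _ z,
            where Gx = "dx S px" and Gy = "dy S px" and Gxx = "dx S (dx S px)" and Gyy = "dy S (dy S px)"])
        (auto intro!: dx_int dy_int diff differentiable_imp_continuous_on simp: px_harmonic px_top slope px_bed)
    have "- px z \<le> 0"
      by (rule max_principle[OF eta_cont eta_pos H _ bd(2) _ _ _ _ _ _ _ z,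
            where Gx = "\<lambda>z. - dx S px z" and Gy = "\<lambda>z. - dy S px z"
              and Gxx = "\<lambda>z. - dx S (dx S px) z" and Gyy = "\<lambda>z. - dy S (dy S px) z"])
        (use px_harmonic in \<open>force intro!: DERIV_minus dx_int dy_int diff differentiable_imp_continuous_on continuous_intros simp: px_top slope px_bed\<close>)+
    then show "0 \<le> px z"
      by simp
  qed
  then show ?thesis
    using solution flat by (auto simp: laminar_def vel_v_def)
qed

end

context unidirectional_flow
begin

text \<open>In a laminar flow \<open>py\<close> grows linearly with rate \<open>\<gamma>\<close>
  from a positive bed velocity; integrating to the surface value 1 leaves less than 1 for
  \<open>\<gamma> * (\<eta> x)\<^sup>2 / 2\<close>. Thus the curve starts strictly below depth
  \<open>a\<close>.\<close>

lemma laminar_depth_less: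
  assumes lam: "laminar \<gamma> \<eta> \<psi> r"
  shows "\<gamma> * (\<eta> x)\<^sup>2 / 2 < 1"
proof -
  have px0: "px z = 0" if "z \<in> S" for z
    using lam that by (auto simp: laminar_def vel_v_def)
  have pyy: "dy S py (x, t) = \<gamma>" if t: "0 < t" "t < \<eta> x" for t
  proof -
    have "(x, t) \<in> S"
      using t by auto
    moreover have "((\<lambda>s. px (s, t)) has_real_derivative 0) (at x)"
    proof -
      obtain e where e: "0 < e" "\<And>s t'. \<bar>s - x\<bar> < e \<Longrightarrow> \<bar>t' - t\<bar> < e \<Longrightarrow> (s, t') \<in> fluid \<eta>"
        using fluid_box[OF eta_cont, of x t] t by auto
      have "\<forall>\<^sub>F s in nhds x. \<bar>s - x\<bar> < e"
        by (auto simp: eventually_nhds_metric dist_real_def intro!: exI[of _ e] e(1))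
      then have "\<forall>\<^sub>F s in nhds x. px (s, t) = 0"
        by eventually_elim (rule px0[OF fluid_imp_closed_fluid[OF e(2)]], use e(1) in auto)
      then show ?thesis
        by (subst DERIV_cong_ev[OF refl _ refl]) auto
    qed
    then have "dx S px (x, t) = 0"
      using DERIV_unique[OF dx_int[OF diff(2)]] t by auto
    ultimately show ?thesis
      using laplace[of "(x, t)"] by simp
  qed
  have cont: "continuous_on {0..\<eta> x} (\<lambda>t. f (x, t))" if "f differentiable_on S" for f :: "real \<times> real \<Rightarrow> real"
    by (rule continuous_on_compose2[OF differentiable_imp_continuous_on[OF that]]) (auto intro!: continuous_intros)
  have shear: "py (x, t) - \<gamma> * t = py (x, 0)" if t: "0 \<le> t" "t \<le> \<eta> x" for t
  proof -
    have "py (x, t) - \<gamma> * t = py (x, 0) - \<gamma> * 0"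
    proof (rule DERIV_isconst2[OF eta_pos, where f = "\<lambda>t. py (x, t) - \<gamma> * t"])
      show "continuous_on {0..\<eta> x} (\<lambda>t. py (x, t) - \<gamma> * t)"
        by (intro continuous_intros cont diff)
      show "((\<lambda>t. py (x, t) - \<gamma> * t) has_real_derivative 0) (at y)" if "0 < y" "y < \<eta> x" for y
        using dy_int[OF diff(3), of x y] pyy[OF that] that by (auto intro!: derivative_eq_intros)
    qed (use t in auto)
    then show ?thesis
      by simp
  qed
  have "\<psi> (x, 0) - \<gamma> * 0\<^sup>2 / 2 < \<psi> (x, \<eta> x) - \<gamma> * (\<eta> x)\<^sup>2 / 2"
  proof (rule DERIV_pos_imp_increasing_open[OF eta_pos, where f = "\<lambda>t. \<psi> (x, t) - \<gamma> * t\<^sup>2 / 2"])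
    show "continuous_on {0..\<eta> x} (\<lambda>t. \<psi> (x, t) - \<gamma> * t\<^sup>2 / 2)"
      by (intro continuous_intros cont diff) auto
    fix t assume t: "0 < t" "t < \<eta> x"
    then have "((\<lambda>t. \<psi> (x, t) - \<gamma> * t\<^sup>2 / 2) has_real_derivative py (x, t) - \<gamma> * t) (at t)"
      by (auto intro!: derivative_eq_intros dy_int diff)
    then show "\<exists>D. ((\<lambda>t. \<psi> (x, t) - \<gamma> * t\<^sup>2 / 2) has_real_derivative D) (at t) \<and> 0 < D"
      using shear[of t] t py_pos[OF bed_in, of x] by auto
  qed
  then show ?thesis
    by (simp add: psi_top psi_bed)
qed

end

section \<open>Boundedness of Stokes and solitary waves, and the background at infinity\<close>

lemma periodic_int_shift:
  fixes f :: "real \<Rightarrow> 'a"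
  assumes "\<And>x. f (x + p) = f x"
  shows "f (x + of_int n * p) = f x"
proof (induction n rule: int_induct[where k = 0])
  case (step1 i)
  then show ?case
    using assms[of "x + of_int i * p"] by (simp add: algebra_simps)
next
  case (step2 i)
  then show ?case
    using assms[of "x + of_int (i - 1) * p"] by (simp add: algebra_simps)
qed simp

lemma periodic_representative:
  fixes f :: "real \<Rightarrow> 'a"
  assumes "0 < p" "\<And>x. f (x + p) = f x"
  obtains x' where "0 \<le> x'" "x' \<le> p" "f x = f x'"
proof
  define n where "n = \<lfloor>x / p\<rfloor>"
  show "0 \<le> x - of_int n * p" "x - of_int n * p \<le> p"
    using floor_divide_lower[OF assms(1), of x] floor_divide_upper[OF assms(1), of x]
    by (auto simp: n_def algebra_simps)
  show "f x = f (x - of_int n * p)"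
    using periodic_int_shift[of f p "x - of_int n * p" n] assms(2) by simp
qed

lemma continuous_on_fluid_rectangle_bounded:
  fixes g :: "real \<times> real \<Rightarrow> real"
  assumes \<eta>: "continuous_on UNIV \<eta>" "\<And>x. \<eta> x \<le> H" and g: "continuous_on (closed_fluid \<eta>) g"
  obtains B where "\<And>x y. c \<le> x \<Longrightarrow> x \<le> d \<Longrightarrow> (x, y) \<in> closed_fluid \<eta> \<Longrightarrow> \<bar>g (x, y)\<bar> \<le> B"
proof -
  define K where "K = ({c..d} \<times> {0..H}) \<inter> closed_fluid \<eta>"
  have "compact K"
    unfolding K_def by (intro compact_Int_closed compact_Times closed_closed_fluid \<eta>) auto
  moreover have "continuous_on K g"
    using g by (rule continuous_on_subset) (auto simp: K_def)
  ultimately have "bounded (g ` K)"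
    by (intro compact_imp_bounded compact_continuous_image)
  then obtain B where "\<And>z. z \<in> K \<Longrightarrow> \<bar>g z\<bar> \<le> B"
    by (auto simp: bounded_iff)
  moreover have "(x, y) \<in> K" if "c \<le> x" "x \<le> d" "(x, y) \<in> closed_fluid \<eta>" for x y
    using that \<eta>(2)[of x] by (auto simp: K_def)
  ultimately show thesis
    using that by blast
qed

lemma periodic_fluid_bounded:
  fixes g :: "real \<times> real \<Rightarrow> real"
  assumes \<eta>: "continuous_on UNIV \<eta>" "\<And>x. \<eta> x \<le> H" and g: "continuous_on (closed_fluid \<eta>) g"
    and p: "0 < p" "\<And>x. \<eta> (x + p) = \<eta> x" "\<And>x y. (x, y) \<in> closed_fluid \<eta> \<Longrightarrow> g (x + p, y) = g (x, y)"
  shows "\<exists>B. \<forall>z\<in>closed_fluid \<eta>. \<bar>g z\<bar> \<le> B"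
proof -
  obtain B where B: "\<And>x y. 0 \<le> x \<Longrightarrow> x \<le> p \<Longrightarrow> (x, y) \<in> closed_fluid \<eta> \<Longrightarrow> \<bar>g (x, y)\<bar> \<le> B"
    using continuous_on_fluid_rectangle_bounded[OF \<eta> g] by blast
  have "\<bar>g (x, y)\<bar> \<le> B" if xy: "(x, y) \<in> closed_fluid \<eta>" for x y
  proof -
    \<comment> \<open>The option type lets one periodicity argument transfer both membership in the
      fluid and the value of \<open>g\<close>.\<close>
    define f where "f x = (if (x, y) \<in> closed_fluid \<eta> then Some (g (x, y)) else None)" for x
    have "f (x + p) = f x" for x
      using p(2)[of x] p(3)[of x y] by (auto simp: f_def)
    then obtain x' where x': "0 \<le> x'" "x' \<le> p" "f x = f x'"
      using periodic_representative[OF p(1)] by metis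
    then have "(x', y) \<in> closed_fluid \<eta>" "g (x, y) = g (x', y)"
      using xy by (auto simp: f_def split: if_splits)
    then show ?thesis
      using B[OF x'(1,2)] by simp
  qed
  then show ?thesis
    by (intro exI[of _ B]) auto
qed

context unidirectional_flow
begin

lemma periodic_velocity:
  assumes p: "wave_period p \<eta> \<psi>" and z: "(x, y) \<in> S"
  shows "px (x + p, y) = px (x, y)" "py (x + p, y) = py (x, y)"
proof -
  have \<eta>p: "\<eta> (x + p) = \<eta> x" for x
    using p by (simp add: wave_period_def)
  have \<psi>p: "\<psi> (x + p, y) = \<psi> (x, y)" if "(x, y) \<in> S" for x y
    using p that by (auto simp: wave_period_def)
  have shift: "continuous_on S (\<lambda>z. f (fst z + p, snd z))" if "f differentiable_on S" for f :: "real \<times> real \<Rightarrow> real"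
    by (rule continuous_on_compose2[OF differentiable_imp_continuous_on[OF that]])
      (auto intro!: continuous_intros simp: closed_fluid_def \<eta>p)
  have "px (fst z + p, snd z) = px z \<and> py (fst z + p, snd z) = py z" if z: "z \<in> fluid \<eta>" for z
  proof -
    obtain x y where xy: "z = (x, y)" "(x, y) \<in> fluid \<eta>" "(x + p, y) \<in> fluid \<eta>"
      using z by (cases z) (auto simp: \<eta>p)
    obtain e where e: "0 < e" "\<And>s t. \<bar>s - x\<bar> < e \<Longrightarrow> \<bar>t - y\<bar> < e \<Longrightarrow> (s, t) \<in> fluid \<eta>"
      using fluid_box[OF eta_cont xy(2)] by metis
    have near: "\<forall>\<^sub>F s in nhds x. \<bar>s - x\<bar> < e" "\<forall>\<^sub>F t in nhds y. \<bar>t - y\<bar> < e"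
      by (auto simp: eventually_nhds_metric dist_real_def intro!: exI[of _ e] e(1))
    have "\<forall>\<^sub>F s in nhds x. \<psi> (s + p, y) = \<psi> (s, y)"
      using near(1) by eventually_elim (rule \<psi>p[OF fluid_imp_closed_fluid[OF e(2)]], use e(1) in auto)
    moreover have "((\<lambda>s. \<psi> (s + p, y)) has_real_derivative px (x + p, y)) (at x)"
      using dx_int[OF diff(1) xy(3)] by (simp add: DERIV_shift)
    ultimately have "((\<lambda>s. \<psi> (s, y)) has_real_derivative px (x + p, y)) (at x)"
      by (subst (asm) DERIV_cong_ev[OF refl _ refl]) auto
    then have "px (x + p, y) = px (x, y)"
      using dx_int[OF diff(1) xy(2)] by (rule DERIV_unique)
    moreover have "\<forall>\<^sub>F t in nhds y. \<psi> (x + p, t) = \<psi> (x, t)"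
      using near(2) by eventually_elim (rule \<psi>p[OF fluid_imp_closed_fluid[OF e(2)]], use e(1) in auto)
    then have "((\<lambda>t. \<psi> (x, t)) has_real_derivative py (x + p, y)) (at y)"
      using dy_int[OF diff(1) xy(3)] by (subst (asm) DERIV_cong_ev[OF refl _ refl]) auto
    then have "py (x + p, y) = py (x, y)"
      using dy_int[OF diff(1) xy(2)] by (rule DERIV_unique)
    ultimately show ?thesis
      by (simp add: xy(1))
  qed
  then show "px (x + p, y) = px (x, y)" "py (x + p, y) = py (x, y)"
    using closed_fluid_eqI[OF eta_pos eta_cont shift[OF diff(2)] differentiable_imp_continuous_on[OF diff(2)] _ z]
      closed_fluid_eqI[OF eta_pos eta_cont shift[OF diff(3)] differentiable_imp_continuous_on[OF diff(3)] _ z]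
    by simp_all
qed

end

lemma stokes_wave_is_wave:
  assumes st: "stokes_wave \<gamma> \<eta> \<psi> r" and "unidirectional \<eta> \<psi>" "0 < \<gamma>" and H: "\<And>x. \<eta> x \<le> H"
  shows "wave \<gamma> \<eta> \<psi> r" "\<exists>x. \<forall>x'. \<eta> x \<le> \<eta> x'"
proof -
  interpret unidirectional_flow \<gamma> \<eta> \<psi> r
    using assms by unfold_locales (auto simp: stokes_wave_def)
  obtain p where p: "wave_period p \<eta> \<psi>"
    using st by (auto simp: stokes_wave_def)
  then have p0: "0 < p" "\<And>x. \<eta> (x + p) = \<eta> x"
    by (auto simp: wave_period_def)
  obtain B1 where B1: "\<forall>z\<in>S. \<bar>px z\<bar> \<le> B1"
    using periodic_fluid_bounded[OF eta_cont H _ p0 periodic_velocity(1)[OF p]] diff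
    by (auto intro: differentiable_imp_continuous_on)
  obtain B2 where B2: "\<forall>z\<in>S. \<bar>py z\<bar> \<le> B2"
    using periodic_fluid_bounded[OF eta_cont H _ p0 periodic_velocity(2)[OF p]] diff
    by (auto intro: differentiable_imp_continuous_on)
  have "\<forall>z\<in>S. \<bar>px z\<bar> \<le> max B1 B2 \<and> \<bar>py z\<bar> \<le> max B1 B2"
    using B1 B2 by (auto simp: le_max_iff_disj)
  then show "wave \<gamma> \<eta> \<psi> r"
    using H by unfold_locales blast+
  have "\<exists>x\<in>{0..p}. \<forall>x'\<in>{0..p}. \<eta> x \<le> \<eta> x'"
    by (rule continuous_attains_inf) (use p0(1) eta_cont in auto)
  then obtain x where x: "\<And>x'. 0 \<le> x' \<Longrightarrow> x' \<le> p \<Longrightarrow> \<eta> x \<le> \<eta> x'"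
    by (metis atLeastAtMost_iff)
  have "\<eta> x \<le> \<eta> x'" for x'
    using periodic_representative[of p \<eta> x'] p0 x by metis
  then show "\<exists>x. \<forall>x'. \<eta> x \<le> \<eta> x'"
    by blast
qed

text \<open>The surface value of \<open>dy\<close> is a choice of \<open>frechet_derivative\<close>;
  the one-sided derivative along a vertical segment is unique and identifies it with
  \<open>\<gamma> * d + s\<close>.\<close>

lemma laminar_shear_relations:
  assumes lam: "laminar \<gamma> (\<lambda>_. d) (\<lambda>(x, y). \<gamma> * y\<^sup>2 / 2 + s * y) r"
  shows "0 < d" "\<gamma> * d\<^sup>2 / 2 + s * d = 1" "(\<gamma> * d + s)\<^sup>2 / 2 + d = r"
proof -
  let ?S = "closed_fluid (\<lambda>_. d)" and ?\<psi> = "\<lambda>(x, y). \<gamma> * y\<^sup>2 / 2 + s * y :: real"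
  have sol: "solution \<gamma> (\<lambda>_. d) ?\<psi> r"
    using lam by (simp add: laminar_def)
  show d: "0 < d" and "\<gamma> * d\<^sup>2 / 2 + s * d = 1"
    using sol by (auto simp: solution_def Let_def)
  have in_S: "(0, d) \<in> ?S"
    using d by simp
  have "Ck_on 1 ?S ?\<psi>"
    using sol by (auto simp: solution_def Let_def smooth_on_closed_def)
  then have "?\<psi> differentiable_on ?S"
    by simp
  from dy_vertical[OF this in_S]
  have "((\<lambda>t. \<gamma> * t\<^sup>2 / 2 + s * t) has_real_derivative dy ?S ?\<psi> (0, d)) (at d within {0..d})"
    by simp
  moreover have "((\<lambda>t. \<gamma> * t\<^sup>2 / 2 + s * t) has_real_derivative \<gamma> * d + s) (at d within {0..d})"
    by (auto intro!: derivative_eq_intros)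
  moreover have "at d within {0..d} \<noteq> bot"
    using d by (simp add: at_within_Icc_at_left)
  ultimately have "dy ?S ?\<psi> (0, d) = \<gamma> * d + s"
    using has_field_derivative_unique by blast
  moreover have "dx ?S ?\<psi> (0, d) = 0"
    using lam in_S unfolding laminar_def vel_v_def by auto
  moreover have "((dx ?S ?\<psi> (0, d))\<^sup>2 + (dy ?S ?\<psi> (0, d))\<^sup>2) / 2 + d = r"
    using sol unfolding solution_def Let_def by blast
  ultimately show "(\<gamma> * d + s)\<^sup>2 / 2 + d = r"
    by simp
qed

lemma solitary_wave_is_wave:
  assumes so: "solitary_wave \<gamma> \<eta> \<psi> r" and uni: "unidirectional \<eta> \<psi>" and \<gamma>: "0 < \<gamma>" and H: "\<And>x. \<eta> x \<le> H"
  shows "wave \<gamma> \<eta> \<psi> r"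
    and "\<exists>d. 0 < d \<and> \<gamma> * d\<^sup>2 / 2 \<le> 1 \<and> (\<gamma> * d / 2 + 1 / d)\<^sup>2 / 2 + d = r \<and> (\<eta> \<longlongrightarrow> d) at_infinity"
proof -
  interpret unidirectional_flow \<gamma> \<eta> \<psi> r
    using assms by unfold_locales (auto simp: solitary_wave_def)
  obtain d s where lam: "laminar \<gamma> (\<lambda>_. d) (\<lambda>(x, y). \<gamma> * y\<^sup>2 / 2 + s * y) r"
    and lim: "(\<eta> \<longlongrightarrow> d) at_infinity"
    and vel: "\<And>\<epsilon>. 0 < \<epsilon> \<Longrightarrow> \<forall>\<^sub>F x in at_infinity. \<forall>y\<in>{0..\<eta> x}.
           \<bar>vel_u \<eta> \<psi> (x, y) - (\<gamma> * y + s)\<bar> < \<epsilon> \<and> \<bar>vel_v \<eta> \<psi> (x, y)\<bar> < \<epsilon>"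
    using so unfolding solitary_wave_def by blast
  note rel = laminar_shear_relations[OF lam]
  \<comment> \<open>A negative \<open>s\<close> would give negative bed velocities far out. Only the
    weak inequality survives the limit, so the background depth is at most \<open>a\<close>.\<close>
  have s: "0 \<le> s"
  proof (rule ccontr)
    assume "\<not> 0 \<le> s"
    then have "\<forall>\<^sub>F x in at_infinity. \<forall>y\<in>{0..\<eta> x}. \<bar>py (x, y) - (\<gamma> * y + s)\<bar> < - s"
      using vel[of "- s"] by (auto elim!: eventually_mono simp: vel_u_def)
    then obtain b where b: "\<And>x y. b \<le> \<bar>x\<bar> \<Longrightarrow> y \<in> {0..\<eta> x} \<Longrightarrow> \<bar>py (x, y) - (\<gamma> * y + s)\<bar> < - s"
      unfolding eventually_at_infinity real_norm_def by blast
    have "\<bar>py (\<bar>b\<bar>, 0) - (\<gamma> * 0 + s)\<bar> < - s"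
      using eta_pos[of "\<bar>b\<bar>"] by (intro b) auto
    then show False
      using py_pos[OF bed_in, of "\<bar>b\<bar>"] by simp
  qed
  have "s = 1 / d - \<gamma> * d / 2"
    using rel(1,2) by (simp add: field_simps power2_eq_square)
  then have "\<gamma> * d + s = \<gamma> * d / 2 + 1 / d"
    by simp
  then have "(\<gamma> * d / 2 + 1 / d)\<^sup>2 / 2 + d = r"
    using rel(3) by simp
  moreover have "\<gamma> * d\<^sup>2 / 2 \<le> 1"
    using rel(1,2) s by (smt (verit) mult_nonneg_nonneg)
  ultimately show "\<exists>d. 0 < d \<and> \<gamma> * d\<^sup>2 / 2 \<le> 1 \<and> (\<gamma> * d / 2 + 1 / d)\<^sup>2 / 2 + d = r \<and> (\<eta> \<longlongrightarrow> d) at_infinity"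
    using rel(1) lim by blast
  have "\<forall>\<^sub>F x in at_infinity. \<forall>y\<in>{0..\<eta> x}. \<bar>py (x, y) - (\<gamma> * y + s)\<bar> < 1 \<and> \<bar>px (x, y)\<bar> < 1"
    using vel[of 1] by (auto elim!: eventually_mono simp: vel_u_def vel_v_def)
  then obtain b where b: "\<And>x y. b \<le> \<bar>x\<bar> \<Longrightarrow> y \<in> {0..\<eta> x} \<Longrightarrow> \<bar>py (x, y) - (\<gamma> * y + s)\<bar> < 1 \<and> \<bar>px (x, y)\<bar> < 1"
    unfolding eventually_at_infinity real_norm_def by blast
  obtain B1 where B1: "\<And>x y. - b \<le> x \<Longrightarrow> x \<le> b \<Longrightarrow> (x, y) \<in> S \<Longrightarrow> \<bar>px (x, y)\<bar> \<le> B1"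
    using continuous_on_fluid_rectangle_bounded[OF eta_cont H differentiable_imp_continuous_on[OF diff(2)], of "- b" b] by blast
  obtain B2 where B2: "\<And>x y. - b \<le> x \<Longrightarrow> x \<le> b \<Longrightarrow> (x, y) \<in> S \<Longrightarrow> \<bar>py (x, y)\<bar> \<le> B2"
    using continuous_on_fluid_rectangle_bounded[OF eta_cont H differentiable_imp_continuous_on[OF diff(3)], of "- b" b] by blast
  define B where "B = \<bar>B1\<bar> + \<bar>B2\<bar> + 1 + \<gamma> * \<bar>H\<bar> + s"
  have H0: "0 \<le> \<gamma> * \<bar>H\<bar>"
    using \<gamma> by simp
  have "\<bar>px (x, y)\<bar> \<le> B \<and> \<bar>py (x, y)\<bar> \<le> B" if xy: "(x, y) \<in> S" for x y
  proof (cases "\<bar>x\<bar> \<le> b")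
    case True
    then have "- b \<le> x" "x \<le> b"
      by auto
    then show ?thesis
      using B1[OF _ _ xy] B2[OF _ _ xy] H0 s by (auto simp: B_def)
  next
    case False
    have "\<gamma> * y \<le> \<gamma> * \<bar>H\<bar>" "0 \<le> \<gamma> * y"
      using xy H[of x] \<gamma> by auto
    then show ?thesis
      using b[of x y] False xy s by (auto simp: B_def)
  qed
  then have "\<forall>z\<in>S. \<bar>px z\<bar> \<le> B \<and> \<bar>py z\<bar> \<le> B"
    by auto
  then show "wave \<gamma> \<eta> \<psi> r"
    using H by unfold_locales blast+
qed

text \<open>A solitary wave need not attain its infimum, but it does once it dips below the depth at
  infinity, and then there is a lowest trough for the comparison.\<close>

lemma attains_min_of_tendsto:
  fixes f :: "real \<Rightarrow> real"
  assumes cont: "continuous_on UNIV f" and lim: "(f \<longlongrightarrow> d) at_infinity" and x0: "f x0 < d"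
  obtains x where "\<And>x'. f x \<le> f x'" "f x < d"
proof -
  have "\<forall>\<^sub>F x in at_infinity. f x0 < f x"
    using lim x0 by (rule order_tendstoD)
  then obtain b where b: "\<And>x. b \<le> \<bar>x\<bar> \<Longrightarrow> f x0 < f x"
    by (auto simp: eventually_at_infinity)
  define c where "c = max b \<bar>x0\<bar>"
  have "compact {- c..c}" "x0 \<in> {- c..c}"
    by (auto simp: c_def)
  then obtain x where x: "\<And>x'. x' \<in> {- c..c} \<Longrightarrow> f x \<le> f x'"
    using continuous_attains_inf[of "{- c..c}" f] continuous_on_subset[OF cont] by blast
  have "f x \<le> f x0"
    using \<open>x0 \<in> {- c..c}\<close> by (rule x)
  have "f x \<le> f x'" for x'
  proof (cases "\<bar>x'\<bar> \<le> c")
    case True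
    then show ?thesis
      by (intro x) auto
  next
    case False
    then have "f x0 < f x'"
      by (intro b) (auto simp: c_def)
    then show ?thesis
      using \<open>f x \<le> f x0\<close> by linarith
  qed
  moreover have "f x < d"
    using \<open>f x \<le> f x0\<close> x0 by linarith
  ultimately show thesis
    by (rule that)
qed

section \<open>Waves with large vorticity\<close>

text \<open>Common ground of both wave types: \<open>r_ge\<close> comes from a trough for Stokes
  waves and from the background for solitary waves.\<close>

locale crest_wave = wave +
  fixes a :: real
  assumes crest_0: "\<eta> x \<le> \<eta> 0" and a: "0 < a" "a \<le> 1 / 10" and \<gamma>_eq: "\<gamma> = 2 / a\<^sup>2"
    and r_ge: "2 / a\<^sup>2 + a - a ^ 4 / 8 \<le> r"
begin

lemma shear_velocity_\<gamma>: "\<gamma> * h / 2 + 1 / h = shear_velocity a h"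
  by (simp add: \<gamma>_eq shear_velocity_def)

lemma crest_speed:
  assumes "crest \<eta> x"
  shows "(py (x, \<eta> x))\<^sup>2 = 2 * (r - \<eta> x)"
proof -
  obtain e where e: "0 < e" "\<And>y. dist y x < e \<Longrightarrow> \<eta> y \<le> \<eta> x"
    using assms by (auto simp: crest_def eventually_nhds_metric)
  have "\<eta>' x = 0"
    by (rule DERIV_local_max[OF eta_deriv e(1)]) (use e(2) in \<open>auto simp: dist_real_def\<close>)
  then show ?thesis
    using bernoulli_slope[of x] by simp
qed

lemma speed_0: "(py (0, \<eta> 0))\<^sup>2 = 2 * (r - \<eta> 0)"
  by (rule crest_speed) (simp add: crest_def crest_0)

lemma crest_not_at_barrier: "\<eta> 0 \<noteq> a + a ^ 7"
proof
  assume h: "\<eta> 0 = a + a ^ 7"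
  define u where "u = py (0, \<eta> 0)"
  have u: "0 < u" "u\<^sup>2 = 2 * (r - \<eta> 0)"
    using py_pos[OF top_in] speed_0 by (auto simp: u_def)
  have u_ge: "2 / a - a ^ 5 / 4 \<le> u"
    using crest_velocity_lower_bound[OF a _ r_ge u] h by simp
  note ineq = barrier_inequalities[OF a h u_ge]
  have "(\<gamma> * \<eta> 0 / 2 - 1 / \<eta> 0) / 4 \<le> \<gamma> * \<eta> 0 / 2 + 1 / \<eta> 0 - u"
    unfolding u_def by (rule crest_velocity_gap[OF crest_0]) (use ineq in \<open>simp_all add: \<gamma>_eq u_def\<close>)
  then show False
    using ineq(3) unfolding shear_velocity_\<gamma> by (simp add: \<gamma>_eq)
qed

lemma bernoulli_le_shear_energy: "r \<le> shear_energy a (\<eta> 0)"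
proof -
  have "py (0, \<eta> 0) \<le> shear_velocity a (\<eta> 0)"
    using crest_velocity_le[OF crest_0] by (simp add: shear_velocity_\<gamma>)
  then have "(py (0, \<eta> 0))\<^sup>2 \<le> (shear_velocity a (\<eta> 0))\<^sup>2"
    using py_pos[OF top_in, of 0] by (intro power_mono) auto
  then show ?thesis
    using speed_0 by (simp add: shear_energy_def)
qed

lemma trough_shear_energy_le: "(\<And>x'. \<eta> x \<le> \<eta> x') \<Longrightarrow> shear_energy a (\<eta> x) \<le> r"
  using trough_bernoulli_ge[of x] by (simp add: shear_energy_def shear_velocity_\<gamma>)

lemma crest_velocity_ge:
  assumes h: "\<eta> 0 \<le> a + a ^ 7" and x: "crest \<eta> x"
  shows "2 / a - a ^ 5 / 4 \<le> py (x, \<eta> x)"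
proof (rule crest_velocity_lower_bound[OF a _ r_ge _ crest_speed[OF x]])
  show "\<eta> x \<le> a + a ^ 7"
    using h crest_0[of x] by simp
qed (rule py_pos[OF top_in])

lemma small_powers: "a ^ 7 \<le> a ^ 4"
  using a by (intro power_decreasing) auto

text \<open>Since \<open>\<gamma> / 2 = 1 / a\<^sup>2\<close>, the main terms
  \<open>2 / a - (a - m) / a\<^sup>2\<close> equal \<open>1 / a + m / a\<^sup>2\<close>, and
  \<open>m \<le> a + a ^ 7\<close> turns \<open>1 / a\<close> into another
  \<open>m / a\<^sup>2\<close>, which together make \<open>\<gamma> * m\<close>. All errors are of
  order \<open>a ^ 5\<close>.\<close>

lemma velocity_ge:
  assumes h: "\<eta> 0 \<le> a + a ^ 7" and m: "m \<le> \<eta> x" "a - 2 * a ^ 4 \<le> m"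
  shows "\<gamma> * m - 6 * a ^ 5 \<le> py (x, \<eta> x)"
proof -
  define u where "u = py (0, \<eta> 0)"
  have u: "0 < u" "u\<^sup>2 = 2 * (r - \<eta> 0)"
    using py_pos[OF top_in] speed_0 by (auto simp: u_def)
  have u_ge: "2 / a - a ^ 5 / 4 \<le> u"
    by (rule crest_velocity_lower_bound[OF a h r_ge u])
  have a5: "a ^ 5 \<le> 1"
    using a by (intro power_le_one) auto
  have "10 \<le> 1 / a"
    using a by (simp add: field_simps)
  then have "1 / a \<le> u"
    using u_ge a5 by simp
  then have inv: "1 / u \<le> a"
    using a u by (simp add: field_simps)
  have d: "\<eta> 0 - \<eta> x \<le> a + a ^ 7 - m" "0 \<le> \<eta> 0 - \<eta> x" "a + a ^ 7 - m \<le> 3 * a ^ 4"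
    using h m crest_0[of x] small_powers by auto
  have "(1 / a\<^sup>2) * (\<eta> 0 - \<eta> x) \<le> (1 / a\<^sup>2) * (a + a ^ 7 - m)"
    using d by (intro mult_left_mono) auto
  moreover have "(1 / u) * (\<eta> 0 - \<eta> x) \<le> a * (3 * a ^ 4)"
    using d inv u a by (intro mult_mono) auto
  moreover have "(1 / a\<^sup>2) * (a + a ^ 7 - m) = 1 / a + a ^ 5 - m / a\<^sup>2"
    using a by (simp add: field_simps eval_nat_numeral)
  moreover have "a * (3 * a ^ 4) = 3 * a ^ 5"
    by (simp add: eval_nat_numeral)
  ultimately have "(1 / a\<^sup>2 + 1 / u) * (\<eta> 0 - \<eta> x) \<le> 1 / a + a ^ 5 - m / a\<^sup>2 + 3 * a ^ 5"
    by (simp only: distrib_right)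
  moreover have "u - (1 / a\<^sup>2 + 1 / u) * (\<eta> 0 - \<eta> x) \<le> py (x, \<eta> x)"
    using surface_velocity_ge[OF u(1) _ crest_0, of x] u crest_0 by (simp add: \<gamma>_eq)
  moreover have "m / a\<^sup>2 \<le> 1 / a + a ^ 5"
  proof -
    have "m / a\<^sup>2 \<le> (a + a ^ 7) / a\<^sup>2"
      using h m crest_0[of x] by (intro divide_right_mono) auto
    also have "\<dots> = 1 / a + a ^ 5"
      using a by (simp add: field_simps eval_nat_numeral)
    finally show ?thesis .
  qed
  moreover have "2 / a = 1 / a + 1 / a" "\<gamma> * m = m / a\<^sup>2 + m / a\<^sup>2" "0 \<le> a ^ 5"
    using a by (auto simp: \<gamma>_eq)
  ultimately show ?thesis
    using u_ge by linarith
qed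

text \<open>The bound \<open>r\<close> is the extra assumption on Stokes waves; it takes the place
  of the energy of a background near depth \<open>a\<close>.\<close>

lemma stokes_depth_ge:
  assumes trough: "\<And>x'. \<eta> x0 \<le> \<eta> x'" and r: "r \<le> 2 / a\<^sup>2 + a"
  shows "a - 2 * a ^ 4 \<le> \<eta> x"
proof -
  have "shear_energy a (\<eta> x0) \<le> 2 / a\<^sup>2 + a + 5 * a ^ 4"
    using trough_shear_energy_le[OF trough] r a by (simp add: add_increasing2)
  then show ?thesis
    using depth_ge_of_shear_energy_le[OF a(1) eta_pos] trough[of x] by fastforce
qed

text \<open>A background of depth \<open>d < a - a\<^sup>4\<close> is impossible: the troughs would not lie below \<open>d\<close>, so the
  crest would lie above \<open>d\<close>, where the energy of the shear flow is too small for it.\<close>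

lemma solitary_depth_ge:
  assumes d: "0 < d" "d \<le> a" "shear_energy a d = r" and lim: "(\<eta> \<longlongrightarrow> d) at_infinity"
    and h: "\<eta> 0 \<le> a + a ^ 7" and not_laminar: "\<not> laminar \<gamma> \<eta> \<psi> r"
  shows "a - 2 * a ^ 4 \<le> \<eta> x"
proof -
  have a3: "0 < a ^ 3" "a ^ 3 \<le> 1 / 1000"
    using a power_mono[of a "1 / 10" 3] by (auto simp: power3_eq_cube)
  have a4: "0 < a ^ 4" "a ^ 4 = a * a ^ 3"
    using a by (auto simp: eval_nat_numeral)
  define b where "b = a ^ 3"
  have b: "0 < b" "b \<le> 1 / 1000"
    using a3 by (auto simp: b_def)
  have ab: "a - a ^ 4 = a * (1 - b)" "a + a ^ 7 = a * (1 + b\<^sup>2)"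
    by (auto simp: b_def algebra_simps eval_nat_numeral)
  have "a - a ^ 4 \<le> d"
  proof (rule ccontr)
    assume less: "\<not> a - a ^ 4 \<le> d"
    have b2: "0 \<le> b\<^sup>2" "b\<^sup>2 \<le> b / 1000"
      using b mult_left_mono[of b "1 / 1000" b] by (auto simp: power2_eq_square)
    \<comment> \<open>The upper depth may go up to the barrier: with \<open>b = a ^ 3\<close> the
      product criterion holds because
      \<open>(1 + b\<^sup>2) * (1 + b / 2) \<le> 1 + b\<close>.\<close>
    have decr: "shear_energy a y < shear_energy a x"
      if "0 < x" "x < y" "x \<le> a * (1 - b)" "y \<le> a * (1 + b\<^sup>2)" for x y
    proof (rule shear_energy_strict_decreasing[OF a(1) that(1,2)])
      have "x * y \<le> (a * (1 - b)) * (a * (1 + b\<^sup>2))"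
        using that a b by (intro mult_mono) auto
      then have "x * y * (1 + a ^ 3 / 2) \<le> (a * (1 - b)) * (a * (1 + b\<^sup>2)) * (1 + a ^ 3 / 2)"
        using a3 by (intro mult_right_mono) auto
      also have "\<dots> = a\<^sup>2 * ((1 - b) * (1 + b\<^sup>2) * (1 + b / 2))"
        by (simp add: b_def power2_eq_square mult_ac)
      also have "\<dots> < a\<^sup>2 * 1"
      proof (rule mult_strict_left_mono)
        have "(1 + b\<^sup>2) * (1 + b / 2) = 1 + b / 2 + b\<^sup>2 + b\<^sup>2 * (b / 2)"
          by (simp add: algebra_simps)
        also have "\<dots> \<le> 1 + b"
        proof -
          have "b\<^sup>2 * (b / 2) \<le> b\<^sup>2 * 1"
            using b by (intro mult_left_mono) auto
          then show ?thesis
            using b b2 by linarith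
        qed
        finally have "(1 - b) * ((1 + b\<^sup>2) * (1 + b / 2)) \<le> (1 - b) * (1 + b)"
          using b by (intro mult_left_mono) auto
        also have "\<dots> < 1"
          using b by (simp add: algebra_simps)
        finally show "(1 - b) * (1 + b\<^sup>2) * (1 + b / 2) < 1"
          by (simp add: mult.assoc)
      qed (use a in simp)
      finally show "x * y * (1 + a ^ 3 / 2) < a\<^sup>2"
        by simp
    qed
    have d_small: "d \<le> a * (1 - b)"
      using less ab(1) by simp
    have "1 - b \<le> 1 + b\<^sup>2"
      using b b2 by linarith
    then have "a * (1 - b) \<le> a * (1 + b\<^sup>2)"
      using a by (intro mult_left_mono) auto
    then have d_small': "d \<le> a * (1 + b\<^sup>2)"
      using d_small by simp
    \<comment> \<open>A lowest trough below \<open>d\<close> would have shear energy at most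
      \<open>r\<close>, but depths smaller than \<open>d\<close> have more energy than
      \<open>d\<close> itself.\<close>
    have above: "d \<le> \<eta> y" for y
    proof (rule ccontr)
      assume "\<not> d \<le> \<eta> y"
      then obtain x where x: "\<And>x'. \<eta> x \<le> \<eta> x'" "\<eta> x < d"
        using attains_min_of_tendsto[OF eta_cont lim, of y] by auto
      have "shear_energy a d < shear_energy a (\<eta> x)"
        using x(2) d_small d_small' eta_pos by (intro decr) auto
      then show False
        using trough_shear_energy_le[OF x(1)] d(3) by simp
    qed
    have "d < \<eta> 0"
    proof (rule ccontr)
      assume "\<not> d < \<eta> 0"
      then have "\<eta> y = d" for y
        using above[of y] crest_0[of y] by simp
      then show False
        using flat_imp_laminar not_laminar by blast
    qed
    then have "shear_energy a (\<eta> 0) < shear_energy a d"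
      using d(1) d_small h ab(2) by (intro decr) auto
    then show False
      using bernoulli_le_shear_energy d(3) by simp
  qed
  then have d_ge: "a - a ^ 4 \<le> d" .
  \<comment> \<open>Now the background is close to \<open>a\<close>, so \<open>r\<close> is nearly
    minimal and the trough estimate limits any dip below \<open>d\<close>.\<close>
  have r: "r \<le> 2 / a\<^sup>2 + a + 5 * a ^ 4"
    using shear_energy_le_near[OF a d_ge d(2)] d(3) by simp
  show ?thesis
  proof (rule ccontr)
    assume "\<not> a - 2 * a ^ 4 \<le> \<eta> x"
    then have less: "\<eta> x < a - 2 * a ^ 4"
      by simp
    then have "\<eta> x < d"
      using d_ge a4 by simp
    then obtain y where y: "\<And>x'. \<eta> y \<le> \<eta> x'" "\<eta> y < d"
      using attains_min_of_tendsto[OF eta_cont lim] by auto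
    have "a - 2 * a ^ 4 \<le> \<eta> y"
      using trough_shear_energy_le[OF y(1)] r by (intro depth_ge_of_shear_energy_le[OF a(1) eta_pos]) simp
    then show False
      using less y(1)[of x] by simp
  qed
qed

end

section \<open>Both wave types as crest waves, and continuity along the curve\<close>

lemma stokes_crest_wave:
  assumes st: "stokes_wave \<gamma> \<eta> \<psi> r" and uni: "unidirectional \<eta> \<psi>" and crest: "\<And>x. \<eta> x \<le> \<eta> 0"
    and a: "0 < a" "a \<le> 1 / 10" and vort: "\<gamma> = 2 / a\<^sup>2"
  shows "crest_wave \<gamma> \<eta> \<psi> r a" "r \<le> 2 / a\<^sup>2 + a \<Longrightarrow> a - 2 * a ^ 4 \<le> \<eta> x"
proof -
  have \<gamma>0: "0 < \<gamma>"
    using a vort by simp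
  interpret wave \<gamma> \<eta> \<psi> r
    by (rule stokes_wave_is_wave(1)[OF st uni \<gamma>0 crest])
  obtain x0 where x0: "\<And>x'. \<eta> x0 \<le> \<eta> x'"
    using stokes_wave_is_wave(2)[OF st uni \<gamma>0 crest] by blast
  have "shear_energy a (\<eta> x0) \<le> r"
    using trough_bernoulli_ge[OF x0] by (simp add: shear_energy_def shear_velocity_def vort)
  then interpret crest_wave \<gamma> \<eta> \<psi> r a
    using shear_energy_lower_bound[OF a(1) eta_pos[of x0]] crest a vort by unfold_locales auto
  show "crest_wave \<gamma> \<eta> \<psi> r a"
    by unfold_locales
  show "a - 2 * a ^ 4 \<le> \<eta> x" if "r \<le> 2 / a\<^sup>2 + a"
    using stokes_depth_ge[OF x0 that] .
qed

lemma solitary_crest_wave: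
  assumes so: "solitary_wave \<gamma> \<eta> \<psi> r" and uni: "unidirectional \<eta> \<psi>" and crest: "\<And>x. \<eta> x \<le> \<eta> 0"
    and a: "0 < a" "a \<le> 1 / 10" and vort: "\<gamma> = 2 / a\<^sup>2"
  shows "crest_wave \<gamma> \<eta> \<psi> r a" "\<eta> 0 \<le> a + a ^ 7 \<Longrightarrow> a - 2 * a ^ 4 \<le> \<eta> x"
proof -
  have \<gamma>0: "0 < \<gamma>"
    using a vort by simp
  interpret wave \<gamma> \<eta> \<psi> r
    by (rule solitary_wave_is_wave(1)[OF so uni \<gamma>0 crest])
  obtain d where d: "0 < d" "\<gamma> * d\<^sup>2 / 2 \<le> 1" "(\<gamma> * d / 2 + 1 / d)\<^sup>2 / 2 + d = r" "(\<eta> \<longlongrightarrow> d) at_infinity"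
    using solitary_wave_is_wave(2)[OF so uni \<gamma>0 crest] by blast
  have dr: "shear_energy a d = r"
    using d(3) by (simp add: shear_energy_def shear_velocity_def vort)
  have "d\<^sup>2 \<le> a\<^sup>2"
    using d(2) a by (simp add: vort divide_simps)
  then have da: "d \<le> a"
    by (rule power2_le_imp_le) (use a in simp)
  interpret crest_wave \<gamma> \<eta> \<psi> r a
    using shear_energy_lower_bound[OF a(1) d(1)] dr crest a vort by unfold_locales auto
  show "crest_wave \<gamma> \<eta> \<psi> r a"
    by unfold_locales
  show "a - 2 * a ^ 4 \<le> \<eta> x" if "\<eta> 0 \<le> a + a ^ 7"
    using solitary_depth_ge[OF d(1) da dr d(4) that] so by (auto simp: solitary_wave_def)
qed

lemma eta_max_eq:
  assumes "\<And>x. \<eta> x \<le> \<eta> 0"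
  shows "eta_max \<eta> = \<eta> 0"
  unfolding eta_max_def by (rule cSup_eq_maximum) (use assms in auto)

lemma curve_crest_less:
  assumes curve: "bifurcating_curve W \<gamma> T \<eta> \<psi> r" and t: "0 < t" "ereal t < T"
    and a: "0 < a" "\<gamma> = 2 / a\<^sup>2"
    and W: "\<And>\<eta> \<psi> r. W \<gamma> \<eta> \<psi> r \<Longrightarrow> unidirectional \<eta> \<psi> \<Longrightarrow> (\<And>x. \<eta> x \<le> \<eta> 0) \<Longrightarrow> crest_wave \<gamma> \<eta> \<psi> r a"
  shows "\<eta> t 0 < a + a ^ 7"
proof (rule ccontr)
  assume ge: "\<not> \<eta> t 0 < a + a ^ 7"
  have wv: "crest_wave \<gamma> (\<eta> s) (\<psi> s) (r s) a" "eta_max (\<eta> s) = \<eta> s 0" if "0 < s" "s \<le> t" for s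
  proof -
    have "ereal s < T"
      using that t(2) by (meson ereal_less_eq(3) le_less_trans)
    then have *: "W \<gamma> (\<eta> s) (\<psi> s) (r s)" "unidirectional (\<eta> s) (\<psi> s)" "\<And>x. \<eta> s x \<le> \<eta> s 0"
      using curve that by (auto simp: bifurcating_curve_def)
    show "crest_wave \<gamma> (\<eta> s) (\<psi> s) (r s) a"
      by (rule W[OF *])
    show "eta_max (\<eta> s) = \<eta> s 0"
      by (rule eta_max_eq) (rule *(3))
  qed
  have lam: "laminar \<gamma> (\<eta> 0) (\<psi> 0) (r 0)" "unidirectional (\<eta> 0) (\<psi> 0)"
    using curve by (auto simp: bifurcating_curve_def)
  interpret L: unidirectional_flow \<gamma> "\<eta> 0" "\<psi> 0" "r 0"
    using lam a by unfold_locales (auto simp: laminar_def)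
  have "(\<eta> 0 0)\<^sup>2 < a\<^sup>2"
    using L.laminar_depth_less[OF lam(1), of 0] a by (simp add: divide_simps)
  then have "\<eta> 0 0 < a"
    by (rule power2_less_imp_less) (use a in simp)
  moreover have "eta_max (\<eta> 0) = \<eta> 0 0"
    using lam(1) by (intro eta_max_eq) (metis laminar_def order_refl)
  moreover have "0 < a ^ 7"
    using a by simp
  ultimately have start: "eta_max (\<eta> 0) < a + a ^ 7"
    by linarith
  have "continuous_on {0..t} (\<lambda>t. eta_max (\<eta> t))"
  proof (rule continuous_on_subset)
    show "continuous_on {t. 0 \<le> t \<and> ereal t < T} (\<lambda>t. eta_max (\<eta> t))"
      using curve by (simp add: bifurcating_curve_def Let_def)
    show "{0..t} \<subseteq> {t. 0 \<le> t \<and> ereal t < T}"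
      using t(2) by (auto intro: le_less_trans[of _ "ereal t"])
  qed
  then have "\<exists>s\<ge>0. s \<le> t \<and> eta_max (\<eta> s) = a + a ^ 7"
    using start ge wv(2)[of t] t(1) by (intro IVT') auto
  then obtain s where s: "0 \<le> s" "s \<le> t" "eta_max (\<eta> s) = a + a ^ 7"
    by blast
  \<comment> \<open>The member at parameter 0 is laminar rather than a wave of type
    \<open>W\<close>, so the barrier has to be met at a positive parameter.\<close>
  then have "0 < s"
    using start by (cases "s = 0") auto
  interpret crest_wave \<gamma> "\<eta> s" "\<psi> s" "r s" a
    by (rule wv(1)[OF \<open>0 < s\<close> s(2)])
  show False
    using crest_not_at_barrier s(3) wv(2)[OF \<open>0 < s\<close> s(2)] by simp
qed

text \<open>Here \<open>\<gamma> powr (-1/2)\<close> is \<open>a / sqrt 2\<close>. The half-integer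
  powers are bounded below through \<open>a / 2\<close>, which avoids irrational constants at the
  price of a larger \<open>C\<close>.\<close>

lemma powers_of_vorticity:
  fixes \<gamma> a :: real
  assumes "0 < a" "\<gamma> = 2 / a\<^sup>2"
  shows "\<gamma> powr (-1) = a\<^sup>2 / 2" "\<gamma> powr (-2) = a ^ 4 / 4"
    "a ^ 5 / 32 \<le> \<gamma> powr (-5/2)" "a ^ 7 / 128 \<le> \<gamma> powr (-7/2)"
proof -
  define e where "e = \<gamma> powr (-1/2)"
  have \<gamma>: "0 < \<gamma>"
    using assms by simp
  have e: "e ^ n = \<gamma> powr (- real n / 2)" for n
    using \<gamma> by (simp add: e_def powr_power)
  show 1: "\<gamma> powr (-1) = a\<^sup>2 / 2"
    using \<gamma> by (simp add: powr_minus_divide assms)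
  have "\<gamma> powr (- 1 + - 1) = \<gamma> powr (- 1) * \<gamma> powr (- 1)"
    by (rule powr_add)
  then show "\<gamma> powr (-2) = a ^ 4 / 4"
    unfolding 1 by (simp add: power2_eq_square power4_eq_xxxx)
  have "- real 2 / 2 = - 1"
    by simp
  then have "e\<^sup>2 = a\<^sup>2 / 2"
    using e[of 2] 1 by metis
  moreover have "0 \<le> a\<^sup>2"
    by simp
  ultimately have "(a / 2)\<^sup>2 \<le> e\<^sup>2"
    by (simp only: power_divide) simp
  then have "a / 2 \<le> e"
    by (rule power2_le_imp_le) (simp add: e_def)
  then have *: "(a / 2) ^ n \<le> e ^ n" for n
    using assms by (intro power_mono) auto
  show "a ^ 5 / 32 \<le> \<gamma> powr (-5/2)" "a ^ 7 / 128 \<le> \<gamma> powr (-7/2)"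
    using *[of 5] *[of 7] e[of 5] e[of 7] by (simp_all add: power_divide)
qed

theorem theorem3:
  shows "\<exists>C>0. \<exists>\<gamma>\<^sub>0\<ge>gamma_star. \<forall>\<gamma>>\<gamma>\<^sub>0.
    \<forall>(T :: ereal) (\<eta> :: real \<Rightarrow> real \<Rightarrow> real) (\<psi> :: real \<Rightarrow> real \<times> real \<Rightarrow> real)
      (r :: real \<Rightarrow> real) (t :: real).
      0 < t \<and> ereal t < T \<and>
      (bifurcating_curve solitary_wave \<gamma> T \<eta> \<psi> r \<or>
       (bifurcating_curve stokes_wave \<gamma> T \<eta> \<psi> r \<and> r t \<le> \<gamma> + sqrt (2 / \<gamma>))) \<longrightarrow>
      ((\<forall>x. vel_u (\<eta> t) (\<psi> t) (x, \<eta> t x) \<ge> \<gamma> * eta_min (\<eta> t) - C * \<gamma> powr (-5/2)) \<and>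
       \<bar>\<gamma> * eta_min (\<eta> t) - sqrt (2 * \<gamma>)\<bar> \<le> C * \<gamma> powr (-1)) \<and>
      ((\<forall>x. crest (\<eta> t) x \<longrightarrow>
          vel_u (\<eta> t) (\<psi> t) (x, \<eta> t x) \<ge> sqrt (2 * \<gamma>) - C * \<gamma> powr (-5/2)) \<and>
       eta_max (\<eta> t) \<le> sqrt (2 / \<gamma>) + C * \<gamma> powr (-7/2)) \<and>
      eta_max (\<eta> t) - eta_min (\<eta> t) \<le> C * \<gamma> powr (-2)"
proof (rule exI[of _ 200], rule conjI, simp, rule exI[of _ "max gamma_star 200"], rule conjI, simp, intro allI impI)
  \<comment> \<open>The constant is dictated by the surface velocity: \<open>6 * a ^ 5\<close> is at
    most \<open>6 * 32 = 192\<close> times \<open>\<gamma> powr (-5/2)\<close>. The threshold 200 is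
    the value of \<open>\<gamma>\<close> with \<open>a = 1 / 10\<close>, and the maximum secures
    \<open>gamma_star\<close> as a lower bound without evaluating it.\<close>
  fix \<gamma> :: real and T \<eta> \<psi> r and t :: real
  assume \<gamma>: "max gamma_star 200 < \<gamma>"
    and asm: "0 < t \<and> ereal t < T \<and>
      (bifurcating_curve solitary_wave \<gamma> T \<eta> \<psi> r \<or>
       (bifurcating_curve stokes_wave \<gamma> T \<eta> \<psi> r \<and> r t \<le> \<gamma> + sqrt (2 / \<gamma>)))"
  define a where "a = sqrt (2 / \<gamma>)"
  have \<gamma>200: "200 < \<gamma>"
    using \<gamma> by simp
  have a0: "0 < a" and a2: "a\<^sup>2 = 2 / \<gamma>"
    using \<gamma>200 by (auto simp: a_def)
  have "a\<^sup>2 \<le> (1 / 10)\<^sup>2"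
    unfolding a2 using \<gamma>200 by (simp add: divide_simps power2_eq_square)
  then have a10: "a \<le> 1 / 10"
    by (rule power2_le_imp_le) simp
  have \<gamma>a: "\<gamma> = 2 / a\<^sup>2"
    unfolding a2 using \<gamma>200 by simp
  have t: "0 < t" "ereal t < T"
    using asm by auto
  have crest: "\<eta> t x \<le> \<eta> t 0" for x
    using asm t by (auto simp: bifurcating_curve_def)
  have uni: "unidirectional (\<eta> t) (\<psi> t)"
    using asm t by (auto simp: bifurcating_curve_def)
  have "crest_wave \<gamma> (\<eta> t) (\<psi> t) (r t) a \<and> \<eta> t 0 \<le> a + a ^ 7 \<and> (\<forall>x. a - 2 * a ^ 4 \<le> \<eta> t x)"
    using asm
  proof (elim conjE disjE)
    assume c: "bifurcating_curve solitary_wave \<gamma> T \<eta> \<psi> r"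
    then have so: "solitary_wave \<gamma> (\<eta> t) (\<psi> t) (r t)"
      using t by (simp add: bifurcating_curve_def)
    have "\<eta> t 0 < a + a ^ 7"
      by (rule curve_crest_less[OF c t a0 \<gamma>a]) (rule solitary_crest_wave(1)[OF _ _ _ a0 a10 \<gamma>a], assumption+)
    then have h: "\<eta> t 0 \<le> a + a ^ 7"
      by simp
    show ?thesis
      using solitary_crest_wave[OF so uni crest a0 a10 \<gamma>a] h by blast
  next
    assume c: "bifurcating_curve stokes_wave \<gamma> T \<eta> \<psi> r" and r: "r t \<le> \<gamma> + sqrt (2 / \<gamma>)"
    then have st: "stokes_wave \<gamma> (\<eta> t) (\<psi> t) (r t)"
      using t by (simp add: bifurcating_curve_def)
    have "\<eta> t 0 < a + a ^ 7"
      by (rule curve_crest_less[OF c t a0 \<gamma>a]) (rule stokes_crest_wave(1)[OF _ _ _ a0 a10 \<gamma>a], assumption+)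
    then have h: "\<eta> t 0 \<le> a + a ^ 7"
      by simp
    have "r t \<le> 2 / a\<^sup>2 + a"
      using r by (simp add: a_def[symmetric] \<gamma>a[symmetric])
    then show ?thesis
      using stokes_crest_wave[OF st uni crest a0 a10 \<gamma>a] h by blast
  qed
  then have cw: "crest_wave \<gamma> (\<eta> t) (\<psi> t) (r t) a" and h: "\<eta> t 0 \<le> a + a ^ 7"
    and low: "\<And>x. a - 2 * a ^ 4 \<le> \<eta> t x"
    by auto
  interpret crest_wave \<gamma> "\<eta> t" "\<psi> t" "r t" a
    by (rule cw)
  define m where "m = eta_min (\<eta> t)"
  have m_le: "m \<le> \<eta> t x" for x
    unfolding m_def eta_min_def using low by (intro cINF_lower bdd_belowI2) auto
  have m_ge: "a - 2 * a ^ 4 \<le> m"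
    unfolding m_def eta_min_def using low by (intro cINF_greatest) auto
  have max: "eta_max (\<eta> t) = \<eta> t 0"
    by (rule eta_max_eq) (rule crest)
  note pw = powers_of_vorticity[OF a0 \<gamma>a]
  have sq: "sqrt (2 * \<gamma>) = 2 / a"
    using a0 by (intro real_sqrt_unique) (auto simp: \<gamma>a power_divide)
  have m_up: "m \<le> a + a ^ 7"
    using m_le[of 0] h by simp
  have pos: "0 \<le> a ^ 5" "0 \<le> a ^ 7" "0 \<le> a ^ 4"
    using a0 by auto
  have "\<gamma> * m - 200 * \<gamma> powr (-5/2) \<le> vel_u (\<eta> t) (\<psi> t) (x, \<eta> t x)" for x
    using velocity_ge[OF h m_le m_ge, of x] pw(3) pos unfolding vel_u_def by linarith
  moreover have "\<bar>\<gamma> * m - sqrt (2 * \<gamma>)\<bar> \<le> 200 * \<gamma> powr (-1)"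
  proof -
    have "\<gamma> * m - sqrt (2 * \<gamma>) = (2 / a\<^sup>2) * (m - a)"
      unfolding sq using a0 by (simp add: \<gamma>a field_simps power2_eq_square)
    moreover have "\<bar>m - a\<bar> \<le> 2 * a ^ 4"
      using m_ge m_up small_powers pos by linarith
    then have "(2 / a\<^sup>2) * \<bar>m - a\<bar> \<le> (2 / a\<^sup>2) * (2 * a ^ 4)"
      by (intro mult_left_mono) auto
    moreover have "(2 / a\<^sup>2) * (2 * a ^ 4) = 4 * a\<^sup>2"
      using a0 by (simp add: field_simps eval_nat_numeral)
    moreover have "\<bar>(2 / a\<^sup>2) * (m - a)\<bar> = (2 / a\<^sup>2) * \<bar>m - a\<bar>"
      by (subst abs_mult) simp
    moreover have "0 \<le> a\<^sup>2"
      by simp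
    ultimately show ?thesis
      unfolding pw(1) by linarith
  qed
  moreover have "sqrt (2 * \<gamma>) - 200 * \<gamma> powr (-5/2) \<le> vel_u (\<eta> t) (\<psi> t) (x, \<eta> t x)" if "crest (\<eta> t) x" for x
    using crest_velocity_ge[OF h that] pw(3) pos unfolding sq vel_u_def by linarith
  moreover have "eta_max (\<eta> t) \<le> sqrt (2 / \<gamma>) + 200 * \<gamma> powr (-7/2)"
    using h pw(4) pos unfolding max a_def[symmetric] by linarith
  moreover have "eta_max (\<eta> t) - m \<le> 200 * \<gamma> powr (-2)"
    using h m_ge small_powers pos unfolding max pw(2) by linarith
  ultimately show "((\<forall>x. vel_u (\<eta> t) (\<psi> t) (x, \<eta> t x) \<ge> \<gamma> * eta_min (\<eta> t) - 200 * \<gamma> powr (-5/2)) \<and>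
       \<bar>\<gamma> * eta_min (\<eta> t) - sqrt (2 * \<gamma>)\<bar> \<le> 200 * \<gamma> powr (-1)) \<and>
      ((\<forall>x. crest (\<eta> t) x \<longrightarrow>
          vel_u (\<eta> t) (\<psi> t) (x, \<eta> t x) \<ge> sqrt (2 * \<gamma>) - 200 * \<gamma> powr (-5/2)) \<and>
       eta_max (\<eta> t) \<le> sqrt (2 / \<gamma>) + 200 * \<gamma> powr (-7/2)) \<and>
      eta_max (\<eta> t) - eta_min (\<eta> t) \<le> 200 * \<gamma> powr (-2)"
    unfolding m_def by blast
qed

end
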